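(* Let $m\ge2$. (1) Let $q_1,\dots,q_m\in\mathbb{Z}_m[[x]]$ and let $\sigma$ be the cycle $(1,2,\dots,m)$. Then the (recursive) expression $$\alpha=(\alpha^{q_1},\dots,\alpha^{q_m})\sigma$$ is a well-defined automorphism of the $m$-ary tree, and the state-closure $A$ of $\langle\alpha\rangle$ is an abelian transitive group. The group $A^{*}$ is additively isomorphic to the quotient ring $\mathbb{Z}_m[[x]]/(r)$, where $$r=m-xq\quad\text{and}\quad q=q_1+\dots+q_m .$$ (2) Let $A$ be a transitive state-closed abelian group of degree $m$ such that $A^{*}$ is additively a cyclic $\mathbb{Z}_m[[x]]$-module. Then $P(A)$ is cyclic, say generated by $\sigma$, and $A^{*}$ is the state-diagonal-topological closure of an element of the form $\alpha=(\alpha^{q_1},\dots,\alpha^{q_m})\sigma$ for some $q_1,\dots,q_m\in\mathbb{Z}_m[[x]]$.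
   Context: Let $Y=\{1,\dots,m\}$. The vertices of the one-rooted $m$-ary tree $\mathcal{T}_m$ are the finite words over $Y$; $\mathcal{A}_m$ is its automorphism group, acting on the right. A permutation $\gamma\in \mathrm{Perm}(Y)$ is identified with the automorphism $yu\mapsto y^{\gamma}u$. Each $\alpha\in\mathcal{A}_m$ is uniquely written $\alpha=(\alpha_1,\dots,\alpha_m)\sigma(\alpha)$ with $\alpha_i\in\mathcal{A}_m$, $\sigma(\alpha)\in \mathrm{Perm}(Y)$, meaning $(iu)^{\alpha}=i^{\sigma(\alpha)}u^{\alpha_i}$. The states of $\alpha$ are the $\alpha_u$, $u$ a finite word, with $\alpha_{\emptyset}=\alpha$, $\alpha_{yu}=(\alpha_y)_u$. A subgroup $G\le\mathcal{A}_m$ is state-closed (of degree $m$) if all states of its elements lie in $G$; the state-closure of $G$ is the smallest state-closed subgroup containing $G$ (generated by all states of elements of $G$). $P(G)$ is the permutation group induced by $G$ on $Y$, and $G$ is transitive if $P(G)$ is transitive on $Y$. $\mathcal{A}_m$ is a topological group with the level stabilizers as a base of neighbourhoods of the identity, and $\overline{G}$ is the closure of $G$. Put $\alpha^{(0)}=\alpha$, $\alpha^{(1)}=(\alpha,\dots,\alpha)$, $\alpha^{(i+1)}=(\alpha^{(i)})^{(1)}$. The diagonal closure of $G$ is $\widetilde{G}=\langle G^{(i)}\mid i\ge 0\rangle$, and $A^{*}=\overline{\widetilde{A}}$ is the diagonal-topological closure. The state-diagonal-topological closure of an element $\alpha$ is $B^{*}$, where $B$ is the state-closure of $\langle\alpha\rangle$.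 $\mathbb{Z}_m=\varprojlim \mathbb{Z}/m^i\mathbb{Z}$ is the ring of $m$-adic integers. For $\xi\in\mathbb{Z}_m$, $\alpha^{\xi}=\lim\alpha^{n_k}$ for integers $n_k\to\xi$ $m$-adically, and for $q=\sum_{i\ge0}q_ix^i\in\mathbb{Z}_m[[x]]$, $\alpha^{q}=\alpha^{q_0}(\alpha^{q_1})^{(1)}(\alpha^{q_2})^{(2)}\cdots$. The expression $\alpha=(\alpha^{q_1},\dots,\alpha^{q_m})\sigma$ defines $\alpha$ recursively, level by level: its action on level 1 is $\sigma$, and its action on level $l$ is determined by its action on level $l-1$. For $A$ abelian, transitive and state-closed, $A^*$ is abelian and, written additively, is a $\mathbb{Z}_m[[x]]$-module through $\alpha\mapsto\alpha^{q}$ (so $x$ acts as $\alpha\mapsto\alpha^{(1)}$). *)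

theory Defs
  imports
    "HOL-Algebra.Sym_Groups"
    "HOL-Algebra.Elementary_Groups"
    "HOL-Algebra.QuotRing"
    "HOL-Algebra.Module"
    "HOL-Analysis.Abstract_Limits"
begin

section \<open>The rooted m-ary tree and its automorphism group\<close>

definition tree_words :: "nat \<Rightarrow> nat list set" where
  "tree_words m = lists {1..m}"

definition is_child :: "nat list \<Rightarrow> nat list \<Rightarrow> bool" where
  "is_child u v \<longleftrightarrow> (\<exists>y. v = u @ [y])"

text \<open>
  An automorphism is extended by the identity outside the vertex set, so that it is determined
  by its action on the tree.  Automorphisms act on the right, hence in a product the left factor
  acts first.
\<close>

definition tree_aut :: "nat \<Rightarrow> (nat list \<Rightarrow> nat list) monoid" where
  "tree_aut m =
    \<lparr>carrier = {\<alpha>. \<alpha> permutes tree_words m \<and> \<alpha> [] = [] \<and>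
        (\<forall>u\<in>tree_words m. \<forall>v\<in>tree_words m. is_child (\<alpha> u) (\<alpha> v) \<longleftrightarrow> is_child u v)},
     mult = (\<lambda>\<alpha> \<beta>. \<beta> \<circ> \<alpha>),
     one = id\<rparr>"

definition root_perm :: "nat \<Rightarrow> (nat list \<Rightarrow> nat list) \<Rightarrow> nat \<Rightarrow> nat" where
  "root_perm m \<alpha> y = (if y \<in> {1..m} then hd (\<alpha> [y]) else y)"

definition tree_comp :: "nat \<Rightarrow> (nat list \<Rightarrow> nat list) \<Rightarrow> nat \<Rightarrow> nat list \<Rightarrow> nat list" where
  "tree_comp m \<alpha> y u = (if u \<in> tree_words m then tl (\<alpha> (y # u)) else u)"

text \<open>\<open>tree_cons m \<beta> \<sigma>\<close> is the automorphism \<open>(\<beta> 1, \<dots>, \<beta> m) \<sigma>\<close>.\<close>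

definition tree_cons ::
    "nat \<Rightarrow> (nat \<Rightarrow> nat list \<Rightarrow> nat list) \<Rightarrow> (nat \<Rightarrow> nat) \<Rightarrow> nat list \<Rightarrow> nat list" where
  "tree_cons m \<beta> \<sigma> w =
    (case w of [] \<Rightarrow> [] | y # u \<Rightarrow> if w \<in> tree_words m then \<sigma> y # \<beta> y u else w)"

primrec tree_state :: "nat \<Rightarrow> (nat list \<Rightarrow> nat list) \<Rightarrow> nat list \<Rightarrow> nat list \<Rightarrow> nat list" where
  "tree_state m \<alpha> [] = \<alpha>"
| "tree_state m \<alpha> (y # u) = tree_state m (tree_comp m \<alpha> y) u"

definition diag_map :: "nat \<Rightarrow> (nat list \<Rightarrow> nat list) \<Rightarrow> nat list \<Rightarrow> nat list" where
  "diag_map m \<alpha> = tree_cons m (\<lambda>_. \<alpha>) id"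

section \<open>State-closed groups and closures\<close>

definition state_closed :: "nat \<Rightarrow> (nat list \<Rightarrow> nat list) set \<Rightarrow> bool" where
  "state_closed m G \<longleftrightarrow>
    subgroup G (tree_aut m) \<and> (\<forall>\<alpha>\<in>G. \<forall>u\<in>tree_words m. tree_state m \<alpha> u \<in> G)"

definition state_closure ::
    "nat \<Rightarrow> (nat list \<Rightarrow> nat list) set \<Rightarrow> (nat list \<Rightarrow> nat list) set" where
  "state_closure m G = \<Inter>{H. state_closed m H \<and> G \<subseteq> H}"

definition perm_group :: "nat \<Rightarrow> (nat list \<Rightarrow> nat list) set \<Rightarrow> (nat \<Rightarrow> nat) set" where
  "perm_group m G = root_perm m ` G"

definition transitive_on_level1 :: "nat \<Rightarrow> (nat list \<Rightarrow> nat list) set \<Rightarrow> bool" where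
  "transitive_on_level1 m G \<longleftrightarrow>
    (\<forall>x\<in>{1..m}. \<forall>y\<in>{1..m}. \<exists>\<gamma>\<in>perm_group m G. \<gamma> x = y)"

definition level_stab :: "nat \<Rightarrow> nat \<Rightarrow> (nat list \<Rightarrow> nat list) set" where
  "level_stab m l =
    {\<alpha> \<in> carrier (tree_aut m). \<forall>u\<in>tree_words m. length u = l \<longrightarrow> \<alpha> u = u}"

definition tree_topology :: "nat \<Rightarrow> (nat list \<Rightarrow> nat list) topology" where
  "tree_topology m = topology_generated_by
    {\<alpha> <#\<^bsub>tree_aut m\<^esub> level_stab m l | \<alpha> l. \<alpha> \<in> carrier (tree_aut m)}"

definition diag_closure ::
    "nat \<Rightarrow> (nat list \<Rightarrow> nat list) set \<Rightarrow> (nat list \<Rightarrow> nat list) set" where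
  "diag_closure m G = generate (tree_aut m) (\<Union>i. (diag_map m ^^ i) ` G)"

definition diag_top_closure ::
    "nat \<Rightarrow> (nat list \<Rightarrow> nat list) set \<Rightarrow> (nat list \<Rightarrow> nat list) set" where
  "diag_top_closure m G = tree_topology m closure_of diag_closure m G"

definition elt_state_closure ::
    "nat \<Rightarrow> (nat list \<Rightarrow> nat list) \<Rightarrow> (nat list \<Rightarrow> nat list) set" where
  "elt_state_closure m \<alpha> = state_closure m (generate (tree_aut m) {\<alpha>})"

section \<open>m-adic integers and formal power series\<close>

text \<open>
  An m-adic integer is the compatible family of its residues: \<open>f i\<close> is the residue modulo
  \<open>m ^ i\<close>.
\<close>

definition madic_ring :: "nat \<Rightarrow> (nat \<Rightarrow> int) ring" where
  "madic_ring m =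
    \<lparr>carrier = {f. \<forall>i. f i \<in> {0..<int m ^ i} \<and> f (Suc i) mod int m ^ i = f i},
     mult = (\<lambda>f g i. (f i * g i) mod int m ^ i),
     one = (\<lambda>i. 1 mod int m ^ i),
     zero = (\<lambda>i. 0),
     add = (\<lambda>f g i. (f i + g i) mod int m ^ i)\<rparr>"

definition madic_tendsto :: "nat \<Rightarrow> (nat \<Rightarrow> int) \<Rightarrow> (nat \<Rightarrow> int) \<Rightarrow> bool" where
  "madic_tendsto m n \<xi> \<longleftrightarrow> (\<forall>i. \<forall>\<^sub>F k in sequentially. n k mod int m ^ i = \<xi> i)"

definition fps_ring :: "('a, 'b) ring_scheme \<Rightarrow> (nat \<Rightarrow> 'a) ring" where
  "fps_ring R =
    \<lparr>carrier = UNIV \<rightarrow> carrier R,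
     mult = (\<lambda>p q n. \<Oplus>\<^bsub>R\<^esub>i\<in>{..n}. p i \<otimes>\<^bsub>R\<^esub> q (n - i)),
     one = (\<lambda>n. if n = 0 then \<one>\<^bsub>R\<^esub> else \<zero>\<^bsub>R\<^esub>),
     zero = (\<lambda>n. \<zero>\<^bsub>R\<^esub>),
     add = (\<lambda>p q n. p n \<oplus>\<^bsub>R\<^esub> q n)\<rparr>"

definition fps_var :: "('a, 'b) ring_scheme \<Rightarrow> nat \<Rightarrow> 'a" where
  "fps_var R = (\<lambda>n. if n = 1 then \<one>\<^bsub>R\<^esub> else \<zero>\<^bsub>R\<^esub>)"

abbreviation madic_fps :: "nat \<Rightarrow> (nat \<Rightarrow> nat \<Rightarrow> int) ring" where
  "madic_fps m \<equiv> fps_ring (madic_ring m)"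

section \<open>Powers with exponents in the m-adic integers and in the power series ring\<close>

text \<open>
  Such powers need not exist for an arbitrary automorphism (already \<open>\<alpha>\<^sup>\<xi>\<close> may fail to exist), so
  they are introduced as relations that include the convergence of all the limits involved.
\<close>

definition has_madic_pow ::
    "nat \<Rightarrow> (nat list \<Rightarrow> nat list) \<Rightarrow> (nat \<Rightarrow> int) \<Rightarrow> (nat list \<Rightarrow> nat list) \<Rightarrow> bool" where
  "has_madic_pow m \<alpha> \<xi> \<beta> \<longleftrightarrow>
    (\<forall>n :: nat \<Rightarrow> int. madic_tendsto m n \<xi> \<longrightarrow>
      limitin (tree_topology m) (\<lambda>k. \<alpha> [^]\<^bsub>tree_aut m\<^esub> n k) \<beta> sequentially)"

primrec diag_partial_prod ::
    "nat \<Rightarrow> (nat \<Rightarrow> nat list \<Rightarrow> nat list) \<Rightarrow> nat \<Rightarrow> nat list \<Rightarrow> nat list" where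
  "diag_partial_prod m \<gamma> 0 = \<one>\<^bsub>tree_aut m\<^esub>"
| "diag_partial_prod m \<gamma> (Suc k) =
    diag_partial_prod m \<gamma> k \<otimes>\<^bsub>tree_aut m\<^esub> (diag_map m ^^ k) (\<gamma> k)"

definition has_fps_pow ::
    "nat \<Rightarrow> (nat list \<Rightarrow> nat list) \<Rightarrow> (nat \<Rightarrow> nat \<Rightarrow> int) \<Rightarrow> (nat list \<Rightarrow> nat list) \<Rightarrow> bool" where
  "has_fps_pow m \<alpha> q \<beta> \<longleftrightarrow>
    (\<exists>\<gamma>. (\<forall>i. has_madic_pow m \<alpha> (q i) (\<gamma> i)) \<and>
      limitin (tree_topology m) (diag_partial_prod m \<gamma>) \<beta> sequentially)"

definition fps_pow ::
    "nat \<Rightarrow> (nat list \<Rightarrow> nat list) \<Rightarrow> (nat \<Rightarrow> nat \<Rightarrow> int) \<Rightarrow> nat list \<Rightarrow> nat list" where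
  "fps_pow m \<alpha> q = (THE \<beta>. has_fps_pow m \<alpha> q \<beta>)"

text \<open>
  \<open>tree_rec m q \<sigma> \<alpha>\<close> says that \<open>\<alpha>\<close> is an automorphism for which all the powers below exist and
  that it satisfies \<open>\<alpha> = (\<alpha>\<^bsup>q 1\<^esup>, \<dots>, \<alpha>\<^bsup>q m\<^esup>) \<sigma>\<close>.
\<close>

definition tree_rec ::
    "nat \<Rightarrow> (nat \<Rightarrow> nat \<Rightarrow> nat \<Rightarrow> int) \<Rightarrow> (nat \<Rightarrow> nat) \<Rightarrow> (nat list \<Rightarrow> nat list) \<Rightarrow> bool" where
  "tree_rec m q \<sigma> \<alpha> \<longleftrightarrow> \<alpha> \<in> carrier (tree_aut m) \<and>
    (\<exists>\<beta>. (\<forall>y\<in>{1..m}. has_fps_pow m \<alpha> (q y) (\<beta> y)) \<and> \<alpha> = tree_cons m \<beta> \<sigma>)"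

text \<open>
  The closure \<open>A\<^sup>*\<close>, written additively, with its power series action.  The field \<open>mult\<close> plays no
  role in a module; \<open>mult\<close> and \<open>one\<close> are filled in arbitrarily.
\<close>

definition closure_module ::
    "nat \<Rightarrow> (nat list \<Rightarrow> nat list) set \<Rightarrow> (nat \<Rightarrow> nat \<Rightarrow> int, nat list \<Rightarrow> nat list) module" where
  "closure_module m A =
    \<lparr>carrier = diag_top_closure m A,
     mult = (\<otimes>\<^bsub>tree_aut m\<^esub>),
     one = \<one>\<^bsub>tree_aut m\<^esub>,
     zero = \<one>\<^bsub>tree_aut m\<^esub>,
     add = (\<otimes>\<^bsub>tree_aut m\<^esub>),
     smult = (\<lambda>q \<alpha>. fps_pow m \<alpha> q)\<rparr>"

text \<open>Cyclicity only; that \<open>M\<close> is an \<open>R\<close>-module is not part of the definition.\<close>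

definition cyclic_module :: "('a, 'b) ring_scheme \<Rightarrow> ('a, 'c) module \<Rightarrow> bool" where
  "cyclic_module R M \<longleftrightarrow>
    (\<exists>a\<in>carrier M. carrier M = {q \<odot>\<^bsub>M\<^esub> a | q. q \<in> carrier R})"

end

theory Submission
  imports
    Defs
    "HOL-Algebra.Multiplicative_Group"
    "HOL-Computational_Algebra.Formal_Power_Series"
begin

text \<open>
  An automorphism of the tree is determined by its actions on the finite levels, and convergence
  is stabilization of the action on every level.  So everything is proved level by level, through
  the relation \<open>agree l\<close> of acting alike on words of length at most \<open>l\<close>.

  \<^emph>\<open>Powers in \<open>A\<^sup>*\<close>.\<close>  Let \<open>A\<close> be abelian, transitive and state-closed, and \<open>C = A\<^sup>*\<close>.  Then \<open>C\<close> is abelian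
  and state-closed too (\<open>state_abelian_diag_top_closure\<close>).  Commuting with elements that move the letter 1 to an arbitrary
  letter forces an element of \<open>C\<close> with trivial root permutation to have equal states, that is, to
  be a diagonal \<open>\<gamma>\<^sup>(\<^sup>1\<^sup>)\<close> with \<open>\<gamma>\<close> in \<open>C\<close> (\<open>trivial_root_diag\<close>).  This has two consequences.  As \<open>P(C)\<close> is
  regular of order \<open>m\<close>, every \<open>\<gamma>\<^sup>m\<close> is a diagonal, so \<open>\<gamma>\<close> to the power \<open>m\<^sup>l\<close> is trivial on level \<open>l\<close>, and
  \<open>\<gamma>\<^sup>q\<close> exists for all power series \<open>q\<close> over the m-adic integers (\<open>fps_pow_exists\<close>).  And if the root
  permutation of \<open>\<alpha>\<close> in \<open>C\<close> generates \<open>P(C)\<close>, then every element of \<open>C\<close> has a digit expansion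
  \<open>\<alpha>\<^sup>n\<^sup>0 (\<alpha>\<^sup>n\<^sup>1)\<^sup>(\<^sup>1\<^sup>) (\<alpha>\<^sup>n\<^sup>2)\<^sup>(\<^sup>2\<^sup>) \<dots>\<close> with integers \<open>n\<^sub>i\<close>, and thus is a power of \<open>\<alpha>\<close> (\<open>fps_pow_generates\<close>).

  \<^emph>\<open>The second part\<close> follows (\<open>cyclic_module_structure\<close>).  If \<open>a\<close> generates the module \<open>A\<^sup>*\<close>, its root permutation
  generates \<open>P(A)\<close>.  For any generator \<open>\<sigma>\<close> of \<open>P(A)\<close>, an element \<open>\<alpha>\<close> of \<open>A\<close> with root permutation \<open>\<sigma>\<close> has
  all of \<open>A\<^sup>*\<close>, and in particular its own states, among its powers.

  \<^emph>\<open>The first part.\<close>  To solve \<open>\<alpha> = (\<alpha>\<^sup>q\<^sup>1, \<dots>, \<alpha>\<^sup>q\<^sup>m)\<sigma>\<close>, the action of all the future powers \<open>\<alpha>\<^sup>p\<close> is written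
  down at once.  Let \<open>c(t) = q\<^sub>1 + \<dots> + q\<^sub>t\<close>, continued m-periodically.  A series \<open>p\<close> with constant
  coefficient \<open>n\<close> and shift \<open>p'\<close> rotates the letter \<open>y\<close> by \<open>n\<close> and acts on the rest of the word by the
  series \<open>c(y - 1 + n) - c(y - 1) + p'\<close> (\<open>act\<close>).  The sums telescope, so this is an action of the
  additive group (\<open>act_add\<close>); on level \<open>l\<close> it depends only on residues modulo \<open>m\<^sup>l\<close> (\<open>act_cong\<close>), so it
  can be defined with integer series and extended to m-adic coefficients (\<open>adic_act\<close>).  The series 1
  acts by a solution \<open>\<alpha>\<close> of the recursion, \<open>p\<close> acts by \<open>\<alpha>\<^sup>p\<close> (\<open>has_fps_pow_root_gen\<close>), and the digit
  expansion identifies the group of all these powers with \<open>A\<^sup>*\<close> (\<open>root_gen_diag_top_closure\<close>).  The series \<open>r = m - x q\<close>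
  acts trivially: \<open>m\<close> rotations return to the initial letter and collect the sum \<open>q\<close>.  Conversely, if \<open>p\<close>
  acts trivially then \<open>m\<close> divides its constant coefficient, so that \<open>p = s r + x p\<^sub>1\<close>, where \<open>p\<^sub>1\<close> again acts
  trivially; iterating this division shows that \<open>p\<close> is a multiple of \<open>r\<close> (\<open>adic_act_kernel\<close>).  So \<open>A\<^sup>*\<close> is
  the quotient by \<open>(r)\<close> (\<open>root_gen_quotient_iso\<close>).
\<close>

section \<open>Automorphisms of the rooted tree\<close>

locale m_ary_tree =
  fixes m :: nat
  assumes m_ge_2: "m \<ge> 2"
begin

abbreviation words ("W") where "W \<equiv> tree_words m"
abbreviation letters ("Y") where "Y \<equiv> {1..m}"
abbreviation auts ("\<A>") where "\<A> \<equiv> tree_aut m"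
abbreviation "rt \<equiv> root_perm m"
abbreviation "cmp \<equiv> tree_comp m"
abbreviation "diag \<equiv> diag_map m"

lemma words_simps [simp]:
  "[] \<in> W" "y # u \<in> W \<longleftrightarrow> y \<in> Y \<and> u \<in> W" "u @ v \<in> W \<longleftrightarrow> u \<in> W \<and> v \<in> W"
  by (auto simp: tree_words_def)

lemma tree_aut_mult [simp]: "\<alpha> \<otimes>\<^bsub>\<A>\<^esub> \<beta> = \<beta> \<circ> \<alpha>"
  and tree_aut_one [simp]: "\<one>\<^bsub>\<A>\<^esub> = id"
  by (simp_all add: tree_aut_def)

text \<open>
  The one-letter extension property is all that is needed of a map in order that it preserve
  words, lengths and the child relation, so it is the convenient way to build automorphisms
  (\<open>tree_autI\<close>): one exhibits a two-sided inverse with the same property.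
\<close>

definition extends_words :: "(nat list \<Rightarrow> nat list) \<Rightarrow> bool" where
  "extends_words \<alpha> \<longleftrightarrow>
    \<alpha> [] = [] \<and> (\<forall>u\<in>W. \<forall>y\<in>Y. \<exists>z\<in>Y. \<alpha> (u @ [y]) = \<alpha> u @ [z])"

lemma extends_words_in_words:
  assumes "extends_words \<alpha>" "u \<in> W"
  shows "\<alpha> u \<in> W" "length (\<alpha> u) = length u"
proof -
  have "\<alpha> u \<in> W \<and> length (\<alpha> u) = length u"
    using assms(2)
  proof (induction u rule: rev_induct)
    case Nil
    then show ?case using assms(1) unfolding extends_words_def by simp
  next
    case (snoc y u)
    then have "u \<in> W" "y \<in> Y" by simp_all
    then obtain z where "z \<in> Y" "\<alpha> (u @ [y]) = \<alpha> u @ [z]"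
      using assms(1) unfolding extends_words_def by blast
    with snoc.IH \<open>u \<in> W\<close> show ?case by simp
  qed
  then show "\<alpha> u \<in> W" "length (\<alpha> u) = length u" by auto
qed

lemma extends_words_is_child:
  assumes "extends_words \<alpha>" "u \<in> W" "v \<in> W" "is_child u v"
  shows "is_child (\<alpha> u) (\<alpha> v)"
proof -
  from assms obtain y where "v = u @ [y]" "y \<in> Y" by (auto simp: is_child_def)
  with assms show ?thesis unfolding extends_words_def is_child_def by metis
qed

lemma tree_autI:
  assumes "extends_words \<alpha>" "extends_words \<beta>"
    and "\<And>u. u \<in> W \<Longrightarrow> \<beta> (\<alpha> u) = u" "\<And>u. u \<in> W \<Longrightarrow> \<alpha> (\<beta> u) = u"
    and "\<And>u. u \<notin> W \<Longrightarrow> \<alpha> u = u"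
  shows "\<alpha> \<in> carrier \<A>"
proof -
  have "bij_betw \<alpha> W W"
    by (rule bij_betw_byWitness[where f' = \<beta>])
       (use assms(3,4) extends_words_in_words(1)[OF assms(1)] extends_words_in_words(1)[OF assms(2)]
        in blast)+
  then have perm: "\<alpha> permutes W"
    using assms(5) by (rule bij_imp_permutes)
  have "is_child (\<alpha> u) (\<alpha> v) \<longleftrightarrow> is_child u v" if "u \<in> W" "v \<in> W" for u v
    using that assms extends_words_in_words extends_words_is_child by metis
  with perm show ?thesis
    using assms(1) by (simp add: tree_aut_def extends_words_def)
qed

lemma tree_aut_extends_words:
  assumes "\<alpha> \<in> carrier \<A>"
  shows "extends_words \<alpha>"
proof -
  have \<alpha>: "\<alpha> permutes W" "\<alpha> [] = []"
    "\<And>u v. u \<in> W \<Longrightarrow> v \<in> W \<Longrightarrow> is_child (\<alpha> u) (\<alpha> v) \<longleftrightarrow> is_child u v"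
    using assms by (auto simp: tree_aut_def)
  have "\<exists>z\<in>Y. \<alpha> (u @ [y]) = \<alpha> u @ [z]" if "u \<in> W" "y \<in> Y" for u y
  proof -
    have "is_child (\<alpha> u) (\<alpha> (u @ [y]))"
      using \<alpha>(3)[of u "u @ [y]"] that by (simp add: is_child_def)
    then obtain z where "\<alpha> (u @ [y]) = \<alpha> u @ [z]" by (auto simp: is_child_def)
    moreover have "\<alpha> (u @ [y]) \<in> W"
      using that by (subst permutes_in_image[OF \<alpha>(1)]) simp
    ultimately show ?thesis by auto
  qed
  with \<alpha>(2) show ?thesis by (simp add: extends_words_def)
qed

lemma tree_aut_Nil: "\<alpha> \<in> carrier \<A> \<Longrightarrow> \<alpha> [] = []"
  and tree_aut_in_words: "\<alpha> \<in> carrier \<A> \<Longrightarrow> u \<in> W \<Longrightarrow> \<alpha> u \<in> W"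
  and tree_aut_length: "\<alpha> \<in> carrier \<A> \<Longrightarrow> u \<in> W \<Longrightarrow> length (\<alpha> u) = length u"
  using tree_aut_extends_words extends_words_in_words extends_words_def by blast+

lemma tree_aut_outside: "\<alpha> \<in> carrier \<A> \<Longrightarrow> u \<notin> W \<Longrightarrow> \<alpha> u = u"
  unfolding tree_aut_def by (auto dest: permutes_not_in)

lemma tree_aut_eqI:
  assumes "\<alpha> \<in> carrier \<A>" "\<beta> \<in> carrier \<A>" "\<And>u. u \<in> W \<Longrightarrow> \<alpha> u = \<beta> u"
  shows "\<alpha> = \<beta>"
  using assms tree_aut_outside by (metis ext)

lemma extends_words_comp:
  "extends_words \<alpha> \<Longrightarrow> extends_words \<beta> \<Longrightarrow> extends_words (\<beta> \<circ> \<alpha>)"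
  using extends_words_in_words(1) unfolding extends_words_def by (metis comp_apply)

lemma tree_aut_inverse_exists:
  assumes "\<alpha> \<in> carrier \<A>"
  obtains \<beta> where "\<beta> \<in> carrier \<A>" "\<beta> \<circ> \<alpha> = id" "\<alpha> \<circ> \<beta> = id"
proof -
  define \<beta> where "\<beta> = inv' \<alpha>"
  have perm: "\<alpha> permutes W" using assms by (simp add: tree_aut_def)
  have inv: "\<beta> (\<alpha> u) = u" "\<alpha> (\<beta> u) = u" for u
    using permutes_inverses[OF perm] by (simp_all add: \<beta>_def)
  have \<beta>: "\<beta> permutes W" using perm by (simp add: \<beta>_def permutes_inv)
  have "is_child (\<beta> u) (\<beta> v) \<longleftrightarrow> is_child u v" if "u \<in> W" "v \<in> W" for u v
  proof -
    have "\<beta> u \<in> W" "\<beta> v \<in> W" using that permutes_in_image[OF \<beta>] by auto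
    with assms have "is_child (\<alpha> (\<beta> u)) (\<alpha> (\<beta> v)) \<longleftrightarrow> is_child (\<beta> u) (\<beta> v)"
      by (simp add: tree_aut_def)
    then show ?thesis by (simp add: inv)
  qed
  moreover have "\<beta> [] = []" using inv(1)[of "[]"] tree_aut_Nil[OF assms] by simp
  ultimately have "\<beta> \<in> carrier \<A>" using \<beta> by (simp add: tree_aut_def)
  with inv show ?thesis by (intro that[of \<beta>]) (auto simp: fun_eq_iff)
qed

lemma id_tree_aut [simp]: "id \<in> carrier \<A>"
  by (simp add: tree_aut_def permutes_id)

declare tree_aut_Nil [simp] tree_aut_in_words [simp] tree_aut_length [simp]

lemma tree_aut_comp_closed:
  assumes "\<alpha> \<in> carrier \<A>" "\<beta> \<in> carrier \<A>"
  shows "\<beta> \<circ> \<alpha> \<in> carrier \<A>"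
proof -
  obtain \<alpha>' where \<alpha>': "\<alpha>' \<in> carrier \<A>" "\<alpha>' \<circ> \<alpha> = id" "\<alpha> \<circ> \<alpha>' = id"
    using tree_aut_inverse_exists[OF assms(1)] .
  obtain \<beta>' where \<beta>': "\<beta>' \<in> carrier \<A>" "\<beta>' \<circ> \<beta> = id" "\<beta> \<circ> \<beta>' = id"
    using tree_aut_inverse_exists[OF assms(2)] .
  show ?thesis
  proof (rule tree_autI[where \<beta> = "\<alpha>' \<circ> \<beta>'"])
    show "extends_words (\<beta> \<circ> \<alpha>)" "extends_words (\<alpha>' \<circ> \<beta>')"
      using assms \<alpha>' \<beta>' by (blast intro: extends_words_comp tree_aut_extends_words)+
  qed (use assms \<alpha>' \<beta>' in \<open>auto simp: fun_eq_iff tree_aut_outside\<close>)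
qed

sublocale G: group "tree_aut m"
proof (rule groupI)
  show "\<exists>\<beta>\<in>carrier \<A>. \<beta> \<otimes>\<^bsub>\<A>\<^esub> \<alpha> = \<one>\<^bsub>\<A>\<^esub>" if "\<alpha> \<in> carrier \<A>" for \<alpha>
    using tree_aut_inverse_exists[OF that] by (metis tree_aut_mult tree_aut_one)
qed (auto intro: tree_aut_comp_closed simp del: o_apply simp: comp_assoc)

lemma inv_comp [simp]:
  assumes "\<alpha> \<in> carrier \<A>"
  shows "\<alpha> \<circ> inv\<^bsub>\<A>\<^esub> \<alpha> = id" "inv\<^bsub>\<A>\<^esub> \<alpha> \<circ> \<alpha> = id"
  using G.l_inv[OF assms] G.r_inv[OF assms] by simp_all

lemma inv_apply [simp]:
  assumes "\<alpha> \<in> carrier \<A>"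
  shows "\<alpha> ((inv\<^bsub>\<A>\<^esub> \<alpha>) u) = u" "(inv\<^bsub>\<A>\<^esub> \<alpha>) (\<alpha> u) = u"
  using G.l_inv[OF assms] G.r_inv[OF assms] by (auto simp: fun_eq_iff)

lemma tree_aut_prefix:
  assumes "\<alpha> \<in> carrier \<A>" "u \<in> W" "v \<in> W"
  obtains w where "w \<in> W" "length w = length v" "\<alpha> (u @ v) = \<alpha> u @ w"
proof -
  have "\<exists>w. \<alpha> (u @ v) = \<alpha> u @ w"
    using assms(3)
  proof (induction v rule: rev_induct)
    case (snoc y v)
    then obtain z where "\<alpha> ((u @ v) @ [y]) = \<alpha> (u @ v) @ [z]"
      using tree_aut_extends_words[OF assms(1)] assms(2)
      unfolding extends_words_def by (metis words_simps(2,3))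
    with snoc show ?case by auto
  qed simp
  then obtain w where w: "\<alpha> (u @ v) = \<alpha> u @ w" by blast
  have "\<alpha> (u @ v) \<in> W" "length (\<alpha> (u @ v)) = length (u @ v)"
    using assms by simp_all
  with w assms show ?thesis by (intro that[of w]) auto
qed

lemma tree_aut_letter:
  assumes "\<alpha> \<in> carrier \<A>" "y \<in> Y"
  shows "\<alpha> [y] = [rt \<alpha> y]" "rt \<alpha> y \<in> Y"
proof -
  obtain w where w: "w \<in> W" "length w = length [y]" "\<alpha> ([] @ [y]) = \<alpha> [] @ w"
    using assms by (elim tree_aut_prefix[of \<alpha> "[]" "[y]"]) auto
  then obtain z where "w = [z]" by (auto simp: length_Suc_conv)
  with w assms show "\<alpha> [y] = [rt \<alpha> y]" "rt \<alpha> y \<in> Y"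
    by (auto simp: root_perm_def)
qed

lemma tree_aut_Cons:
  assumes "\<alpha> \<in> carrier \<A>" "y \<in> Y" "u \<in> W"
  shows "\<alpha> (y # u) = rt \<alpha> y # cmp \<alpha> y u"
proof -
  obtain w where "\<alpha> ([y] @ u) = \<alpha> [y] @ w"
    using assms by (elim tree_aut_prefix[of \<alpha> "[y]" u]) auto
  with assms tree_aut_letter[OF assms(1,2)] show ?thesis
    by (simp add: tree_comp_def)
qed

section \<open>Root permutations, first-level states and diagonals\<close>

lemma root_perm_outside: "y \<notin> Y \<Longrightarrow> rt \<alpha> y = y"
  by (auto simp: root_perm_def)

lemma root_perm_id [simp]: "rt id = id"
  by (auto simp: root_perm_def)

lemma tree_comp_id [simp]: "cmp id y = id"
  by (auto simp: tree_comp_def)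

text \<open>
  Together with \<open>tree_comp_comp\<close> this is the multiplication rule of the wreath recursion,
  \<open>(\<alpha>\<beta>)\<^sub>y = \<alpha>\<^sub>y \<beta>\<^sub>z\<close> with \<open>z\<close> the image of \<open>y\<close> under the root permutation of \<open>\<alpha>\<close>.
\<close>

lemma root_perm_comp:
  assumes "\<alpha> \<in> carrier \<A>" "\<beta> \<in> carrier \<A>"
  shows "rt (\<beta> \<circ> \<alpha>) = rt \<beta> \<circ> rt \<alpha>"
proof
  fix y
  show "rt (\<beta> \<circ> \<alpha>) y = (rt \<beta> \<circ> rt \<alpha>) y"
  proof (cases "y \<in> Y")
    case True
    have "[rt (\<beta> \<circ> \<alpha>) y] = (\<beta> \<circ> \<alpha>) [y]"
      using tree_aut_letter(1)[OF tree_aut_comp_closed[OF assms] True] by simp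
    also have "\<dots> = [rt \<beta> (rt \<alpha> y)]"
      using tree_aut_letter[OF assms(1) True] tree_aut_letter(1)[OF assms(2)] by simp
    finally show ?thesis by simp
  qed (simp add: root_perm_outside)
qed

lemma tree_comp_comp:
  assumes "\<alpha> \<in> carrier \<A>" "\<beta> \<in> carrier \<A>" "y \<in> Y"
  shows "cmp (\<beta> \<circ> \<alpha>) y = cmp \<beta> (rt \<alpha> y) \<circ> cmp \<alpha> y"
proof
  fix u
  show "cmp (\<beta> \<circ> \<alpha>) y u = (cmp \<beta> (rt \<alpha> y) \<circ> cmp \<alpha> y) u"
  proof (cases "u \<in> W")
    case True
    have 1: "\<alpha> (y # u) = rt \<alpha> y # cmp \<alpha> y u" "rt \<alpha> y \<in> Y"
      using assms True tree_aut_letter by (auto simp: tree_aut_Cons)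
    have "\<alpha> (y # u) \<in> W" using assms True by simp
    then have "cmp \<alpha> y u \<in> W" by (simp add: 1)
    with 1 True show ?thesis by (simp add: tree_comp_def)
  qed (simp add: tree_comp_def)
qed

lemma root_perm_permutes:
  assumes "\<alpha> \<in> carrier \<A>"
  shows "rt \<alpha> permutes Y"
proof -
  have 1: "rt (inv\<^bsub>\<A>\<^esub> \<alpha>) \<circ> rt \<alpha> = id" "rt \<alpha> \<circ> rt (inv\<^bsub>\<A>\<^esub> \<alpha>) = id"
    using assms by (simp_all flip: root_perm_comp)
  have "bij (rt \<alpha>)" using o_bij[OF 1] .
  then show ?thesis
    using assms by (auto simp: permutes_def root_perm_outside bij_iff)
qed

lemma extends_words_tree_comp:
  assumes "\<alpha> \<in> carrier \<A>" "y \<in> Y"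
  shows "extends_words (cmp \<alpha> y)"
  unfolding extends_words_def
proof (intro conjI ballI)
  show "cmp \<alpha> y [] = []" using assms tree_aut_letter[OF assms] by (simp add: tree_comp_def)
next
  fix u z assume uz: "u \<in> W" "z \<in> Y"
  then obtain x where x: "x \<in> Y" "\<alpha> ((y # u) @ [z]) = \<alpha> (y # u) @ [x]"
    using tree_aut_extends_words[OF assms(1)] assms(2)
    unfolding extends_words_def by (metis words_simps(2))
  with assms uz have "cmp \<alpha> y (u @ [z]) = cmp \<alpha> y u @ [x]"
    by (simp add: tree_aut_Cons)
  with x(1) show "\<exists>x\<in>Y. cmp \<alpha> y (u @ [z]) = cmp \<alpha> y u @ [x]" by blast
qed

text \<open>
  The inverse of the state at \<open>y\<close> is the state of \<open>\<alpha>\<inverse>\<close> at the image of \<open>y\<close>.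
\<close>

lemma tree_comp_closed:
  assumes "\<alpha> \<in> carrier \<A>"
  shows "cmp \<alpha> y \<in> carrier \<A>"
proof (cases "y \<in> Y")
  case True
  let ?\<beta> = "inv\<^bsub>\<A>\<^esub> \<alpha>"
  have \<beta>: "?\<beta> \<in> carrier \<A>" using assms by simp
  have root: "rt \<alpha> y \<in> Y" using assms True tree_aut_letter by blast
  have root_inv: "rt ?\<beta> (rt \<alpha> y) = y"
    using root_perm_comp[OF assms \<beta>] assms by (simp add: fun_eq_iff)
  have "cmp ?\<beta> (rt \<alpha> y) \<circ> cmp \<alpha> y = id" "cmp \<alpha> y \<circ> cmp ?\<beta> (rt \<alpha> y) = id"
    using tree_comp_comp[OF assms \<beta> True] tree_comp_comp[OF \<beta> assms root] assms root_inv by simp_all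
  then have "cmp ?\<beta> (rt \<alpha> y) (cmp \<alpha> y u) = u" "cmp \<alpha> y (cmp ?\<beta> (rt \<alpha> y) u) = u" for u
    by (simp_all add: pointfree_idE)
  then show ?thesis
    by (rule tree_autI[OF extends_words_tree_comp[OF assms True] extends_words_tree_comp[OF \<beta> root]])
       (simp add: tree_comp_def)
next
  case False
  then have "cmp \<alpha> y = id" using assms by (auto simp: tree_comp_def tree_aut_outside)
  then show ?thesis by simp
qed

lemma tree_cons_root_comp:
  assumes "\<alpha> \<in> carrier \<A>"
  shows "\<alpha> = tree_cons m (cmp \<alpha>) (rt \<alpha>)"
proof
  fix w show "\<alpha> w = tree_cons m (cmp \<alpha>) (rt \<alpha>) w"
    using assms by (cases w) (auto simp: tree_cons_def tree_aut_Cons tree_aut_outside)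
qed

lemma tree_cons_simps [simp]:
  "tree_cons m \<beta> \<sigma> [] = []"
  "y \<in> Y \<Longrightarrow> u \<in> W \<Longrightarrow> tree_cons m \<beta> \<sigma> (y # u) = \<sigma> y # \<beta> y u"
  "w \<notin> W \<Longrightarrow> tree_cons m \<beta> \<sigma> w = w"
  by (auto simp: tree_cons_def split: list.split)

lemma extends_words_tree_cons:
  assumes "\<And>y. y \<in> Y \<Longrightarrow> \<beta> y \<in> carrier \<A>" "\<sigma> permutes Y"
  shows "extends_words (tree_cons m \<beta> \<sigma>)"
  unfolding extends_words_def
proof (intro conjI ballI)
  fix u y assume uy: "u \<in> W" "y \<in> Y"
  show "\<exists>z\<in>Y. tree_cons m \<beta> \<sigma> (u @ [y]) = tree_cons m \<beta> \<sigma> u @ [z]"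
  proof (cases u)
    case Nil
    then show ?thesis using uy assms permutes_in_image[OF assms(2)] by (simp add: assms)
  next
    case (Cons x v)
    then obtain z where "z \<in> Y" "\<beta> x (v @ [y]) = \<beta> x v @ [z]"
      using uy tree_aut_extends_words[OF assms(1)[of x]] unfolding extends_words_def
      by (metis words_simps(2))
    with Cons uy show ?thesis by auto
  qed
qed simp

lemma tree_cons_closed:
  assumes "\<And>y. y \<in> Y \<Longrightarrow> \<beta> y \<in> carrier \<A>" "\<sigma> permutes Y"
  shows "tree_cons m \<beta> \<sigma> \<in> carrier \<A>"
proof -
  let ?\<tau> = "inv' \<sigma>"
  let ?\<gamma> = "\<lambda>y. inv\<^bsub>\<A>\<^esub> (\<beta> (?\<tau> y))"
  have \<tau>: "?\<tau> permutes Y" using assms(2) by (rule permutes_inv)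
  have in_Y: "?\<tau> y \<in> Y \<longleftrightarrow> y \<in> Y" "\<sigma> y \<in> Y \<longleftrightarrow> y \<in> Y" for y
    using permutes_in_image[OF \<tau>] permutes_in_image[OF assms(2)] by auto
  show ?thesis
  proof (rule tree_autI[where \<beta> = "tree_cons m ?\<gamma> ?\<tau>"])
    show "extends_words (tree_cons m \<beta> \<sigma>)" "extends_words (tree_cons m ?\<gamma> ?\<tau>)"
      using assms \<tau> in_Y by (auto intro!: extends_words_tree_cons)
    fix u assume "u \<in> W"
    then show "tree_cons m ?\<gamma> ?\<tau> (tree_cons m \<beta> \<sigma> u) = u"
      "tree_cons m \<beta> \<sigma> (tree_cons m ?\<gamma> ?\<tau> u) = u"
      using assms in_Y permutes_inverses[OF assms(2)]
      by (cases u; simp del: atLeastAtMost_iff)+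
  qed auto
qed

lemma root_perm_tree_cons:
  assumes "\<sigma> permutes Y" shows "rt (tree_cons m \<beta> \<sigma>) = \<sigma>"
  using assms by (auto simp: root_perm_def permutes_def fun_eq_iff)

lemma tree_comp_tree_cons:
  assumes "y \<in> Y" "\<beta> y \<in> carrier \<A>"
  shows "cmp (tree_cons m \<beta> \<sigma>) y = \<beta> y"
  using assms by (auto simp: tree_comp_def fun_eq_iff tree_aut_outside)

lemma tree_cons_eqI:
  assumes "\<And>y. y \<in> Y \<Longrightarrow> \<beta> y = \<gamma> y"
  shows "tree_cons m \<beta> \<sigma> = tree_cons m \<gamma> \<sigma>"
proof
  fix w show "tree_cons m \<beta> \<sigma> w = tree_cons m \<gamma> \<sigma> w"
    using assms by (cases w) (auto simp: tree_cons_def)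
qed

lemma diag_closed [simp]: "\<alpha> \<in> carrier \<A> \<Longrightarrow> diag \<alpha> \<in> carrier \<A>"
  unfolding diag_map_def by (auto intro: tree_cons_closed permutes_id)

lemma diag_pow_closed [simp]: "\<alpha> \<in> carrier \<A> \<Longrightarrow> (diag ^^ i) \<alpha> \<in> carrier \<A>"
  by (induction i) simp_all

lemma diag_apply [simp]:
  "diag \<alpha> [] = []" "y \<in> Y \<Longrightarrow> u \<in> W \<Longrightarrow> diag \<alpha> (y # u) = y # \<alpha> u"
  by (simp_all add: diag_map_def)

lemma diag_outside: "u \<notin> W \<Longrightarrow> diag \<alpha> u = u"
  by (simp add: diag_map_def)

lemma root_perm_diag [simp]: "rt (diag \<alpha>) = id"
  by (simp add: diag_map_def root_perm_tree_cons permutes_id)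

lemma tree_comp_diag [simp]: "y \<in> Y \<Longrightarrow> \<alpha> \<in> carrier \<A> \<Longrightarrow> cmp (diag \<alpha>) y = \<alpha>"
  by (simp add: diag_map_def tree_comp_tree_cons)

lemma tree_aut_eq_diag:
  assumes "\<alpha> \<in> carrier \<A>" "rt \<alpha> = id" "\<And>y. y \<in> Y \<Longrightarrow> cmp \<alpha> y = \<beta>"
  shows "\<alpha> = diag \<beta>"
  using tree_cons_root_comp[OF assms(1)] tree_cons_eqI[of "cmp \<alpha>" "\<lambda>_. \<beta>" id] assms
  by (simp add: diag_map_def)

lemma tree_aut_eq_root_comp:
  assumes "\<alpha> \<in> carrier \<A>" "\<beta> \<in> carrier \<A>" "rt \<alpha> = rt \<beta>" "\<And>y. y \<in> Y \<Longrightarrow> cmp \<alpha> y = cmp \<beta> y"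
  shows "\<alpha> = \<beta>"
  using tree_cons_root_comp[OF assms(1)] tree_cons_root_comp[OF assms(2)] assms(3)
    tree_cons_eqI[of "cmp \<alpha>" "cmp \<beta>" "rt \<alpha>", OF assms(4)] by simp

lemma diag_group_hom: "group_hom \<A> \<A> diag"
proof (intro group_hom.intro group_hom_axioms.intro G.group_axioms)
  show "diag \<in> hom \<A> \<A>"
  proof (rule homI)
    fix \<alpha> \<beta> assume *: "\<alpha> \<in> carrier \<A>" "\<beta> \<in> carrier \<A>"
    show "diag (\<alpha> \<otimes>\<^bsub>\<A>\<^esub> \<beta>) = diag \<alpha> \<otimes>\<^bsub>\<A>\<^esub> diag \<beta>"
    proof
      fix w show "diag (\<alpha> \<otimes>\<^bsub>\<A>\<^esub> \<beta>) w = (diag \<alpha> \<otimes>\<^bsub>\<A>\<^esub> diag \<beta>) w"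
        using * by (cases "w \<in> W"; cases w) (auto simp: diag_outside)
    qed
  qed simp
qed

sublocale diag: group_hom "tree_aut m" "tree_aut m" "diag_map m"
  by (rule diag_group_hom)

section \<open>The topology: agreement up to a level\<close>

text \<open>
  The level stabilizers are normal, so two automorphisms lie in the same coset of the \<open>l\<close>-th one
  exactly when they act alike on the words of length at most \<open>l\<close>.  All topological notions are
  expressed through this relation.
\<close>

definition agree :: "nat \<Rightarrow> (nat list \<Rightarrow> nat list) \<Rightarrow> (nat list \<Rightarrow> nat list) \<Rightarrow> bool" where
  "agree l \<alpha> \<beta> \<longleftrightarrow> (\<forall>u\<in>W. length u \<le> l \<longrightarrow> \<alpha> u = \<beta> u)"

lemma agree_refl [simp]: "agree l \<alpha> \<alpha>"
  by (simp add: agree_def)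

lemma agree_sym: "agree l \<alpha> \<beta> \<Longrightarrow> agree l \<beta> \<alpha>"
  by (simp add: agree_def)

lemma agree_trans [trans]: "agree l \<alpha> \<beta> \<Longrightarrow> agree l \<beta> \<gamma> \<Longrightarrow> agree l \<alpha> \<gamma>"
  by (simp add: agree_def)

lemma agree_mono: "agree l \<alpha> \<beta> \<Longrightarrow> k \<le> l \<Longrightarrow> agree k \<alpha> \<beta>"
  by (simp add: agree_def)

lemma agree_0: "\<alpha> \<in> carrier \<A> \<Longrightarrow> \<beta> \<in> carrier \<A> \<Longrightarrow> agree 0 \<alpha> \<beta>"
  by (simp add: agree_def)

lemma agree_all_eq:
  assumes "\<alpha> \<in> carrier \<A>" "\<beta> \<in> carrier \<A>" "\<And>l. agree l \<alpha> \<beta>"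
  shows "\<alpha> = \<beta>"
  using assms by (intro tree_aut_eqI) (auto simp: agree_def)

lemma agree_comp:
  assumes "agree l \<alpha> \<alpha>'" "agree l \<beta> \<beta>'" "\<alpha> \<in> carrier \<A>"
  shows "agree l (\<beta> \<circ> \<alpha>) (\<beta>' \<circ> \<alpha>')"
  using assms unfolding agree_def by (metis comp_apply tree_aut_in_words tree_aut_length)

lemma agree_inv:
  assumes "agree l \<alpha> \<beta>" "\<alpha> \<in> carrier \<A>" "\<beta> \<in> carrier \<A>"
  shows "agree l (inv\<^bsub>\<A>\<^esub> \<alpha>) (inv\<^bsub>\<A>\<^esub> \<beta>)"
  unfolding agree_def
proof (intro ballI impI)
  fix u assume u: "u \<in> W" "length u \<le> l"
  let ?v = "(inv\<^bsub>\<A>\<^esub> \<beta>) u"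
  have "?v \<in> W" "length ?v = length u" using assms u by simp_all
  then have "\<alpha> ?v = u" using assms u by (simp add: agree_def)
  then show "(inv\<^bsub>\<A>\<^esub> \<alpha>) u = ?v" using assms(2) by (metis inv_apply(2))
qed

lemma agree_diag: "agree l \<alpha> \<beta> \<Longrightarrow> agree (Suc l) (diag \<alpha>) (diag \<beta>)"
  unfolding agree_def
proof (intro ballI impI)
  fix u assume "\<forall>u\<in>W. length u \<le> l \<longrightarrow> \<alpha> u = \<beta> u" "u \<in> W" "length u \<le> Suc l"
  then show "diag \<alpha> u = diag \<beta> u" by (cases u) auto
qed

lemma agree_diag_pow: "agree l \<alpha> \<beta> \<Longrightarrow> agree (l + i) ((diag ^^ i) \<alpha>) ((diag ^^ i) \<beta>)"
  by (induction i) (auto intro: agree_diag)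

lemma agree_root:
  assumes "agree l \<alpha> \<beta>" "l \<ge> 1"
  shows "rt \<alpha> = rt \<beta>"
  using assms by (auto simp: agree_def root_perm_def fun_eq_iff)

lemma agree_tree_comp:
  assumes "agree (Suc l) \<alpha> \<beta>" "y \<in> Y"
  shows "agree l (cmp \<alpha> y) (cmp \<beta> y)"
  using assms by (auto simp: agree_def tree_comp_def)

lemma agree_tree_cons:
  assumes "\<And>y. y \<in> Y \<Longrightarrow> agree l (\<beta> y) (\<gamma> y)"
  shows "agree (Suc l) (tree_cons m \<beta> \<sigma>) (tree_cons m \<gamma> \<sigma>)"
  unfolding agree_def
proof (intro ballI impI)
  fix u assume "u \<in> W" "length u \<le> Suc l"
  then show "tree_cons m \<beta> \<sigma> u = tree_cons m \<gamma> \<sigma> u"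
    using assms by (cases u) (auto simp: agree_def)
qed

text \<open>
  Every word can be prolonged to length \<open>l\<close>, and automorphisms map prefixes to prefixes; hence the
  action on level \<open>l\<close> determines the action on all lower levels.
\<close>

lemma agree_exact_level:
  assumes "\<alpha> \<in> carrier \<A>" "\<beta> \<in> carrier \<A>" "\<And>u. u \<in> W \<Longrightarrow> length u = l \<Longrightarrow> \<alpha> u = \<beta> u"
  shows "agree l \<alpha> \<beta>"
  unfolding agree_def
proof (intro ballI impI)
  fix u assume u: "u \<in> W" "length u \<le> l"
  \<comment> \<open>Any letter will do; there is one because \<open>m \<ge> 2\<close>.\<close>
  define v where "v = replicate (l - length u) (1::nat)"
  have v: "v \<in> W" using m_ge_2 by (auto simp: v_def tree_words_def)
  have "\<alpha> (u @ v) = \<beta> (u @ v)" using u v assms(3) by (simp add: v_def)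
  moreover obtain w where "\<alpha> (u @ v) = \<alpha> u @ w"
    using assms u v by (elim tree_aut_prefix)
  moreover obtain w' where "\<beta> (u @ v) = \<beta> u @ w'"
    using assms u v by (elim tree_aut_prefix)
  moreover have "length (\<alpha> u) = length (\<beta> u)" using assms u by simp
  ultimately show "\<alpha> u = \<beta> u" by simp
qed

lemma level_stab_iff: "\<delta> \<in> level_stab m l \<longleftrightarrow> \<delta> \<in> carrier \<A> \<and> agree l \<delta> id"
  using agree_exact_level[of \<delta> id l] by (auto simp: level_stab_def agree_def)

lemma level_coset_iff:
  assumes "\<alpha> \<in> carrier \<A>"
  shows "\<beta> \<in> \<alpha> <#\<^bsub>\<A>\<^esub> level_stab m l \<longleftrightarrow> \<beta> \<in> carrier \<A> \<and> agree l \<beta> \<alpha>"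
proof
  assume "\<beta> \<in> \<alpha> <#\<^bsub>\<A>\<^esub> level_stab m l"
  then obtain \<delta> where "\<delta> \<in> carrier \<A>" "agree l \<delta> id" "\<beta> = \<delta> \<circ> \<alpha>"
    by (auto simp: l_coset_def level_stab_iff)
  with assms agree_comp[of l \<alpha> \<alpha> \<delta> id] show "\<beta> \<in> carrier \<A> \<and> agree l \<beta> \<alpha>"
    using tree_aut_comp_closed by simp
next
  assume \<beta>: "\<beta> \<in> carrier \<A> \<and> agree l \<beta> \<alpha>"
  let ?\<delta> = "\<beta> \<circ> inv\<^bsub>\<A>\<^esub> \<alpha>"
  have 1: "\<alpha> \<circ> inv\<^bsub>\<A>\<^esub> \<alpha> = id" "\<beta> = ?\<delta> \<circ> \<alpha>" using assms by (auto simp: fun_eq_iff)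
  have "?\<delta> \<in> level_stab m l"
    using assms \<beta> tree_aut_comp_closed agree_comp[of l "inv\<^bsub>\<A>\<^esub> \<alpha>" "inv\<^bsub>\<A>\<^esub> \<alpha>" \<beta> \<alpha>] 1
    by (simp add: level_stab_iff)
  with 1(2) show "\<beta> \<in> \<alpha> <#\<^bsub>\<A>\<^esub> level_stab m l"
    by (auto simp: l_coset_def)
qed

lemma openin_level_coset:
  assumes "\<alpha> \<in> carrier \<A>"
  shows "openin (tree_topology m) (\<alpha> <#\<^bsub>\<A>\<^esub> level_stab m l)"
  unfolding tree_topology_def by (rule topology_generated_by_Basis) (use assms in blast)

lemma topspace_tree_topology [simp]: "topspace (tree_topology m) = carrier \<A>"
  using level_coset_iff by (fastforce simp: tree_topology_def)

text \<open>
  The cosets of the level stabilizers were given as a subbasis; they form a basis because two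
  cosets through a common point intersect in a coset of the smaller stabilizer.
\<close>

lemma openin_tree_topology_neighbourhood:
  assumes "openin (tree_topology m) U" "\<beta> \<in> U"
  obtains l where "\<And>\<gamma>. \<gamma> \<in> carrier \<A> \<Longrightarrow> agree l \<gamma> \<beta> \<Longrightarrow> \<gamma> \<in> U"
proof -
  have "generate_topology_on
      {\<alpha> <#\<^bsub>\<A>\<^esub> level_stab m l | \<alpha> l. \<alpha> \<in> carrier \<A>} U"
    using assms(1) by (simp add: tree_topology_def openin_topology_generated_by_iff)
  then have "\<exists>l. \<forall>\<gamma>\<in>carrier \<A>. agree l \<gamma> \<beta> \<longrightarrow> \<gamma> \<in> U" using assms(2)
  proof induction
    case Empty
    then show ?case by simp
  next
    case (Int U V)
    then obtain k l where "\<forall>\<gamma>\<in>carrier \<A>. agree k \<gamma> \<beta> \<longrightarrow> \<gamma> \<in> U"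
      "\<forall>\<gamma>\<in>carrier \<A>. agree l \<gamma> \<beta> \<longrightarrow> \<gamma> \<in> V" by blast
    then have "\<forall>\<gamma>\<in>carrier \<A>. agree (max k l) \<gamma> \<beta> \<longrightarrow> \<gamma> \<in> U \<inter> V"
      by (meson Int_iff agree_mono max.cobounded1 max.cobounded2)
    then show ?case by blast
  next
    case (UN K)
    then show ?case by blast
  next
    case (Basis U)
    then obtain \<alpha> l where U: "U = \<alpha> <#\<^bsub>\<A>\<^esub> level_stab m l" "\<alpha> \<in> carrier \<A>" by blast
    with Basis have "agree l \<beta> \<alpha>" by (simp add: level_coset_iff)
    with U have "\<forall>\<gamma>\<in>carrier \<A>. agree l \<gamma> \<beta> \<longrightarrow> \<gamma> \<in> U"
      using agree_trans level_coset_iff by blast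
    then show ?case by blast
  qed
  with that show ?thesis by blast
qed

lemma limitin_tree_topology_iff:
  assumes "\<And>k. f k \<in> carrier \<A>"
  shows "limitin (tree_topology m) f \<beta> sequentially \<longleftrightarrow>
    \<beta> \<in> carrier \<A> \<and> (\<forall>l. \<forall>\<^sub>F k in sequentially. agree l (f k) \<beta>)"
proof
  assume lim: "limitin (tree_topology m) f \<beta> sequentially"
  then have \<beta>: "\<beta> \<in> carrier \<A>" by (simp add: limitin_def)
  have "\<forall>\<^sub>F k in sequentially. agree l (f k) \<beta>" for l
  proof -
    have "\<beta> \<in> \<beta> <#\<^bsub>\<A>\<^esub> level_stab m l" using \<beta> by (simp add: level_coset_iff)
    then have "\<forall>\<^sub>F k in sequentially. f k \<in> \<beta> <#\<^bsub>\<A>\<^esub> level_stab m l"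
      using lim openin_level_coset[OF \<beta>] by (simp add: limitin_def)
    then show ?thesis by (rule eventually_mono) (simp add: level_coset_iff[OF \<beta>])
  qed
  with \<beta> show "\<beta> \<in> carrier \<A> \<and> (\<forall>l. \<forall>\<^sub>F k in sequentially. agree l (f k) \<beta>)" by blast
next
  assume *: "\<beta> \<in> carrier \<A> \<and> (\<forall>l. \<forall>\<^sub>F k in sequentially. agree l (f k) \<beta>)"
  show "limitin (tree_topology m) f \<beta> sequentially"
    unfolding limitin_def
  proof (intro conjI allI impI)
    fix U assume "openin (tree_topology m) U \<and> \<beta> \<in> U"
    then obtain l where l: "\<And>\<gamma>. \<gamma> \<in> carrier \<A> \<Longrightarrow> agree l \<gamma> \<beta> \<Longrightarrow> \<gamma> \<in> U"
      using openin_tree_topology_neighbourhood by metis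
    have "\<forall>\<^sub>F k in sequentially. agree l (f k) \<beta>" using * by blast
    then show "\<forall>\<^sub>F k in sequentially. f k \<in> U"
      by (rule eventually_mono) (use assms l in blast)
  qed (use * in simp)
qed

lemma in_tree_closure_iff:
  assumes "S \<subseteq> carrier \<A>"
  shows "\<beta> \<in> Abstract_Topology.closure_of (tree_topology m) S \<longleftrightarrow>
    \<beta> \<in> carrier \<A> \<and> (\<forall>l. \<exists>\<gamma>\<in>S. agree l \<gamma> \<beta>)"
proof
  assume *: "\<beta> \<in> Abstract_Topology.closure_of (tree_topology m) S"
  then have \<beta>: "\<beta> \<in> carrier \<A>" by (simp add: in_closure_of)
  have "\<exists>\<gamma>\<in>S. agree l \<gamma> \<beta>" for l
  proof -
    have "\<beta> \<in> \<beta> <#\<^bsub>\<A>\<^esub> level_stab m l" using \<beta> by (simp add: level_coset_iff)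
    with * openin_level_coset[OF \<beta>] obtain \<gamma> where "\<gamma> \<in> S" "\<gamma> \<in> \<beta> <#\<^bsub>\<A>\<^esub> level_stab m l"
      unfolding in_closure_of by blast
    then show ?thesis using level_coset_iff[OF \<beta>] by blast
  qed
  with \<beta> show "\<beta> \<in> carrier \<A> \<and> (\<forall>l. \<exists>\<gamma>\<in>S. agree l \<gamma> \<beta>)" by blast
next
  assume *: "\<beta> \<in> carrier \<A> \<and> (\<forall>l. \<exists>\<gamma>\<in>S. agree l \<gamma> \<beta>)"
  show "\<beta> \<in> Abstract_Topology.closure_of (tree_topology m) S"
    unfolding in_closure_of
  proof (intro conjI allI impI)
    fix U assume "\<beta> \<in> U \<and> openin (tree_topology m) U"
    then obtain l where "\<And>\<gamma>. \<gamma> \<in> carrier \<A> \<Longrightarrow> agree l \<gamma> \<beta> \<Longrightarrow> \<gamma> \<in> U"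
      using openin_tree_topology_neighbourhood by metis
    with * assms show "\<exists>\<gamma>. \<gamma> \<in> S \<and> \<gamma> \<in> U" by blast
  qed (use * in simp)
qed

text \<open>
  The automorphism group is complete.  The limit is read off on the diagonal: on a word of length
  \<open>k\<close> it acts as the \<open>k\<close>-th member of the sequence.  The inverses form a coherent sequence too,
  and their limit is the inverse.
\<close>

lemma tree_aut_complete:
  assumes "\<And>l. f l \<in> carrier \<A>" "\<And>l. agree l (f (Suc l)) (f l)"
  obtains \<beta> where "\<beta> \<in> carrier \<A>" "\<And>l k. l \<le> k \<Longrightarrow> agree l (f k) \<beta>"
proof -
  have coherent: "agree l (f k) (f l)" if "l \<le> k" for l k
    using that
  proof (induction k rule: dec_induct)
    case (step k)
    have "agree l (f (Suc k)) (f k)"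
      by (rule agree_mono[OF assms(2)]) (use step in simp)
    with step.IH show ?case using agree_trans by blast
  qed simp
  define lim where "lim g u = (if u \<in> W then g (length u) u else u)"
    for g :: "nat \<Rightarrow> nat list \<Rightarrow> nat list" and u
  have lim: "agree l (g k) (lim g)"
    if "l \<le> k" "\<And>k l. l \<le> k \<Longrightarrow> agree l (g k) (g l)" for g l k
    using that unfolding agree_def lim_def by (metis order.trans order_refl)
  have ext: "extends_words (lim g)"
    if g: "\<And>l. g l \<in> carrier \<A>" "\<And>k l. l \<le> k \<Longrightarrow> agree l (g k) (g l)" for g
    unfolding extends_words_def
  proof (intro conjI ballI)
    show "lim g [] = []" using g by (simp add: lim_def)
  next
    fix u y assume uy: "u \<in> W" "y \<in> Y"
    then obtain z where "z \<in> Y" "g (Suc (length u)) (u @ [y]) = g (Suc (length u)) u @ [z]"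
      using tree_aut_extends_words[OF g(1)[of "Suc (length u)"]]
      unfolding extends_words_def by blast
    moreover have "g (Suc (length u)) u = g (length u) u"
      using g(2)[of "length u" "Suc (length u)"] uy by (simp add: agree_def)
    ultimately show "\<exists>z\<in>Y. lim g (u @ [y]) = lim g u @ [z]" using uy by (auto simp: lim_def)
  qed
  let ?h = "\<lambda>l. inv\<^bsub>\<A>\<^esub> (f l)"
  have "lim f \<in> carrier \<A>"
  proof (rule tree_autI[where \<beta> = "lim ?h"])
    show "extends_words (lim f)" using assms coherent by (intro ext)
    show "extends_words (lim ?h)" using assms coherent by (intro ext agree_inv) auto
  qed (use assms in \<open>auto simp: lim_def\<close>)
  moreover have "agree l (f k) (lim f)" if "l \<le> k" for l k
    using that coherent by (intro lim) auto
  ultimately show ?thesis using that by blast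
qed

section \<open>State-closed groups and their closures\<close>

text \<open>
  Closure under all states reduces to closure under first-level states, a state at a longer word
  being an iterated first-level state.
\<close>

lemma state_closed_iff:
  "state_closed m C \<longleftrightarrow> subgroup C \<A> \<and> (\<forall>\<alpha>\<in>C. \<forall>y\<in>Y. cmp \<alpha> y \<in> C)"
proof
  assume *: "state_closed m C"
  have "cmp \<alpha> y \<in> C" if "\<alpha> \<in> C" "y \<in> Y" for \<alpha> y
  proof -
    have "[y] \<in> W" using that(2) by simp
    then have "tree_state m \<alpha> [y] \<in> C" using * that(1) unfolding state_closed_def by blast
    then show ?thesis by simp
  qed
  with * show "subgroup C \<A> \<and> (\<forall>\<alpha>\<in>C. \<forall>y\<in>Y. cmp \<alpha> y \<in> C)" by (simp add: state_closed_def)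
next
  assume *: "subgroup C \<A> \<and> (\<forall>\<alpha>\<in>C. \<forall>y\<in>Y. cmp \<alpha> y \<in> C)"
  have "tree_state m \<alpha> u \<in> C" if "\<alpha> \<in> C" "u \<in> W" for \<alpha> u
    using that by (induction u arbitrary: \<alpha>) (use * in auto)
  with * show "state_closed m C" by (simp add: state_closed_def)
qed

text \<open>
  State-closedness and commutativity in elementwise form; in a product of maps the order of
  composition is the reverse of the order in the group.
\<close>

definition state_abelian :: "(nat list \<Rightarrow> nat list) set \<Rightarrow> bool" where
  "state_abelian C \<longleftrightarrow> subgroup C \<A> \<and> (\<forall>\<alpha>\<in>C. \<forall>y\<in>Y. cmp \<alpha> y \<in> C) \<and>
    (\<forall>\<alpha>\<in>C. \<forall>\<beta>\<in>C. \<beta> \<circ> \<alpha> = \<alpha> \<circ> \<beta>)"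

lemma state_abelianI:
  assumes "state_closed m A" "comm_group (\<A>\<lparr>carrier := A\<rparr>)"
  shows "state_abelian A"
proof -
  interpret A: comm_group "\<A>\<lparr>carrier := A\<rparr>" by (rule assms)
  show ?thesis using assms(1) A.m_comm by (simp add: state_abelian_def state_closed_iff)
qed

lemma comm_group_if_commutes:
  assumes "subgroup A \<A>" "\<And>\<alpha> \<beta>. \<alpha> \<in> A \<Longrightarrow> \<beta> \<in> A \<Longrightarrow> \<beta> \<circ> \<alpha> = \<alpha> \<circ> \<beta>"
  shows "comm_group (\<A>\<lparr>carrier := A\<rparr>)"
  using G.subgroup_imp_group[OF assms(1)] by (rule group.group_comm_groupI) (use assms(2) in simp)

lemma subgroup_in_carrier: "subgroup C \<A> \<Longrightarrow> \<alpha> \<in> C \<Longrightarrow> \<alpha> \<in> carrier \<A>"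
  by (rule subgroup.mem_carrier)

text \<open>
  The set \<open>A\<^sup>*\<close> is the smallest one of this kind that contains \<open>A\<close>: see \<open>diag_top_closed_diag_top_closure\<close> and
  \<open>diag_top_closure_minimal\<close>.
\<close>

definition diag_top_closed :: "(nat list \<Rightarrow> nat list) set \<Rightarrow> bool" where
  "diag_top_closed C \<longleftrightarrow> subgroup C \<A> \<and> (\<forall>\<alpha>\<in>C. diag \<alpha> \<in> C) \<and>
    (\<forall>\<beta>\<in>carrier \<A>. (\<forall>l. \<exists>\<gamma>\<in>C. agree l \<gamma> \<beta>) \<longrightarrow> \<beta> \<in> C)"

lemma diag_top_closed_diag_pow: "diag_top_closed C \<Longrightarrow> \<alpha> \<in> C \<Longrightarrow> (diag ^^ i) \<alpha> \<in> C"
  by (induction i) (auto simp: diag_top_closed_def)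

lemma subgroup_diag_closure:
  assumes "A \<subseteq> carrier \<A>"
  shows "subgroup (diag_closure m A) \<A>"
  unfolding diag_closure_def by (rule G.generate_is_subgroup) (use assms in auto)

lemma diag_closure_closed_diag:
  assumes "A \<subseteq> carrier \<A>" "\<alpha> \<in> diag_closure m A"
  shows "diag \<alpha> \<in> diag_closure m A"
proof -
  let ?S = "\<Union>i. (diag ^^ i) ` A"
  have S: "?S \<subseteq> carrier \<A>" using assms(1) by auto
  have "diag s \<in> ?S" if "s \<in> ?S" for s
  proof -
    from that obtain i \<alpha> where "s = (diag ^^ i) \<alpha>" "\<alpha> \<in> A" by blast
    then have "diag s \<in> (diag ^^ Suc i) ` A" by simp
    then show ?thesis by blast
  qed
  then have "diag ` ?S \<subseteq> ?S" by blast
  then have "generate \<A> (diag ` ?S) \<subseteq> generate \<A> ?S"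
    by (rule G.mono_generate)
  then show ?thesis
    using assms(2) diag.generate_img[OF S] unfolding diag_closure_def by blast
qed

lemma diag_closure_minimal:
  assumes "diag_top_closed C" "A \<subseteq> C"
  shows "diag_closure m A \<subseteq> C"
  unfolding diag_closure_def
  by (rule G.generate_subgroup_incl)
     (use assms diag_top_closed_diag_pow in \<open>auto simp: diag_top_closed_def\<close>)

lemma in_diag_top_closure_iff:
  assumes "A \<subseteq> carrier \<A>"
  shows "\<beta> \<in> diag_top_closure m A \<longleftrightarrow>
    \<beta> \<in> carrier \<A> \<and> (\<forall>l. \<exists>\<gamma>\<in>diag_closure m A. agree l \<gamma> \<beta>)"
  unfolding diag_top_closure_def
  using in_tree_closure_iff[OF subgroup.subset[OF subgroup_diag_closure[OF assms]]] .

lemma diag_top_closure_minimal: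
  assumes "diag_top_closed C" "A \<subseteq> C"
  shows "diag_top_closure m A \<subseteq> C"
proof
  fix \<beta> assume *: "\<beta> \<in> diag_top_closure m A"
  have "A \<subseteq> carrier \<A>"
    using assms subgroup.subset unfolding diag_top_closed_def by blast
  with * assms(1) show "\<beta> \<in> C"
    using diag_closure_minimal[OF assms]
    unfolding in_diag_top_closure_iff[OF \<open>A \<subseteq> carrier \<A>\<close>] diag_top_closed_def by blast
qed

lemma diag_closure_incl: "A \<subseteq> diag_closure m A"
proof
  fix \<alpha> assume "\<alpha> \<in> A"
  then have "\<alpha> \<in> (diag ^^ 0) ` A" by simp
  then have "\<alpha> \<in> (\<Union>i. (diag ^^ i) ` A)" by blast
  then show "\<alpha> \<in> diag_closure m A"
    unfolding diag_closure_def by (rule generate.incl)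
qed

lemma diag_closure_subset_top_closure:
  assumes "A \<subseteq> carrier \<A>"
  shows "diag_closure m A \<subseteq> diag_top_closure m A"
proof
  fix \<alpha> assume \<alpha>: "\<alpha> \<in> diag_closure m A"
  then have "\<alpha> \<in> carrier \<A>"
    using subgroup_diag_closure[OF assms] subgroup_in_carrier by blast
  with \<alpha> show "\<alpha> \<in> diag_top_closure m A"
    unfolding in_diag_top_closure_iff[OF assms] using agree_refl by blast
qed

lemma diag_top_closure_incl:
  "A \<subseteq> carrier \<A> \<Longrightarrow> A \<subseteq> diag_top_closure m A"
  using diag_closure_incl diag_closure_subset_top_closure by blast

lemma diag_top_closed_diag_top_closure:
  assumes "A \<subseteq> carrier \<A>"
  shows "diag_top_closed (diag_top_closure m A)"
proof -
  note iff = in_diag_top_closure_iff[OF assms]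
  have sub: "subgroup (diag_closure m A) \<A>" by (rule subgroup_diag_closure[OF assms])
  have "subgroup (diag_top_closure m A) \<A>"
  proof (rule G.subgroupI)
    show "diag_top_closure m A \<subseteq> carrier \<A>" using iff by blast
    have "\<one>\<^bsub>\<A>\<^esub> \<in> diag_closure m A" using sub by (rule subgroup.one_closed)
    then show "diag_top_closure m A \<noteq> {}"
      using diag_closure_subset_top_closure[OF assms] by blast
  next
    fix \<alpha> assume \<alpha>: "\<alpha> \<in> diag_top_closure m A"
    have "\<exists>\<gamma>\<in>diag_closure m A. agree l \<gamma> (inv\<^bsub>\<A>\<^esub> \<alpha>)" for l
    proof -
      obtain \<gamma> where \<gamma>: "\<gamma> \<in> diag_closure m A" "agree l \<gamma> \<alpha>" using \<alpha> iff by blast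
      then have "agree l (inv\<^bsub>\<A>\<^esub> \<gamma>) (inv\<^bsub>\<A>\<^esub> \<alpha>)"
        using \<alpha> iff sub subgroup_in_carrier by (intro agree_inv) blast+
      then show ?thesis using subgroup.m_inv_closed[OF sub \<gamma>(1)] by blast
    qed
    then show "inv\<^bsub>\<A>\<^esub> \<alpha> \<in> diag_top_closure m A" using \<alpha> iff by simp
  next
    fix \<alpha> \<beta> assume \<alpha>: "\<alpha> \<in> diag_top_closure m A" and \<beta>: "\<beta> \<in> diag_top_closure m A"
    have "\<exists>\<gamma>\<in>diag_closure m A. agree l \<gamma> (\<alpha> \<otimes>\<^bsub>\<A>\<^esub> \<beta>)" for l
    proof -
      obtain \<gamma> where \<gamma>: "\<gamma> \<in> diag_closure m A" "agree l \<gamma> \<alpha>" using \<alpha> iff by blast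
      obtain \<delta> where \<delta>: "\<delta> \<in> diag_closure m A" "agree l \<delta> \<beta>" using \<beta> iff by blast
      have "agree l (\<gamma> \<otimes>\<^bsub>\<A>\<^esub> \<delta>) (\<alpha> \<otimes>\<^bsub>\<A>\<^esub> \<beta>)"
        using agree_comp[OF \<gamma>(2) \<delta>(2)] subgroup_in_carrier[OF sub \<gamma>(1)] by simp
      then show ?thesis using subgroup.m_closed[OF sub \<gamma>(1) \<delta>(1)] by blast
    qed
    then show "\<alpha> \<otimes>\<^bsub>\<A>\<^esub> \<beta> \<in> diag_top_closure m A"
      using \<alpha> \<beta> iff G.m_closed by blast
  qed
  moreover have "diag \<alpha> \<in> diag_top_closure m A" if \<alpha>: "\<alpha> \<in> diag_top_closure m A" for \<alpha>
  proof -
    have "\<exists>\<gamma>\<in>diag_closure m A. agree l \<gamma> (diag \<alpha>)" for l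
    proof -
      obtain \<gamma> where \<gamma>: "\<gamma> \<in> diag_closure m A" "agree l \<gamma> \<alpha>" using \<alpha> iff by blast
      then have "agree l (diag \<gamma>) (diag \<alpha>)"
        using agree_diag agree_mono by (meson le_SucI order_refl)
      then show ?thesis using diag_closure_closed_diag[OF assms \<gamma>(1)] by blast
    qed
    then show ?thesis using \<alpha> iff by simp
  qed
  moreover have "\<beta> \<in> diag_top_closure m A"
    if "\<beta> \<in> carrier \<A>" "\<forall>l. \<exists>\<gamma>\<in>diag_top_closure m A. agree l \<gamma> \<beta>" for \<beta>
    using that iff agree_trans by meson
  ultimately show ?thesis by (simp add: diag_top_closed_def)
qed

lemma root_perm_inv:
  assumes "\<alpha> \<in> carrier \<A>"
  shows "rt (inv\<^bsub>\<A>\<^esub> \<alpha>) = inv\<^bsub>sym_group m\<^esub> (rt \<alpha>)"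
proof -
  interpret S: group "sym_group m" by (rule sym_group_is_group)
  have "rt (inv\<^bsub>\<A>\<^esub> \<alpha>) \<circ> rt \<alpha> = id" using assms by (simp flip: root_perm_comp)
  then have "inv\<^bsub>sym_group m\<^esub> (rt \<alpha>) = rt (inv\<^bsub>\<A>\<^esub> \<alpha>)"
    using assms root_perm_permutes
    by (intro S.inv_equality) (auto simp: sym_group_carrier sym_group_mult sym_group_one)
  then show ?thesis by simp
qed

lemma tree_comp_inv:
  assumes "\<alpha> \<in> carrier \<A>" "y \<in> Y"
  shows "cmp (inv\<^bsub>\<A>\<^esub> \<alpha>) y = inv\<^bsub>\<A>\<^esub> (cmp \<alpha> (rt (inv\<^bsub>\<A>\<^esub> \<alpha>) y))"
proof -
  have "cmp \<alpha> (rt (inv\<^bsub>\<A>\<^esub> \<alpha>) y) \<circ> cmp (inv\<^bsub>\<A>\<^esub> \<alpha>) y = id"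
    using tree_comp_comp[of "inv\<^bsub>\<A>\<^esub> \<alpha>" \<alpha> y] assms by simp
  then have "inv\<^bsub>\<A>\<^esub> (cmp \<alpha> (rt (inv\<^bsub>\<A>\<^esub> \<alpha>) y)) = cmp (inv\<^bsub>\<A>\<^esub> \<alpha>) y"
    using assms by (intro G.inv_equality) (simp_all add: tree_comp_closed)
  then show ?thesis by simp
qed

text \<open>
  Why \<open>A\<close> commutes with its diagonal copies: \<open>\<alpha>\<close> and \<open>\<beta>\<^sup>(\<^sup>k\<^sup>+\<^sup>1\<^sup>)\<close> have commuting root permutations, one
  of them being trivial, and their states at \<open>y\<close> are \<open>\<alpha>\<^sub>y\<close> and \<open>\<beta>\<^sup>(\<^sup>k\<^sup>)\<close>, where \<open>\<alpha>\<^sub>y\<close> lies in \<open>A\<close>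
  again.
\<close>

lemma commutes_with_diag_pow:
  assumes "state_abelian A" "\<alpha> \<in> A" "\<beta> \<in> A"
  shows "(diag ^^ k) \<beta> \<circ> \<alpha> = \<alpha> \<circ> (diag ^^ k) \<beta>"
  using assms(2)
proof (induction k arbitrary: \<alpha>)
  case 0
  then show ?case using assms(1,3) by (simp add: state_abelian_def)
next
  case (Suc k)
  let ?\<gamma> = "(diag ^^ k) \<beta>"
  have in_carrier: "\<alpha> \<in> carrier \<A>" "\<beta> \<in> carrier \<A>"
    using assms Suc.prems subgroup_in_carrier unfolding state_abelian_def by blast+
  have "diag ?\<gamma> \<circ> \<alpha> = \<alpha> \<circ> diag ?\<gamma>"
  proof (rule tree_aut_eq_root_comp)
    fix y assume y: "y \<in> Y"
    then have "cmp \<alpha> y \<in> A" using assms(1) Suc.prems unfolding state_abelian_def by blast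
    then have "?\<gamma> \<circ> cmp \<alpha> y = cmp \<alpha> y \<circ> ?\<gamma>" by (rule Suc.IH)
    then show "cmp (diag ?\<gamma> \<circ> \<alpha>) y = cmp (\<alpha> \<circ> diag ?\<gamma>) y"
      using in_carrier y tree_aut_letter(2)[of \<alpha> y]
      by (simp add: tree_comp_comp del: atLeastAtMost_iff)
  qed (use in_carrier in \<open>simp_all add: root_perm_comp tree_aut_comp_closed\<close>)
  then show ?case by simp
qed

lemma diag_pow_comp:
  assumes "\<alpha> \<in> carrier \<A>" "\<beta> \<in> carrier \<A>"
  shows "(diag ^^ i) (\<beta> \<circ> \<alpha>) = (diag ^^ i) \<beta> \<circ> (diag ^^ i) \<alpha>"
proof (induction i)
  case (Suc i)
  have "(diag ^^ Suc i) (\<beta> \<circ> \<alpha>) = diag ((diag ^^ i) (\<beta> \<circ> \<alpha>))" by simp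
  also have "\<dots> = diag ((diag ^^ i) \<beta> \<circ> (diag ^^ i) \<alpha>)" by (simp only: Suc.IH)
  also have "\<dots> = (diag ^^ Suc i) \<beta> \<circ> (diag ^^ Suc i) \<alpha>"
    using diag.hom_mult[of "(diag ^^ i) \<alpha>" "(diag ^^ i) \<beta>"] assms by simp
  finally show ?case .
qed simp

lemma diag_generators_commute:
  assumes "state_abelian A" "\<alpha> \<in> A" "\<beta> \<in> A"
  shows "(diag ^^ i) \<beta> \<circ> (diag ^^ j) \<alpha> = (diag ^^ j) \<alpha> \<circ> (diag ^^ i) \<beta>"
proof -
  have *: "(diag ^^ i) \<beta> \<circ> (diag ^^ j) \<alpha> = (diag ^^ j) \<alpha> \<circ> (diag ^^ i) \<beta>"
    if "i \<le> j" "\<alpha> \<in> A" "\<beta> \<in> A" for i j \<alpha> \<beta>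
  proof -
    have in_carrier: "\<alpha> \<in> carrier \<A>" "\<beta> \<in> carrier \<A>"
      using assms(1) that subgroup_in_carrier unfolding state_abelian_def by blast+
    have "(diag ^^ j) \<alpha> = (diag ^^ i) ((diag ^^ (j - i)) \<alpha>)"
      using that(1) by (simp flip: funpow_add[THEN fun_cong, unfolded o_apply])
    then show ?thesis
      using commutes_with_diag_pow[OF assms(1) that(3,2), of "j - i"] in_carrier
      by (simp flip: diag_pow_comp)
  qed
  show ?thesis
    using *[of i j \<alpha> \<beta>] *[of j i \<beta> \<alpha>] assms(2,3) by (cases "i \<le> j") auto
qed

end

lemma (in group) generate_commutes_with:
  assumes "x \<in> carrier G" "S \<subseteq> carrier G" "\<And>s. s \<in> S \<Longrightarrow> x \<otimes> s = s \<otimes> x"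
    and "y \<in> generate G S"
  shows "x \<otimes> y = y \<otimes> x"
proof -
  have "subgroup {y \<in> carrier G. x \<otimes> y = y \<otimes> x} G"
  proof (rule subgroupI)
    fix a assume "a \<in> {y \<in> carrier G. x \<otimes> y = y \<otimes> x}"
    then have a: "a \<in> carrier G" "x \<otimes> a = a \<otimes> x" by auto
    then have "x = a \<otimes> x \<otimes> inv a"
      using assms(1) inv_solve_right'[of x "a \<otimes> x" a] by simp
    with a assms(1) show "inv a \<in> {y \<in> carrier G. x \<otimes> y = y \<otimes> x}"
      by (simp add: m_assoc inv_solve_left)
  next
    fix a b assume "a \<in> {y \<in> carrier G. x \<otimes> y = y \<otimes> x}" "b \<in> {y \<in> carrier G. x \<otimes> y = y \<otimes> x}"
    with assms(1) show "a \<otimes> b \<in> {y \<in> carrier G. x \<otimes> y = y \<otimes> x}"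
      by simp (metis m_assoc)
  qed (use assms(1) in auto)
  then show ?thesis using generate_subgroup_incl[of S "{y \<in> carrier G. x \<otimes> y = y \<otimes> x}"] assms by blast
qed

lemma (in group) generate_commutes:
  assumes "S \<subseteq> carrier G" "\<And>s t. s \<in> S \<Longrightarrow> t \<in> S \<Longrightarrow> s \<otimes> t = t \<otimes> s"
    and "x \<in> generate G S" "y \<in> generate G S"
  shows "x \<otimes> y = y \<otimes> x"
proof -
  have "x \<otimes> s = s \<otimes> x" if "s \<in> S" for s
    using generate_commutes_with[of s S x] assms that by auto
  then show ?thesis
    using generate_commutes_with[of x S y] assms generate_in_carrier by blast
qed

context m_ary_tree
begin

lemma diag_closure_comp_closed:
  assumes "state_closed m A" "\<alpha> \<in> diag_closure m A" "y \<in> Y"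
  shows "cmp \<alpha> y \<in> diag_closure m A"
proof -
  define S where "S = (\<Union>i. (diag ^^ i) ` A)"
  have sub: "A \<subseteq> carrier \<A>" "\<And>\<alpha> y. \<alpha> \<in> A \<Longrightarrow> y \<in> Y \<Longrightarrow> cmp \<alpha> y \<in> A"
    using assms(1) subgroup.subset unfolding state_closed_iff by blast+
  have S: "S \<subseteq> carrier \<A>" using sub by (auto simp: S_def)
  have S_comp: "cmp s y \<in> S" if "s \<in> S" "y \<in> Y" for s y
  proof -
    from that(1) obtain i \<alpha> where s: "s = (diag ^^ i) \<alpha>" "\<alpha> \<in> A" unfolding S_def by blast
    show ?thesis
    proof (cases i)
      case 0
      with s that sub(2)[of \<alpha> y] have "cmp s y \<in> (diag ^^ 0) ` A" by simp
      then show ?thesis unfolding S_def by blast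
    next
      case (Suc j)
      with s that sub have "cmp s y = (diag ^^ j) \<alpha>"
        by (simp add: subset_iff del: atLeastAtMost_iff)
      with s(2) show ?thesis unfolding S_def by blast
    qed
  qed
  note in_carrier = G.generate_in_carrier[OF S]
  show ?thesis
    using assms(2,3) unfolding diag_closure_def S_def[symmetric]
  proof (induction arbitrary: y rule: generate.induct)
    case one
    have "cmp \<one>\<^bsub>\<A>\<^esub> y = \<one>\<^bsub>\<A>\<^esub>" by simp
    then show ?case using generate.one by metis
  next
    case (incl s)
    then show ?case using S_comp by (blast intro: generate.incl)
  next
    case (inv s)
    have s: "s \<in> carrier \<A>" using inv S by blast
    then have "rt (inv\<^bsub>\<A>\<^esub> s) y \<in> Y" using inv by (intro tree_aut_letter(2)) auto
    then show ?case using inv s S_comp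
      by (simp only: tree_comp_inv) (blast intro: generate.inv)
  next
    case (eng s t)
    have st: "s \<in> carrier \<A>" "t \<in> carrier \<A>" using eng in_carrier by blast+
    then have "rt s y \<in> Y" using eng by (intro tree_aut_letter(2)) auto
    then have "cmp s y \<otimes>\<^bsub>\<A>\<^esub> cmp t (rt s y) \<in> generate \<A> S"
      using eng by (intro generate.eng) blast+
    moreover have "cmp (s \<otimes>\<^bsub>\<A>\<^esub> t) y = cmp s y \<otimes>\<^bsub>\<A>\<^esub> cmp t (rt s y)"
      using tree_comp_comp[OF st eng.prems] by simp
    ultimately show ?case by metis
  qed
qed

text \<open>
  Proper diagonal copies have trivial root permutation, so they add nothing to the permutation
  group on the first level.
\<close>

lemma perm_group_diag_closure:
  assumes "subgroup A \<A>" "\<alpha> \<in> diag_closure m A"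
  shows "rt \<alpha> \<in> perm_group m A"
proof -
  define S where "S = (\<Union>i. (diag ^^ i) ` A)"
  have A: "A \<subseteq> carrier \<A>" using assms(1) by (rule subgroup.subset)
  then have S: "S \<subseteq> carrier \<A>" by (auto simp: S_def)
  have id: "id \<in> perm_group m A"
    using subgroup.one_closed[OF assms(1)] unfolding perm_group_def
    by (metis imageI root_perm_id tree_aut_one)
  have gen: "rt s \<in> perm_group m A" if "s \<in> S" for s
  proof -
    from that obtain i \<alpha> where "s = (diag ^^ i) \<alpha>" "\<alpha> \<in> A" unfolding S_def by blast
    then show ?thesis using id by (cases i) (auto simp: perm_group_def)
  qed
  show ?thesis
    using assms(2) unfolding diag_closure_def S_def[symmetric]
  proof (induction rule: generate.induct)
    case one
    have "rt \<one>\<^bsub>\<A>\<^esub> = id" by simp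
    then show ?case using id by metis
  next
    case (incl s)
    then show ?case using gen by blast
  next
    case (inv s)
    with gen obtain \<alpha> where \<alpha>: "\<alpha> \<in> A" "rt s = rt \<alpha>" unfolding perm_group_def by blast
    then have "rt (inv\<^bsub>\<A>\<^esub> s) = rt (inv\<^bsub>\<A>\<^esub> \<alpha>)"
      using A S inv by (subst (1 2) root_perm_inv) auto
    then show ?case using subgroup.m_inv_closed[OF assms(1) \<alpha>(1)] by (simp add: perm_group_def)
  next
    case (eng s t)
    then obtain \<alpha> \<beta> where ab: "\<alpha> \<in> A" "rt s = rt \<alpha>" "\<beta> \<in> A" "rt t = rt \<beta>"
      unfolding perm_group_def by blast
    have "s \<in> carrier \<A>" "t \<in> carrier \<A>" using eng G.generate_in_carrier[OF S] by blast+
    then have "rt (s \<otimes>\<^bsub>\<A>\<^esub> t) = rt (\<alpha> \<otimes>\<^bsub>\<A>\<^esub> \<beta>)"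
      using ab A by (auto simp: root_perm_comp subset_iff)
    then show ?case
      using subgroup.m_closed[OF assms(1) ab(1,3)] unfolding perm_group_def by (metis imageI)
  qed
qed

lemma perm_group_diag_top_closure:
  assumes "subgroup A \<A>"
  shows "perm_group m (diag_top_closure m A) = perm_group m A"
proof
  note A = subgroup.subset[OF assms]
  show "perm_group m (diag_top_closure m A) \<subseteq> perm_group m A"
  proof
    fix \<pi> assume "\<pi> \<in> perm_group m (diag_top_closure m A)"
    then obtain \<beta> where "\<pi> = rt \<beta>" "\<beta> \<in> diag_top_closure m A" unfolding perm_group_def by blast
    then obtain \<gamma> where "\<gamma> \<in> diag_closure m A" "agree 1 \<gamma> \<beta>"
      using in_diag_top_closure_iff[OF A] by blast
    then show "\<pi> \<in> perm_group m A"
      using perm_group_diag_closure[OF assms] agree_root[of 1 \<gamma> \<beta>] \<open>\<pi> = rt \<beta>\<close> by (metis order_refl)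
  qed
  show "perm_group m A \<subseteq> perm_group m (diag_top_closure m A)"
    using diag_top_closure_incl[OF A] unfolding perm_group_def by blast
qed

lemma state_abelian_diag_top_closure:
  assumes "state_abelian A"
  shows "state_abelian (diag_top_closure m A)"
proof -
  have sc: "state_closed m A" using assms by (simp add: state_abelian_def state_closed_iff)
  then have A: "A \<subseteq> carrier \<A>" using subgroup.subset unfolding state_closed_iff by blast
  note iff = in_diag_top_closure_iff[OF A]
  have sub: "subgroup (diag_top_closure m A) \<A>"
    using diag_top_closed_diag_top_closure[OF A] by (simp add: diag_top_closed_def)
  have dcc: "diag_closure m A \<subseteq> carrier \<A>"
    using subgroup_diag_closure[OF A] by (rule subgroup.subset)
  have comm: "\<beta> \<circ> \<alpha> = \<alpha> \<circ> \<beta>" if "\<alpha> \<in> diag_closure m A" "\<beta> \<in> diag_closure m A" for \<alpha> \<beta>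
  proof -
    have "\<alpha> \<otimes>\<^bsub>\<A>\<^esub> \<beta> = \<beta> \<otimes>\<^bsub>\<A>\<^esub> \<alpha>"
      using that unfolding diag_closure_def
    proof (rule G.generate_commutes[rotated 2])
      show "(\<Union>i. (diag ^^ i) ` A) \<subseteq> carrier \<A>" using A by auto
    qed (use diag_generators_commute[OF assms] in force)
    then show ?thesis by simp
  qed
  show ?thesis
    unfolding state_abelian_def
  proof (intro conjI ballI sub)
    fix \<alpha> y assume \<alpha>: "\<alpha> \<in> diag_top_closure m A" and y: "y \<in> Y"
    have "\<exists>\<gamma>\<in>diag_closure m A. agree l \<gamma> (cmp \<alpha> y)" for l
    proof -
      obtain \<gamma> where "\<gamma> \<in> diag_closure m A" "agree (Suc l) \<gamma> \<alpha>" using \<alpha> iff by blast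
      then show ?thesis using diag_closure_comp_closed[OF sc _ y] agree_tree_comp[OF _ y] by blast
    qed
    then show "cmp \<alpha> y \<in> diag_top_closure m A" using \<alpha> iff tree_comp_closed by simp
  next
    fix \<alpha> \<beta> assume \<alpha>: "\<alpha> \<in> diag_top_closure m A" and \<beta>: "\<beta> \<in> diag_top_closure m A"
    then have in_carrier: "\<alpha> \<in> carrier \<A>" "\<beta> \<in> carrier \<A>" using iff by blast+
    show "\<beta> \<circ> \<alpha> = \<alpha> \<circ> \<beta>"
    proof (rule agree_all_eq)
      fix l
      obtain \<gamma> where \<gamma>: "\<gamma> \<in> diag_closure m A" "agree l \<gamma> \<alpha>" using \<alpha> iff by blast
      obtain \<delta> where \<delta>: "\<delta> \<in> diag_closure m A" "agree l \<delta> \<beta>" using \<beta> iff by blast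
      have "agree l (\<beta> \<circ> \<alpha>) (\<delta> \<circ> \<gamma>)"
        using \<gamma> \<delta> in_carrier by (intro agree_comp) (auto intro: agree_sym)
      also have "\<delta> \<circ> \<gamma> = \<gamma> \<circ> \<delta>" using comm \<gamma> \<delta> by blast
      also have "agree l (\<gamma> \<circ> \<delta>) (\<alpha> \<circ> \<beta>)"
        using \<gamma> \<delta> dcc by (intro agree_comp) auto
      finally show "agree l (\<beta> \<circ> \<alpha>) (\<alpha> \<circ> \<beta>)" .
    qed (use in_carrier tree_aut_comp_closed in auto)
  qed
qed

section \<open>Powers with m-adic and power series exponents\<close>

abbreviation "Zm \<equiv> madic_ring m"
abbreviation "R \<equiv> madic_fps m"

lemma in_madic_ring_iff:
  "\<xi> \<in> carrier Zm \<longleftrightarrow> (\<forall>i. 0 \<le> \<xi> i \<and> \<xi> i < int m ^ i \<and> \<xi> (Suc i) mod int m ^ i = \<xi> i)"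
  by (auto simp: madic_ring_def)

lemma in_madic_fps_iff: "q \<in> carrier R \<longleftrightarrow> (\<forall>n. q n \<in> carrier Zm)"
  by (auto simp: fps_ring_def)

lemma madic_coherent:
  assumes "\<xi> \<in> carrier Zm" "i \<le> k"
  shows "\<xi> k mod int m ^ i = \<xi> i"
  using assms(2)
proof (induction k rule: dec_induct)
  case base
  then show ?case using assms(1) by (simp add: in_madic_ring_iff)
next
  case (step k)
  have "\<xi> (Suc k) mod int m ^ i = (\<xi> (Suc k) mod int m ^ k) mod int m ^ i"
    using step by (simp add: mod_mod_cancel le_imp_power_dvd)
  with step assms(1) show ?case by (simp add: in_madic_ring_iff)
qed

lemma madic_tendsto_self: "\<xi> \<in> carrier Zm \<Longrightarrow> madic_tendsto m \<xi> \<xi>"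
  unfolding madic_tendsto_def by (intro allI eventually_sequentiallyI madic_coherent)

lemma integer_in_madic_ring: "(\<lambda>i. n mod int m ^ i) \<in> carrier Zm"
  using m_ge_2 by (auto simp: in_madic_ring_iff mod_mod_cancel le_imp_power_dvd)

lemma agree_nat_pow:
  assumes "agree l \<alpha> \<beta>" "\<alpha> \<in> carrier \<A>" "\<beta> \<in> carrier \<A>"
  shows "agree l (\<alpha> [^]\<^bsub>\<A>\<^esub> (n::nat)) (\<beta> [^]\<^bsub>\<A>\<^esub> n)"
proof (induction n)
  case (Suc n)
  then have "agree l (\<alpha> \<circ> \<alpha> [^]\<^bsub>\<A>\<^esub> n) (\<beta> \<circ> \<beta> [^]\<^bsub>\<A>\<^esub> n)"
    using assms by (intro agree_comp) auto
  then have "agree l (\<alpha> [^]\<^bsub>\<A>\<^esub> Suc n) (\<beta> [^]\<^bsub>\<A>\<^esub> Suc n)" by simp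
  then show ?case .
qed simp

lemma agree_int_pow:
  assumes "agree l \<alpha> \<beta>" "\<alpha> \<in> carrier \<A>" "\<beta> \<in> carrier \<A>"
  shows "agree l (\<alpha> [^]\<^bsub>\<A>\<^esub> (n::int)) (\<beta> [^]\<^bsub>\<A>\<^esub> n)"
proof (cases n)
  case (nonneg k)
  then show ?thesis using agree_nat_pow[OF assms] by (simp add: int_pow_int)
next
  case (neg k)
  have "agree l (inv\<^bsub>\<A>\<^esub> (\<alpha> [^]\<^bsub>\<A>\<^esub> Suc k)) (inv\<^bsub>\<A>\<^esub> (\<beta> [^]\<^bsub>\<A>\<^esub> Suc k))"
    using assms by (intro agree_inv agree_nat_pow G.nat_pow_closed)
  then show ?thesis
    unfolding neg using assms G.int_pow_neg_int[of _ "Suc k"] by simp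
qed

text \<open>
  The residues of an m-adic integer \<open>\<xi>\<close> are themselves a sequence of integers converging to \<open>\<xi>\<close>.
  This makes the definition of \<open>\<alpha>\<^sup>\<xi>\<close>, a statement about all such sequences, non-vacuous.
\<close>

lemma has_madic_powD:
  assumes "has_madic_pow m \<alpha> \<xi> \<beta>" "\<alpha> \<in> carrier \<A>" "\<xi> \<in> carrier Zm"
  shows "\<beta> \<in> carrier \<A>" "\<forall>\<^sub>F k in sequentially. agree l (\<alpha> [^]\<^bsub>\<A>\<^esub> \<xi> k) \<beta>"
proof -
  have "limitin (tree_topology m) (\<lambda>k. \<alpha> [^]\<^bsub>\<A>\<^esub> \<xi> k) \<beta> sequentially"
    using assms madic_tendsto_self unfolding has_madic_pow_def by blast
  then show "\<beta> \<in> carrier \<A>" "\<forall>\<^sub>F k in sequentially. agree l (\<alpha> [^]\<^bsub>\<A>\<^esub> \<xi> k) \<beta>"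
    using assms by (simp_all add: limitin_tree_topology_iff)
qed

lemma has_madic_powI:
  assumes "\<alpha> \<in> carrier \<A>" "\<beta> \<in> carrier \<A>"
    and "\<And>n l. n mod int m ^ l = \<xi> l \<Longrightarrow> agree l (\<alpha> [^]\<^bsub>\<A>\<^esub> n) \<beta>"
  shows "has_madic_pow m \<alpha> \<xi> \<beta>"
  unfolding has_madic_pow_def
proof (intro allI impI)
  fix n assume n: "madic_tendsto m n \<xi>"
  have "\<forall>\<^sub>F k in sequentially. agree l (\<alpha> [^]\<^bsub>\<A>\<^esub> n k) \<beta>" for l
  proof -
    have "\<forall>\<^sub>F k in sequentially. n k mod int m ^ l = \<xi> l"
      using n by (simp add: madic_tendsto_def)
    then show ?thesis by (rule eventually_mono) (rule assms(3))
  qed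
  then show "limitin (tree_topology m) (\<lambda>k. \<alpha> [^]\<^bsub>\<A>\<^esub> n k) \<beta> sequentially"
    using assms by (simp add: limitin_tree_topology_iff)
qed

lemma has_madic_pow_agree:
  assumes "has_madic_pow m \<alpha> \<xi> \<beta>" "has_madic_pow m \<alpha>' \<xi> \<beta>'" "agree l \<alpha> \<alpha>'"
    and "\<alpha> \<in> carrier \<A>" "\<alpha>' \<in> carrier \<A>" "\<xi> \<in> carrier Zm"
  shows "agree l \<beta> \<beta>'"
proof -
  have "\<forall>\<^sub>F k in sequentially. agree l (\<alpha> [^]\<^bsub>\<A>\<^esub> \<xi> k) \<beta> \<and> agree l (\<alpha>' [^]\<^bsub>\<A>\<^esub> \<xi> k) \<beta>'"
    using assms has_madic_powD(2) by (simp add: eventually_conj)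
  then obtain k where "agree l (\<alpha> [^]\<^bsub>\<A>\<^esub> \<xi> k) \<beta>" "agree l (\<alpha>' [^]\<^bsub>\<A>\<^esub> \<xi> k) \<beta>'"
    using eventually_happens'[OF sequentially_bot] by blast
  then show ?thesis
    using agree_int_pow[OF assms(3-5)] agree_sym agree_trans by blast
qed

lemma diag_partial_prod_closed:
  "(\<And>i. \<gamma> i \<in> carrier \<A>) \<Longrightarrow> diag_partial_prod m \<gamma> k \<in> carrier \<A>"
  by (induction k) (simp_all add: tree_aut_comp_closed)

lemma diag_pow_id [simp]: "(diag ^^ i) id = id"
  using diag.hom_one by (induction i) simp_all

lemma diag_partial_prod_agree:
  assumes "\<And>i. \<gamma> i \<in> carrier \<A>" "\<And>i. \<gamma>' i \<in> carrier \<A>" "\<And>i. agree l (\<gamma> i) (\<gamma>' i)"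
  shows "agree l (diag_partial_prod m \<gamma> k) (diag_partial_prod m \<gamma>' k)"
proof (induction k)
  case (Suc k)
  have "agree l ((diag ^^ k) (\<gamma> k)) ((diag ^^ k) (\<gamma>' k))"
    using agree_mono[OF agree_diag_pow[OF assms(3)]] by simp
  with Suc have "agree l ((diag ^^ k) (\<gamma> k) \<circ> diag_partial_prod m \<gamma> k)
      ((diag ^^ k) (\<gamma>' k) \<circ> diag_partial_prod m \<gamma>' k)"
    using diag_partial_prod_closed[of \<gamma>, OF assms(1)] by (intro agree_comp)
  then have "agree l (diag_partial_prod m \<gamma> (Suc k)) (diag_partial_prod m \<gamma>' (Suc k))" by simp
  then show ?case .
qed simp

text \<open>
  The \<open>k\<close>-th factor of \<open>\<alpha>\<^sup>q\<close> is a \<open>k\<close>-fold diagonal and hence acts trivially up to level \<open>k\<close>; so the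
  infinite product stabilizes on every level.
\<close>

lemma diag_partial_prod_step:
  assumes "\<And>i. \<gamma> i \<in> carrier \<A>"
  shows "agree k (diag_partial_prod m \<gamma> (Suc k)) (diag_partial_prod m \<gamma> k)"
proof -
  have "agree (0 + k) ((diag ^^ k) (\<gamma> k)) ((diag ^^ k) id)"
    using assms by (intro agree_diag_pow agree_0) simp_all
  then have "agree k ((diag ^^ k) (\<gamma> k) \<circ> diag_partial_prod m \<gamma> k) (id \<circ> diag_partial_prod m \<gamma> k)"
    using assms diag_partial_prod_closed by (intro agree_comp) simp_all
  then show ?thesis by simp
qed

lemma has_fps_powD:
  assumes "has_fps_pow m \<alpha> q \<beta>" "\<alpha> \<in> carrier \<A>" "q \<in> carrier R"
  obtains \<gamma> where "\<And>i. has_madic_pow m \<alpha> (q i) (\<gamma> i)" "\<And>i. \<gamma> i \<in> carrier \<A>" "\<beta> \<in> carrier \<A>"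
    "\<And>l. \<forall>\<^sub>F k in sequentially. agree l (diag_partial_prod m \<gamma> k) \<beta>"
proof -
  obtain \<gamma> where \<gamma>: "\<And>i. has_madic_pow m \<alpha> (q i) (\<gamma> i)"
    "limitin (tree_topology m) (diag_partial_prod m \<gamma>) \<beta> sequentially"
    using assms(1) unfolding has_fps_pow_def by blast
  have "\<gamma> i \<in> carrier \<A>" for i
    using has_madic_powD(1)[OF \<gamma>(1)] assms in_madic_fps_iff by blast
  with \<gamma> that show ?thesis
    using limitin_tree_topology_iff[of "diag_partial_prod m \<gamma>"] diag_partial_prod_closed by blast
qed

lemma has_fps_powI:
  assumes "\<And>i. has_madic_pow m \<alpha> (q i) (\<gamma> i)" "\<And>i. \<gamma> i \<in> carrier \<A>" "\<beta> \<in> carrier \<A>"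
    "\<And>k. agree k (diag_partial_prod m \<gamma> k) \<beta>"
  shows "has_fps_pow m \<alpha> q \<beta>"
proof -
  have "\<forall>\<^sub>F k in sequentially. agree l (diag_partial_prod m \<gamma> k) \<beta>" for l
    by (rule eventually_sequentiallyI[of l]) (use assms(4) agree_mono in blast)
  then show ?thesis
    unfolding has_fps_pow_def using assms diag_partial_prod_closed[of \<gamma>, OF assms(2)]
    by (intro exI[of _ \<gamma>]) (simp add: limitin_tree_topology_iff)
qed

lemma has_fps_pow_closed:
  "has_fps_pow m \<alpha> q \<beta> \<Longrightarrow> \<alpha> \<in> carrier \<A> \<Longrightarrow> q \<in> carrier R \<Longrightarrow> \<beta> \<in> carrier \<A>"
  by (elim has_fps_powD)

text \<open>
  On each level \<open>\<alpha>\<^sup>q\<close> depends only on the action of \<open>\<alpha>\<close> on that level.  This gives the uniqueness of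
  powers, and also that of the solution of \<open>\<alpha> = (\<alpha>\<^sup>q\<^sup>1, \<dots>, \<alpha>\<^sup>q\<^sup>m)\<sigma>\<close>: the action of \<open>\<alpha>\<close> on level \<open>l\<close>
  determines that of the states \<open>\<alpha>\<^sup>q\<^sup>i\<close> on level \<open>l\<close>, hence that of \<open>\<alpha>\<close> on level \<open>l + 1\<close>.
\<close>

lemma has_fps_pow_agree:
  assumes "has_fps_pow m \<alpha> q \<beta>" "has_fps_pow m \<alpha>' q \<beta>'" "agree l \<alpha> \<alpha>'"
    and \<alpha>: "\<alpha> \<in> carrier \<A>" "\<alpha>' \<in> carrier \<A>" "q \<in> carrier R"
  shows "agree l \<beta> \<beta>'"
proof -
  obtain \<gamma> where \<gamma>: "\<And>i. has_madic_pow m \<alpha> (q i) (\<gamma> i)" "\<And>i. \<gamma> i \<in> carrier \<A>"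
    "\<forall>\<^sub>F k in sequentially. agree l (diag_partial_prod m \<gamma> k) \<beta>"
    using has_fps_powD[OF assms(1) \<alpha>(1,3)] by metis
  obtain \<gamma>' where \<gamma>': "\<And>i. has_madic_pow m \<alpha>' (q i) (\<gamma>' i)" "\<And>i. \<gamma>' i \<in> carrier \<A>"
    "\<forall>\<^sub>F k in sequentially. agree l (diag_partial_prod m \<gamma>' k) \<beta>'"
    using has_fps_powD[OF assms(2) \<alpha>(2,3)] by metis
  obtain k where "agree l (diag_partial_prod m \<gamma> k) \<beta>" "agree l (diag_partial_prod m \<gamma>' k) \<beta>'"
    using eventually_happens'[OF sequentially_bot eventually_conj[OF \<gamma>(3) \<gamma>'(3)]] by blast
  moreover have "agree l (\<gamma> i) (\<gamma>' i)" for i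
    using has_madic_pow_agree[OF \<gamma>(1) \<gamma>'(1) assms(3) \<alpha>(1,2)] \<alpha>(3) in_madic_fps_iff by blast
  then have "agree l (diag_partial_prod m \<gamma> k) (diag_partial_prod m \<gamma>' k)"
    by (rule diag_partial_prod_agree[OF \<gamma>(2) \<gamma>'(2)])
  ultimately show ?thesis using agree_sym agree_trans by metis
qed

lemma has_fps_pow_unique:
  assumes "has_fps_pow m \<alpha> q \<beta>" "has_fps_pow m \<alpha> q \<beta>'" "\<alpha> \<in> carrier \<A>" "q \<in> carrier R"
  shows "\<beta> = \<beta>'"
proof (rule agree_all_eq)
  show "\<beta> \<in> carrier \<A>" "\<beta>' \<in> carrier \<A>" using assms has_fps_pow_closed by metis+
  show "agree l \<beta> \<beta>'" for l
    by (rule has_fps_pow_agree[OF assms(1,2) agree_refl assms(3,3,4)])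
qed

lemma fps_pow_eq:
  "has_fps_pow m \<alpha> q \<beta> \<Longrightarrow> \<alpha> \<in> carrier \<A> \<Longrightarrow> q \<in> carrier R \<Longrightarrow> fps_pow m \<alpha> q = \<beta>"
  unfolding fps_pow_def using has_fps_pow_unique by blast

lemma diag_top_closed_pow:
  assumes "diag_top_closed C" "\<alpha> \<in> C" "\<xi> \<in> carrier Zm" "has_madic_pow m \<alpha> \<xi> \<beta>"
  shows "\<beta> \<in> C"
proof -
  have sub: "subgroup C \<A>" using assms(1) by (simp add: diag_top_closed_def)
  note \<alpha> = subgroup_in_carrier[OF sub assms(2)]
  have "\<exists>\<gamma>\<in>C. agree l \<gamma> \<beta>" for l
  proof -
    obtain k where "agree l (\<alpha> [^]\<^bsub>\<A>\<^esub> \<xi> k) \<beta>"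
      using has_madic_powD(2)[OF assms(4) \<alpha> assms(3)] eventually_happens'[OF sequentially_bot]
      by blast
    then show ?thesis using G.subgroup_int_pow_closed[OF sub assms(2)] by blast
  qed
  then show ?thesis
    using has_madic_powD(1)[OF assms(4) \<alpha> assms(3)] assms(1) unfolding diag_top_closed_def by blast
qed

lemma diag_top_closed_partial_prod:
  assumes "diag_top_closed C" "\<And>i. \<gamma> i \<in> C"
  shows "diag_partial_prod m \<gamma> k \<in> C"
proof -
  have sub: "subgroup C \<A>" using assms(1) by (simp add: diag_top_closed_def)
  show ?thesis
  proof (induction k)
    case 0
    have "diag_partial_prod m \<gamma> 0 \<in> C" using subgroup.one_closed[OF sub] by simp
    then show ?case .
  next
    case (Suc k)
    then have "diag_partial_prod m \<gamma> (Suc k) \<in> C"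
      using subgroup.m_closed[OF sub Suc diag_top_closed_diag_pow[OF assms]] by simp
    then show ?case .
  qed
qed

lemma diag_top_closed_fps_pow:
  assumes "diag_top_closed C" "\<alpha> \<in> C" "q \<in> carrier R" "has_fps_pow m \<alpha> q \<beta>"
  shows "\<beta> \<in> C"
proof -
  have sub: "subgroup C \<A>" using assms(1) by (simp add: diag_top_closed_def)
  note \<alpha> = subgroup_in_carrier[OF sub assms(2)]
  obtain \<gamma> where \<gamma>: "\<And>i. has_madic_pow m \<alpha> (q i) (\<gamma> i)" "\<beta> \<in> carrier \<A>"
    "\<And>l. \<forall>\<^sub>F k in sequentially. agree l (diag_partial_prod m \<gamma> k) \<beta>"
    using has_fps_powD[OF assms(4) \<alpha> assms(3)] by metis
  have "\<gamma> i \<in> C" for i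
    using diag_top_closed_pow[OF assms(1,2) _ \<gamma>(1)] assms(3) in_madic_fps_iff by blast
  then have prod: "diag_partial_prod m \<gamma> k \<in> C" for k
    by (rule diag_top_closed_partial_prod[OF assms(1)])
  have "\<exists>\<delta>\<in>C. agree l \<delta> \<beta>" for l
    using eventually_happens'[OF sequentially_bot \<gamma>(3)[of l]] prod by blast
  then show ?thesis using \<gamma>(2) assms(1) unfolding diag_top_closed_def by blast
qed

lemma tree_rec_unique:
  assumes "q \<in> Y \<rightarrow> carrier R" "tree_rec m q \<sigma> \<alpha>" "tree_rec m q \<sigma> \<alpha>'"
  shows "\<alpha> = \<alpha>'"
proof -
  from assms obtain \<beta> \<beta>' where \<alpha>: "\<alpha> \<in> carrier \<A>" "\<alpha>' \<in> carrier \<A>"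
    and pow: "\<And>y. y \<in> Y \<Longrightarrow> has_fps_pow m \<alpha> (q y) (\<beta> y)" "\<And>y. y \<in> Y \<Longrightarrow> has_fps_pow m \<alpha>' (q y) (\<beta>' y)"
    and eq: "\<alpha> = tree_cons m \<beta> \<sigma>" "\<alpha>' = tree_cons m \<beta>' \<sigma>"
    unfolding tree_rec_def by blast
  have "agree l \<alpha> \<alpha>'" for l
  proof (induction l)
    case 0
    then show ?case using \<alpha> by (rule agree_0)
  next
    case (Suc l)
    have "agree (Suc l) (tree_cons m \<beta> \<sigma>) (tree_cons m \<beta>' \<sigma>)"
      using assms(1) has_fps_pow_agree[OF pow Suc \<alpha>] by (intro agree_tree_cons) blast
    then show ?case by (simp only: eq[symmetric])
  qed
  then show ?thesis by (rule agree_all_eq[OF \<alpha>])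
qed

text \<open>
  Products of automorphisms and of permutations are composed in opposite orders, so \<open>rt\<close> is an
  anti-homomorphism; on the powers of a single element this makes no difference.
\<close>

lemma root_perm_nat_pow:
  assumes "\<alpha> \<in> carrier \<A>"
  shows "rt (\<alpha> [^]\<^bsub>\<A>\<^esub> (n::nat)) = rt \<alpha> [^]\<^bsub>sym_group m\<^esub> n"
proof -
  interpret S: group "sym_group m" by (rule sym_group_is_group)
  show ?thesis
  proof (induction n)
    case 0
    have "rt (\<alpha> [^]\<^bsub>\<A>\<^esub> (0::nat)) = rt \<alpha> [^]\<^bsub>sym_group m\<^esub> (0::nat)"
      by (simp add: sym_group_one)
    then show ?case .
  next
    case (Suc n)
    have "rt (\<alpha> [^]\<^bsub>\<A>\<^esub> Suc n) = rt \<alpha> \<circ> rt (\<alpha> [^]\<^bsub>\<A>\<^esub> n)"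
      using root_perm_comp[OF G.nat_pow_closed[OF assms, of n] assms] by simp
    also have "\<dots> = rt \<alpha> \<otimes>\<^bsub>sym_group m\<^esub> rt \<alpha> [^]\<^bsub>sym_group m\<^esub> n"
      by (simp only: Suc sym_group_mult)
    also have "\<dots> = rt \<alpha> [^]\<^bsub>sym_group m\<^esub> Suc n"
      using root_perm_permutes[OF assms] by (intro S.nat_pow_Suc2[symmetric]) (simp add: sym_group_carrier)
    finally show ?case .
  qed
qed

lemma root_perm_int_pow:
  assumes "\<alpha> \<in> carrier \<A>"
  shows "rt (\<alpha> [^]\<^bsub>\<A>\<^esub> (n::int)) = rt \<alpha> [^]\<^bsub>sym_group m\<^esub> n"
proof -
  interpret S: group "sym_group m" by (rule sym_group_is_group)
  have \<sigma>: "rt \<alpha> \<in> carrier (sym_group m)"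
    using root_perm_permutes[OF assms] by (simp add: sym_group_carrier)
  show ?thesis
  proof (cases n)
    case (nonneg k)
    then show ?thesis using root_perm_nat_pow[OF assms] by (simp add: int_pow_int)
  next
    case (neg k)
    then show ?thesis
      using G.int_pow_neg_int[OF assms, of "Suc k"] S.int_pow_neg_int[OF \<sigma>, of "Suc k"]
      by (simp only: root_perm_inv root_perm_nat_pow assms G.nat_pow_closed)
  qed
qed

text \<open>
  The image of a subgroup under an anti-homomorphism is a subgroup.
\<close>

lemma perm_group_subgroup:
  assumes "subgroup C \<A>"
  shows "subgroup (perm_group m C) (sym_group m)"
proof (rule group.subgroupI[OF sym_group_is_group])
  note C = subgroup.subset[OF assms]
  show "perm_group m C \<subseteq> carrier (sym_group m)"
    using C root_perm_permutes by (auto simp: perm_group_def sym_group_carrier)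
  show "perm_group m C \<noteq> {}" using subgroup.one_closed[OF assms] by (auto simp: perm_group_def)
  fix \<pi> assume "\<pi> \<in> perm_group m C"
  then obtain \<alpha> where \<alpha>: "\<alpha> \<in> C" "\<pi> = rt \<alpha>" by (auto simp: perm_group_def)
  then show "inv\<^bsub>sym_group m\<^esub> \<pi> \<in> perm_group m C"
    using subgroup.m_inv_closed[OF assms \<alpha>(1)] C unfolding perm_group_def
    by (auto simp flip: root_perm_inv)
  fix \<rho> assume "\<rho> \<in> perm_group m C"
  then obtain \<beta> where \<beta>: "\<beta> \<in> C" "\<rho> = rt \<beta>" by (auto simp: perm_group_def)
  have "\<pi> \<otimes>\<^bsub>sym_group m\<^esub> \<rho> = rt (\<beta> \<otimes>\<^bsub>\<A>\<^esub> \<alpha>)"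
    using \<alpha> \<beta> C by (auto simp: sym_group_mult root_perm_comp subset_iff)
  then show "\<pi> \<otimes>\<^bsub>sym_group m\<^esub> \<rho> \<in> perm_group m C"
    using subgroup.m_closed[OF assms \<beta>(1) \<alpha>(1)] unfolding perm_group_def by blast
qed

end

section \<open>Powers in the closure of an abelian transitive state-closed group\<close>

text \<open>
  The properties of \<open>A\<^sup>*\<close>, for \<open>A\<close> abelian, transitive and state-closed, on which the theory of its
  powers rests.
\<close>

locale closed_abelian = m_ary_tree +
  fixes C :: "(nat list \<Rightarrow> nat list) set"
  assumes state_abelian: "state_abelian C"
    and diag_top_closed: "diag_top_closed C"
    and transitive: "transitive_on_level1 m C"
begin

lemma subgroup: "subgroup C \<A>"
  using state_abelian by (simp add: state_abelian_def)

lemma in_carrier [simp]: "\<alpha> \<in> C \<Longrightarrow> \<alpha> \<in> carrier \<A>"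
  using subgroup_in_carrier[OF subgroup] .

lemma comp_closed: "\<alpha> \<in> C \<Longrightarrow> y \<in> Y \<Longrightarrow> cmp \<alpha> y \<in> C"
  and commute: "\<alpha> \<in> C \<Longrightarrow> \<beta> \<in> C \<Longrightarrow> \<beta> \<circ> \<alpha> = \<alpha> \<circ> \<beta>"
  using state_abelian unfolding state_abelian_def by blast+

lemma moves_1:
  assumes "y \<in> Y"
  obtains \<delta> where "\<delta> \<in> C" "rt \<delta> 1 = y"
proof -
  have "1 \<in> Y" using m_ge_2 by simp
  with assms transitive obtain \<pi> where "\<pi> \<in> perm_group m C" "\<pi> 1 = y"
    unfolding transitive_on_level1_def by blast
  with that show ?thesis unfolding perm_group_def by blast
qed

text \<open>
  A transitive abelian permutation group is regular.
\<close>

lemma root_regular: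
  assumes "\<gamma> \<in> C" "\<gamma>' \<in> C" "rt \<gamma> 1 = rt \<gamma>' 1"
  shows "rt \<gamma> = rt \<gamma>'"
proof
  fix y show "rt \<gamma> y = rt \<gamma>' y"
  proof (cases "y \<in> Y")
    case True
    then obtain \<delta> where \<delta>: "\<delta> \<in> C" "rt \<delta> 1 = y" by (rule moves_1)
    have "rt \<epsilon> y = rt \<delta> (rt \<epsilon> 1)" if "\<epsilon> \<in> C" for \<epsilon>
      using commute[OF \<delta>(1) that] \<delta> that root_perm_comp[of \<delta> \<epsilon>] root_perm_comp[of \<epsilon> \<delta>]
      by (metis comp_apply in_carrier)
    then show ?thesis using assms by simp
  qed (simp add: root_perm_outside)
qed

text \<open>
  The central structural fact.  Let \<open>\<delta>\<close> send the letter 1 to \<open>y\<close>.  Comparing the states of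
  \<open>\<gamma>\<delta> = \<delta>\<gamma>\<close> at 1 gives \<open>\<gamma>\<^sub>1 \<delta>\<^sub>1 = \<delta>\<^sub>1 \<gamma>\<^sub>y\<close>, and as states commute, \<open>\<gamma>\<^sub>1 = \<gamma>\<^sub>y\<close>.
\<close>

lemma trivial_root_diag:
  assumes "\<gamma> \<in> C" "rt \<gamma> = id"
  obtains \<gamma>' where "\<gamma>' \<in> C" "\<gamma> = diag \<gamma>'"
proof -
  have "(1::nat) \<in> Y" using m_ge_2 by simp
  have comp_eq: "cmp \<gamma> y = cmp \<gamma> 1" if "y \<in> Y" for y
  proof -
    obtain \<delta> where \<delta>: "\<delta> \<in> C" "rt \<delta> 1 = y" using \<open>y \<in> Y\<close> by (rule moves_1)
    have mem: "cmp \<gamma> 1 \<in> C" "cmp \<gamma> y \<in> C" "cmp \<delta> 1 \<in> C"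
      using comp_closed assms(1) \<delta>(1) \<open>y \<in> Y\<close> \<open>1 \<in> Y\<close> by blast+
    have "cmp \<delta> 1 \<circ> cmp \<gamma> 1 = cmp (\<delta> \<circ> \<gamma>) 1"
      using tree_comp_comp[of \<gamma> \<delta> 1] assms \<delta> \<open>1 \<in> Y\<close> by simp
    also have "\<delta> \<circ> \<gamma> = \<gamma> \<circ> \<delta>" using commute assms(1) \<delta>(1) by blast
    also have "cmp (\<gamma> \<circ> \<delta>) 1 = cmp \<gamma> y \<circ> cmp \<delta> 1"
      using tree_comp_comp[of \<delta> \<gamma> 1] assms \<delta> \<open>1 \<in> Y\<close> by simp
    also have "\<dots> = cmp \<delta> 1 \<circ> cmp \<gamma> y" using commute mem by blast
    finally have "cmp \<delta> 1 \<circ> cmp \<gamma> 1 = cmp \<delta> 1 \<circ> cmp \<gamma> y" .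
    then have "cmp \<gamma> 1 \<otimes>\<^bsub>\<A>\<^esub> cmp \<delta> 1 = cmp \<gamma> y \<otimes>\<^bsub>\<A>\<^esub> cmp \<delta> 1"
      by (simp only: tree_aut_mult)
    then show ?thesis using mem G.right_cancel by (metis in_carrier)
  qed
  have "\<gamma> = diag (cmp \<gamma> 1)"
    by (rule tree_aut_eq_diag[OF in_carrier[OF assms(1)] assms(2) comp_eq])
  with comp_closed[OF assms(1) \<open>1 \<in> Y\<close>] that show ?thesis by blast
qed

lemma card_perm_group: "card (perm_group m C) = m"
proof -
  have "1 \<in> Y" using m_ge_2 by simp
  \<comment> \<open>A regular permutation group is in bijection with the set on which it acts.\<close>
  have "bij_betw (\<lambda>\<pi>. \<pi> 1) (perm_group m C) Y"
    unfolding bij_betw_def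
  proof
    show "inj_on (\<lambda>\<pi>. \<pi> 1) (perm_group m C)"
      using root_regular by (auto simp: inj_on_def perm_group_def)
    show "(\<lambda>\<pi>. \<pi> 1) ` perm_group m C = Y"
    proof
      show "Y \<subseteq> (\<lambda>\<pi>. \<pi> 1) ` perm_group m C"
      proof
        fix y assume "y \<in> Y"
        then obtain \<delta> where "\<delta> \<in> C" "rt \<delta> 1 = y" by (rule moves_1)
        then show "y \<in> (\<lambda>\<pi>. \<pi> 1) ` perm_group m C" unfolding perm_group_def by blast
      qed
      show "(\<lambda>\<pi>. \<pi> 1) ` perm_group m C \<subseteq> Y"
        using tree_aut_letter(2)[OF in_carrier \<open>1 \<in> Y\<close>] unfolding perm_group_def by blast
    qed
  qed
  then show ?thesis using bij_betw_same_card by fastforce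
qed

lemma root_perm_pow_m:
  assumes "\<gamma> \<in> C"
  shows "rt (\<gamma> [^]\<^bsub>\<A>\<^esub> m) = id"
proof -
  interpret S: group "sym_group m" by (rule sym_group_is_group)
  let ?P = "perm_group m C"
  have sub: "subgroup ?P (sym_group m)" by (rule perm_group_subgroup[OF subgroup])
  interpret P: group "sym_group m\<lparr>carrier := ?P\<rparr>" by (rule S.subgroup_imp_group[OF sub])
  have "rt \<gamma> \<in> ?P" using assms by (simp add: perm_group_def)
  then have "rt \<gamma> [^]\<^bsub>sym_group m\<lparr>carrier := ?P\<rparr>\<^esub> m = id"
    using P.pow_order_eq_1[of "rt \<gamma>"] card_perm_group by (simp add: order_def sym_group_one)
  then show ?thesis
    using assms by (simp add: root_perm_nat_pow flip: S.nat_pow_consistent)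
qed

text \<open>
  By regularity \<open>\<gamma>\<^sup>m\<close> has trivial root permutation, so \<open>\<gamma>\<^sup>m = \<delta>\<^sup>(\<^sup>1\<^sup>)\<close>; raising to the power \<open>m\<^sup>l\<close> moves
  the claim one level down.  This is what makes exponents in the m-adic integers meaningful.
\<close>

lemma pow_m_pow_trivial:
  assumes "\<gamma> \<in> C"
  shows "agree l (\<gamma> [^]\<^bsub>\<A>\<^esub> (m ^ l)) id"
  using assms
proof (induction l arbitrary: \<gamma>)
  case 0
  then show ?case by (intro agree_0 id_tree_aut G.nat_pow_closed in_carrier)
next
  case (Suc l)
  have "\<gamma> [^]\<^bsub>\<A>\<^esub> m \<in> C"
    using G.subgroup_int_pow_closed[OF subgroup Suc.prems, of "int m"] by (simp add: int_pow_int)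
  then obtain \<delta> where \<delta>: "\<delta> \<in> C" "\<gamma> [^]\<^bsub>\<A>\<^esub> m = diag \<delta>"
    using root_perm_pow_m[OF Suc.prems] trivial_root_diag by blast
  have "\<gamma> [^]\<^bsub>\<A>\<^esub> (m ^ Suc l) = diag (\<delta> [^]\<^bsub>\<A>\<^esub> (m ^ l))"
    using Suc.prems \<delta> by (simp add: diag.hom_nat_pow flip: G.nat_pow_pow)
  moreover have "agree (Suc l) (diag (\<delta> [^]\<^bsub>\<A>\<^esub> (m ^ l))) (diag id)"
    by (intro agree_diag Suc.IH \<delta>)
  ultimately have "agree (Suc l) (\<gamma> [^]\<^bsub>\<A>\<^esub> (m ^ Suc l)) id" using diag_pow_id[of 1] by simp
  then show ?case .
qed

lemma pow_cong:
  assumes "\<alpha> \<in> C" "n mod int m ^ l = k mod int m ^ l"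
  shows "agree l (\<alpha> [^]\<^bsub>\<A>\<^esub> n) (\<alpha> [^]\<^bsub>\<A>\<^esub> k)"
proof -
  have "int m ^ l dvd n - k" using assms(2) by (simp add: mod_eq_dvd_iff)
  then obtain t where "n = int (m ^ l) * t + k" by (metis diff_eq_eq dvdE of_nat_power)
  then have n: "\<alpha> [^]\<^bsub>\<A>\<^esub> n = (\<alpha> [^]\<^bsub>\<A>\<^esub> (m ^ l)) [^]\<^bsub>\<A>\<^esub> t \<otimes>\<^bsub>\<A>\<^esub> \<alpha> [^]\<^bsub>\<A>\<^esub> k"
    using assms(1) by (simp only: in_carrier G.int_pow_mult flip: G.int_pow_pow int_pow_int)
  have "agree l ((\<alpha> [^]\<^bsub>\<A>\<^esub> (m ^ l)) [^]\<^bsub>\<A>\<^esub> t) (id [^]\<^bsub>\<A>\<^esub> t)"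
    using assms(1) by (intro agree_int_pow pow_m_pow_trivial) auto
  then have "agree l ((\<alpha> [^]\<^bsub>\<A>\<^esub> (m ^ l)) [^]\<^bsub>\<A>\<^esub> t) id"
    using G.int_pow_one[of t] by simp
  then have "agree l (\<alpha> [^]\<^bsub>\<A>\<^esub> k \<circ> (\<alpha> [^]\<^bsub>\<A>\<^esub> (m ^ l)) [^]\<^bsub>\<A>\<^esub> t) (\<alpha> [^]\<^bsub>\<A>\<^esub> k \<circ> id)"
    using assms(1) by (intro agree_comp) auto
  then show ?thesis by (simp add: n)
qed

lemma madic_pow_exists:
  assumes "\<alpha> \<in> C" "\<xi> \<in> carrier Zm"
  obtains \<beta> where "\<beta> \<in> C" "has_madic_pow m \<alpha> \<xi> \<beta>"
proof -
  have \<xi>: "\<xi> (Suc l) mod int m ^ l = \<xi> l" "\<xi> l mod int m ^ l = \<xi> l" for l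
    using assms(2) by (auto simp: in_madic_ring_iff)
  obtain \<beta> where \<beta>: "\<beta> \<in> carrier \<A>" "\<And>l k. l \<le> k \<Longrightarrow> agree l (\<alpha> [^]\<^bsub>\<A>\<^esub> \<xi> k) \<beta>"
    using tree_aut_complete[of "\<lambda>l. \<alpha> [^]\<^bsub>\<A>\<^esub> \<xi> l"] assms(1) pow_cong \<xi>
    by (metis G.int_pow_closed in_carrier)
  have "has_madic_pow m \<alpha> \<xi> \<beta>"
  proof (rule has_madic_powI)
    fix n l assume "n mod int m ^ l = \<xi> l"
    then have "agree l (\<alpha> [^]\<^bsub>\<A>\<^esub> n) (\<alpha> [^]\<^bsub>\<A>\<^esub> \<xi> l)"
      using \<xi> assms(1) by (intro pow_cong) simp_all
    also have "agree l (\<alpha> [^]\<^bsub>\<A>\<^esub> \<xi> l) \<beta>" using \<beta>(2) by blast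
    finally show "agree l (\<alpha> [^]\<^bsub>\<A>\<^esub> n) \<beta>" .
  qed (use assms \<beta> in auto)
  then show ?thesis using that diag_top_closed_pow[OF diag_top_closed assms] by blast
qed

lemma fps_pow_exists:
  assumes "\<alpha> \<in> C" "q \<in> carrier R"
  obtains \<beta> where "\<beta> \<in> C" "has_fps_pow m \<alpha> q \<beta>"
proof -
  have "\<exists>\<beta>. \<beta> \<in> C \<and> has_madic_pow m \<alpha> (q i) \<beta>" for i
    using madic_pow_exists[OF assms(1)] assms(2) in_madic_fps_iff by metis
  then obtain \<gamma> where \<gamma>: "\<And>i. \<gamma> i \<in> C" "\<And>i. has_madic_pow m \<alpha> (q i) (\<gamma> i)" by metis
  have prod: "diag_partial_prod m \<gamma> k \<in> carrier \<A>" for k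
    using \<gamma>(1) by (intro diag_partial_prod_closed in_carrier)
  obtain \<beta> where \<beta>: "\<beta> \<in> carrier \<A>" "\<And>l k. l \<le> k \<Longrightarrow> agree l (diag_partial_prod m \<gamma> k) \<beta>"
    using tree_aut_complete[of "diag_partial_prod m \<gamma>", OF prod diag_partial_prod_step] \<gamma>(1)
    by (metis in_carrier)
  have "has_fps_pow m \<alpha> q \<beta>"
    by (rule has_fps_powI[OF \<gamma>(2)]) (use \<gamma> \<beta> in auto)
  then show ?thesis using that diag_top_closed_fps_pow[OF diag_top_closed assms] by blast
qed

text \<open>
  Digit expansion.  If \<open>\<beta>\<close> and \<open>\<alpha>\<^sup>n\<close> have the same root permutation, then \<open>\<beta> = \<alpha>\<^sup>n \<beta>'\<^sup>(\<^sup>1\<^sup>)\<close> for some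
  \<open>\<beta>'\<close> in \<open>C\<close>; iterating, \<open>\<beta> = \<alpha>\<^sup>n\<^sup>0 (\<alpha>\<^sup>n\<^sup>1)\<^sup>(\<^sup>1\<^sup>) (\<alpha>\<^sup>n\<^sup>2)\<^sup>(\<^sup>2\<^sup>) \<dots>\<close>.  So \<open>\<alpha>\<close> generates \<open>C\<close> as a module as soon
  as its root permutation generates the permutation group of \<open>C\<close>.
\<close>

lemma fps_pow_generates:
  assumes "\<alpha> \<in> C" "\<And>\<beta>. \<beta> \<in> C \<Longrightarrow> \<exists>n::int. rt \<beta> = rt (\<alpha> [^]\<^bsub>\<A>\<^esub> n)" "\<beta> \<in> C"
  obtains q where "q \<in> carrier R" "has_fps_pow m \<alpha> q \<beta>"
proof -
  have "\<exists>(n::int) \<beta>'. \<beta>' \<in> C \<and> \<beta> = \<alpha> [^]\<^bsub>\<A>\<^esub> n \<otimes>\<^bsub>\<A>\<^esub> diag \<beta>'" if \<beta>: "\<beta> \<in> C" for \<beta>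
  proof -
    obtain n :: int where n: "rt \<beta> = rt (\<alpha> [^]\<^bsub>\<A>\<^esub> n)" using assms(2)[OF \<beta>] by blast
    let ?\<alpha> = "\<alpha> [^]\<^bsub>\<A>\<^esub> n"
    have \<alpha>: "?\<alpha> \<in> C" by (rule G.subgroup_int_pow_closed[OF subgroup assms(1)])
    have "inv\<^bsub>\<A>\<^esub> ?\<alpha> \<otimes>\<^bsub>\<A>\<^esub> \<beta> \<in> C"
      using subgroup \<alpha> \<beta> by (intro subgroup.m_closed subgroup.m_inv_closed)
    moreover have "rt (inv\<^bsub>\<A>\<^esub> ?\<alpha> \<otimes>\<^bsub>\<A>\<^esub> \<beta>) = rt (inv\<^bsub>\<A>\<^esub> ?\<alpha> \<otimes>\<^bsub>\<A>\<^esub> ?\<alpha>)"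
      using \<alpha> \<beta> n by (simp add: root_perm_comp del: inv_comp G.l_inv)
    then have "rt (inv\<^bsub>\<A>\<^esub> ?\<alpha> \<otimes>\<^bsub>\<A>\<^esub> \<beta>) = id" using \<alpha> by simp
    ultimately obtain \<beta>' where "\<beta>' \<in> C" "inv\<^bsub>\<A>\<^esub> ?\<alpha> \<otimes>\<^bsub>\<A>\<^esub> \<beta> = diag \<beta>'"
      by (rule trivial_root_diag)
    then show ?thesis
      using G.inv_solve_left[of "diag \<beta>'" ?\<alpha> \<beta>] \<alpha> \<beta> by (metis diag_closed in_carrier)
  qed
  then obtain d b where d: "\<And>\<beta>. \<beta> \<in> C \<Longrightarrow> b \<beta> \<in> C"
    "\<And>\<beta>. \<beta> \<in> C \<Longrightarrow> \<beta> = \<alpha> [^]\<^bsub>\<A>\<^esub> (d \<beta> :: int) \<otimes>\<^bsub>\<A>\<^esub> diag (b \<beta>)" by metis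
  \<comment> \<open>The remainders and digits of the expansion; an integer digit is also an m-adic integer.\<close>
  define \<beta>s where "\<beta>s k = (b ^^ k) \<beta>" for k
  define q where "q k i = d (\<beta>s k) mod int m ^ i" for k i
  define \<gamma> where "\<gamma> k = \<alpha> [^]\<^bsub>\<A>\<^esub> d (\<beta>s k)" for k
  have \<beta>s: "\<beta>s k \<in> C" for k by (induction k) (simp_all add: \<beta>s_def assms(3) d)
  have step: "\<beta>s k = diag (\<beta>s (Suc k)) \<circ> \<gamma> k" for k
    using d(2)[OF \<beta>s[of k]] by (simp add: \<beta>s_def \<gamma>_def)
  have \<gamma>: "\<gamma> k \<in> C" "\<gamma> k \<in> carrier \<A>" for k
    using G.subgroup_int_pow_closed[OF subgroup assms(1)] by (auto simp: \<gamma>_def)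
  have q: "q \<in> carrier R"
    using integer_in_madic_ring by (simp add: in_madic_fps_iff q_def[abs_def])
  \<comment> \<open>The part of \<open>\<beta>\<close> left after \<open>k\<close> digits is a \<open>k\<close>-fold diagonal.\<close>
  have rest: "\<beta> = (diag ^^ k) (\<beta>s k) \<circ> diag_partial_prod m \<gamma> k" for k
  proof (induction k)
    case 0
    have "\<beta> = (diag ^^ 0) (\<beta>s 0) \<circ> diag_partial_prod m \<gamma> 0" by (simp add: \<beta>s_def)
    then show ?case .
  next
    case (Suc k)
    have "(diag ^^ k) (\<beta>s k) = (diag ^^ k) (diag (\<beta>s (Suc k)) \<circ> \<gamma> k)"
      using step[of k] by simp
    also have "\<dots> = (diag ^^ k) (diag (\<beta>s (Suc k))) \<circ> (diag ^^ k) (\<gamma> k)"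
      using \<gamma> \<beta>s by (intro diag_pow_comp) auto
    also have "\<dots> = (diag ^^ Suc k) (\<beta>s (Suc k)) \<circ> (diag ^^ k) (\<gamma> k)"
      by (simp add: funpow_swap1)
    finally have "(diag ^^ k) (\<beta>s k) \<circ> diag_partial_prod m \<gamma> k =
        (diag ^^ Suc k) (\<beta>s (Suc k)) \<circ> diag_partial_prod m \<gamma> (Suc k)"
      by (simp add: comp_assoc)
    then show ?case by (rule trans[OF Suc])
  qed
  have "has_fps_pow m \<alpha> q \<beta>"
  proof (rule has_fps_powI)
    show "has_madic_pow m \<alpha> (q i) (\<gamma> i)" for i
    proof (rule has_madic_powI)
      fix n l assume "n mod int m ^ l = q i l"
      then show "agree l (\<alpha> [^]\<^bsub>\<A>\<^esub> n) (\<gamma> i)"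
        unfolding \<gamma>_def by (intro pow_cong assms(1)) (simp add: q_def)
    qed (use assms \<gamma> in auto)
    show "agree k (diag_partial_prod m \<gamma> k) \<beta>" for k
    proof -
      have "agree (0 + k) ((diag ^^ k) (\<beta>s k)) ((diag ^^ k) id)"
        using \<beta>s by (intro agree_diag_pow agree_0) auto
      then have "agree k (id \<circ> diag_partial_prod m \<gamma> k) ((diag ^^ k) (\<beta>s k) \<circ> diag_partial_prod m \<gamma> k)"
        using \<gamma> diag_partial_prod_closed by (intro agree_comp) (auto intro: agree_sym)
      then show ?thesis by (simp flip: rest)
    qed
  qed (use assms \<gamma> in auto)
  with q that show ?thesis by blast
qed

end

section \<open>The ring of power series over the m-adic integers\<close>

text \<open>
  Coefficientwise congruence.  A power series over the m-adic integers is handled through its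
  residues modulo \<open>m\<^sup>i\<close>, represented by ordinary integer power series; identities are then checked
  in the commutative ring of integer power series, up to this congruence.
\<close>

definition fcong :: "int \<Rightarrow> int fps \<Rightarrow> int fps \<Rightarrow> bool" where
  "fcong M a b \<longleftrightarrow> (\<forall>n. M dvd fps_nth (a - b) n)"

lemma fcong_refl [simp]: "fcong M a a"
  by (simp add: fcong_def)

lemma fcong_sym: "fcong M a b \<Longrightarrow> fcong M b a"
  by (simp add: fcong_def dvd_diff_commute)

lemma fcong_add: "fcong M a b \<Longrightarrow> fcong M c d \<Longrightarrow> fcong M (a + c) (b + d)"
  unfolding fcong_def by (metis add_diff_add dvd_add fps_add_nth)

lemma fcong_uminus: "fcong M a b \<Longrightarrow> fcong M (- a) (- b)"
  unfolding fcong_def by (metis dvd_minus_iff fps_neg_nth minus_diff_minus)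

lemma fcong_diff: "fcong M a b \<Longrightarrow> fcong M c d \<Longrightarrow> fcong M (a - c) (b - d)"
  using fcong_add[of M a b "- c" "- d"] fcong_uminus by simp

lemma fcong_trans [trans]: "fcong M a b \<Longrightarrow> fcong M b c \<Longrightarrow> fcong M a c"
  using fcong_add[of M "a - b" 0 "b - c" 0] by (simp add: fcong_def)

lemma fcong_mult: 
  assumes "fcong M a b" "fcong M c d" 
  shows "fcong M (a * c) (b * d)"
proof -
  have "a * c - b * d = (a - b) * c + b * (c - d)" by (simp add: algebra_simps)
  moreover have "M dvd fps_nth ((a - b) * c) n" "M dvd fps_nth (b * (c - d)) n" for n
    using assms by (auto simp: fcong_def fps_mult_nth simp del: fps_sub_nth intro!: dvd_sum)
  ultimately show ?thesis by (simp add: fcong_def del: fps_sub_nth)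
qed

lemma fcong_sum: "(\<And>x. x \<in> A \<Longrightarrow> fcong M (f x) (g x)) \<Longrightarrow> fcong M (sum f A) (sum g A)"
  by (induction A rule: infinite_finite_induct) (auto intro: fcong_add)

lemma fcong_shift: "fcong M a b \<Longrightarrow> fcong M (fps_shift k a) (fps_shift k b)"
  by (simp add: fcong_def)

lemma fcong_dvd: "fcong M a b \<Longrightarrow> N dvd M \<Longrightarrow> fcong N a b"
  unfolding fcong_def using dvd_trans by blast

lemma fcong_mod: "fcong M a b \<longleftrightarrow> (\<forall>n. fps_nth a n mod M = fps_nth b n mod M)"
  by (simp add: fcong_def mod_eq_dvd_iff)

context m_ary_tree
begin

text \<open>
  \<open>slice i\<close> lifts the residue of a series modulo \<open>m\<^sup>i\<close> to an integer series, and \<open>reduce\<close> glues a family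
  of integer series, the \<open>i\<close>-th taken modulo \<open>m\<^sup>i\<close>.  Coherent families are those that give elements
  of the ring (\<open>reduce_in_carrier\<close>), and every element arises (\<open>reduce_slice\<close>).
\<close>

definition slice :: "nat \<Rightarrow> (nat \<Rightarrow> nat \<Rightarrow> int) \<Rightarrow> int fps" where
  "slice i p = Abs_fps (\<lambda>n. p n i)"

definition reduce :: "(nat \<Rightarrow> int fps) \<Rightarrow> nat \<Rightarrow> nat \<Rightarrow> int" where
  "reduce F n i = fps_nth (F i) n mod int m ^ i"

lemma slice_nth [simp]: "fps_nth (slice i p) n = p n i"
  by (simp add: slice_def)

lemma slice_reduce: "fcong (int m ^ i) (slice i (reduce F)) (F i)"
  by (simp add: fcong_mod reduce_def)

lemma reduce_eqI: "(\<And>i. fcong (int m ^ i) (F i) (G i)) \<Longrightarrow> reduce F = reduce G"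
  by (auto simp: fcong_mod reduce_def fun_eq_iff)

lemma reduce_in_carrier:
  assumes "\<And>i. fcong (int m ^ i) (F (Suc i)) (F i)"
  shows "reduce F \<in> carrier R"
  using assms m_ge_2
  by (auto simp: in_madic_fps_iff in_madic_ring_iff reduce_def fcong_mod mod_mod_cancel le_imp_power_dvd)

lemma slice_coherent:
  assumes "p \<in> carrier R" "i \<le> k"
  shows "fcong (int m ^ i) (slice k p) (slice i p)"
  using assms madic_coherent[OF _ assms(2)] madic_coherent[OF _ order_refl, of _ i]
  by (simp add: fcong_mod in_madic_fps_iff)

lemma reduce_slice: "p \<in> carrier R \<Longrightarrow> reduce (\<lambda>i. slice i p) = p"
  using madic_coherent[OF _ order_refl] by (simp add: fun_eq_iff reduce_def in_madic_fps_iff)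

lemma madic_fps_eqI:
  assumes "p \<in> carrier R" "p' \<in> carrier R" "\<And>i. fcong (int m ^ i) (slice i p) (slice i p')"
  shows "p = p'"
  using reduce_eqI[of "\<lambda>i. slice i p" "\<lambda>i. slice i p'"] assms by (simp add: reduce_slice)

lemma zero_in_madic_ring: "\<zero>\<^bsub>Zm\<^esub> \<in> carrier Zm"
  using m_ge_2 by (simp add: in_madic_ring_iff) (simp add: madic_ring_def)

lemma coherent_residues_in_madic_ring:
  assumes "\<And>i. a (Suc i) mod int m ^ i = a i mod int m ^ i"
  shows "(\<lambda>i. a i mod int m ^ i) \<in> carrier Zm"
  using assms m_ge_2 by (simp add: in_madic_ring_iff mod_mod_cancel le_imp_power_dvd)

lemma madic_coherent_Suc: "f \<in> carrier Zm \<Longrightarrow> f (Suc i) mod int m ^ i = f i"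
  by (simp add: in_madic_ring_iff)

lemma madic_add_closed:
  assumes "f \<in> carrier Zm" "g \<in> carrier Zm"
  shows "f \<oplus>\<^bsub>Zm\<^esub> g \<in> carrier Zm"
proof -
  have "(f (Suc i) + g (Suc i)) mod int m ^ i = (f i + g i) mod int m ^ i" for i
    using mod_add_eq[of "f (Suc i)" "int m ^ i" "g (Suc i)"] assms by (simp add: madic_coherent_Suc)
  from coherent_residues_in_madic_ring[of "\<lambda>i. f i + g i", OF this]
  show ?thesis by (simp add: madic_ring_def)
qed

lemma madic_mult_closed:
  assumes "f \<in> carrier Zm" "g \<in> carrier Zm"
  shows "f \<otimes>\<^bsub>Zm\<^esub> g \<in> carrier Zm"
proof -
  have "(f (Suc i) * g (Suc i)) mod int m ^ i = (f i * g i) mod int m ^ i" for i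
    using mod_mult_eq[of "f (Suc i)" "int m ^ i" "g (Suc i)"] assms by (simp add: madic_coherent_Suc)
  from coherent_residues_in_madic_ring[of "\<lambda>i. f i * g i", OF this]
  show ?thesis by (simp add: madic_ring_def)
qed

lemma abelian_monoid_madic_ring: "abelian_monoid Zm"
proof (rule abelian_monoidI)
  fix f g h assume "f \<in> carrier Zm" "g \<in> carrier Zm" "h \<in> carrier Zm"
  then show "f \<oplus>\<^bsub>Zm\<^esub> g \<oplus>\<^bsub>Zm\<^esub> h = f \<oplus>\<^bsub>Zm\<^esub> (g \<oplus>\<^bsub>Zm\<^esub> h)"
    by (simp add: madic_ring_def fun_eq_iff mod_simps add.assoc)
next
  fix f assume "f \<in> carrier Zm"
  then show "\<zero>\<^bsub>Zm\<^esub> \<oplus>\<^bsub>Zm\<^esub> f = f"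
    using madic_coherent[OF _ order_refl, of f] by (simp add: fun_eq_iff) (simp add: madic_ring_def)
qed (use zero_in_madic_ring madic_add_closed in \<open>auto simp: madic_ring_def add.commute\<close>)

lemma madic_finsum:
  assumes "finite A" "f \<in> A \<rightarrow> carrier Zm"
  shows "finsum Zm f A = (\<lambda>i. (\<Sum>a\<in>A. f a i) mod int m ^ i)"
proof -
  interpret Z: abelian_monoid Zm by (rule abelian_monoid_madic_ring)
  show ?thesis
    using assms
  proof (induction A rule: finite_induct)
    case empty
    have "finsum Zm f {} = \<zero>\<^bsub>Zm\<^esub>" by simp
    then show ?case by (simp add: madic_ring_def)
  next
    case (insert a A)
    then have "finsum Zm f (insert a A) = f a \<oplus>\<^bsub>Zm\<^esub> finsum Zm f A" by (simp add: Pi_iff)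
    also have "\<dots> = (\<lambda>i. (\<Sum>a\<in>insert a A. f a i) mod int m ^ i)"
      using insert by (simp add: Pi_iff) (simp add: madic_ring_def mod_simps)
    finally show ?case .
  qed
qed

lemma fps_add_reduce: "p \<oplus>\<^bsub>R\<^esub> p' = reduce (\<lambda>i. slice i p + slice i p')"
  by (simp add: fps_ring_def madic_ring_def reduce_def fun_eq_iff)

lemma fps_zero_reduce: "\<zero>\<^bsub>R\<^esub> = reduce (\<lambda>i. 0)"
  by (simp add: fps_ring_def madic_ring_def reduce_def fun_eq_iff)

lemma fps_one_reduce: "\<one>\<^bsub>R\<^esub> = reduce (\<lambda>i. 1)"
  by (simp add: fps_ring_def madic_ring_def reduce_def fun_eq_iff)

lemma fps_var_reduce: "fps_var Zm = reduce (\<lambda>i. fps_X)"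
  by (simp add: fps_var_def madic_ring_def reduce_def fun_eq_iff)

lemma fps_mult_reduce:
  assumes "p \<in> carrier R" "p' \<in> carrier R"
  shows "p \<otimes>\<^bsub>R\<^esub> p' = reduce (\<lambda>i. slice i p * slice i p')"
proof (intro ext)
  fix n i
  have "(p \<otimes>\<^bsub>R\<^esub> p') n = (\<lambda>i. (\<Sum>k\<le>n. (p k \<otimes>\<^bsub>Zm\<^esub> p' (n - k)) i) mod int m ^ i)"
    using assms madic_mult_closed by (simp add: fps_ring_def Pi_iff madic_finsum)
  then show "(p \<otimes>\<^bsub>R\<^esub> p') n i = reduce (\<lambda>i. slice i p * slice i p') n i"
    by (simp add: reduce_def fps_mult_nth atLeast0AtMost) (simp add: madic_ring_def mod_sum_eq)
qed

lemma fps_add_closed: "p \<in> carrier R \<Longrightarrow> p' \<in> carrier R \<Longrightarrow> p \<oplus>\<^bsub>R\<^esub> p' \<in> carrier R"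
  unfolding fps_add_reduce by (intro reduce_in_carrier fcong_add slice_coherent) auto

lemma fps_mult_closed: "p \<in> carrier R \<Longrightarrow> p' \<in> carrier R \<Longrightarrow> p \<otimes>\<^bsub>R\<^esub> p' \<in> carrier R"
  unfolding fps_mult_reduce by (intro reduce_in_carrier fcong_mult slice_coherent) auto

lemma fps_constants_closed: "\<zero>\<^bsub>R\<^esub> \<in> carrier R" "\<one>\<^bsub>R\<^esub> \<in> carrier R" "fps_var Zm \<in> carrier R"
  unfolding fps_zero_reduce fps_one_reduce fps_var_reduce by (auto intro: reduce_in_carrier)

lemma slice_add: "fcong (int m ^ i) (slice i (p \<oplus>\<^bsub>R\<^esub> p')) (slice i p + slice i p')"
  unfolding fps_add_reduce by (rule slice_reduce)

lemma slice_mult: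
  "p \<in> carrier R \<Longrightarrow> p' \<in> carrier R \<Longrightarrow>
    fcong (int m ^ i) (slice i (p \<otimes>\<^bsub>R\<^esub> p')) (slice i p * slice i p')"
  unfolding fps_mult_reduce by (rule slice_reduce)

lemma slice_constants:
  "fcong (int m ^ i) (slice i \<zero>\<^bsub>R\<^esub>) 0" "fcong (int m ^ i) (slice i \<one>\<^bsub>R\<^esub>) 1"
  "fcong (int m ^ i) (slice i (fps_var Zm)) fps_X"
  unfolding fps_zero_reduce fps_one_reduce fps_var_reduce by (rule slice_reduce)+

lemma slice_mult3:
  assumes "p \<in> carrier R" "p' \<in> carrier R" "p'' \<in> carrier R"
  shows "fcong (int m ^ i) (slice i (p \<otimes>\<^bsub>R\<^esub> p' \<otimes>\<^bsub>R\<^esub> p'')) (slice i p * slice i p' * slice i p'')"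
    and "fcong (int m ^ i) (slice i ((p \<oplus>\<^bsub>R\<^esub> p') \<otimes>\<^bsub>R\<^esub> p'')) ((slice i p + slice i p') * slice i p'')"
  using assms
  by (auto intro!: fcong_trans[OF slice_mult fcong_mult[OF slice_mult fcong_refl]]
      fcong_trans[OF slice_mult fcong_mult[OF slice_add fcong_refl]] fps_add_closed fps_mult_closed)

lemma fps_mult_commute:
  "p \<in> carrier R \<Longrightarrow> p' \<in> carrier R \<Longrightarrow> p \<otimes>\<^bsub>R\<^esub> p' = p' \<otimes>\<^bsub>R\<^esub> p"
  by (simp add: fps_mult_reduce mult.commute)

text \<open>
  Each axiom is the corresponding identity of integer power series, read modulo every \<open>m\<^sup>i\<close>.
\<close>

lemma cring_madic_fps: "cring R"
proof (rule cringI)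
  show "abelian_group R"
  proof (rule abelian_groupI)
    fix p p' p'' assume p: "p \<in> carrier R" "p' \<in> carrier R" "p'' \<in> carrier R"
    show "p \<oplus>\<^bsub>R\<^esub> p' \<in> carrier R" using p by (intro fps_add_closed)
    show "p \<oplus>\<^bsub>R\<^esub> p' = p' \<oplus>\<^bsub>R\<^esub> p" by (simp add: fps_add_reduce add.commute)
    show "p \<oplus>\<^bsub>R\<^esub> p' \<oplus>\<^bsub>R\<^esub> p'' = p \<oplus>\<^bsub>R\<^esub> (p' \<oplus>\<^bsub>R\<^esub> p'')"
    proof (rule madic_fps_eqI)
      fix i
      have "fcong (int m ^ i) (slice i (p \<oplus>\<^bsub>R\<^esub> p' \<oplus>\<^bsub>R\<^esub> p'')) (slice i p + slice i p' + slice i p'')"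
        by (rule fcong_trans[OF slice_add fcong_add[OF slice_add fcong_refl]])
      also have "slice i p + slice i p' + slice i p'' = slice i p + (slice i p' + slice i p'')"
        by (rule add.assoc)
      also have "fcong (int m ^ i) \<dots> (slice i (p \<oplus>\<^bsub>R\<^esub> (p' \<oplus>\<^bsub>R\<^esub> p'')))"
        by (rule fcong_sym[OF fcong_trans[OF slice_add fcong_add[OF fcong_refl slice_add]]])
      finally show "fcong (int m ^ i) (slice i (p \<oplus>\<^bsub>R\<^esub> p' \<oplus>\<^bsub>R\<^esub> p'')) (slice i (p \<oplus>\<^bsub>R\<^esub> (p' \<oplus>\<^bsub>R\<^esub> p'')))" .
    qed (use p in \<open>auto intro: fps_add_closed\<close>)
    show "\<zero>\<^bsub>R\<^esub> \<oplus>\<^bsub>R\<^esub> p = p"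
    proof (rule madic_fps_eqI)
      show "fcong (int m ^ i) (slice i (\<zero>\<^bsub>R\<^esub> \<oplus>\<^bsub>R\<^esub> p)) (slice i p)" for i
        using fcong_trans[OF slice_add fcong_add[OF slice_constants(1) fcong_refl]] by simp
    qed (use p fps_constants_closed in \<open>auto intro: fps_add_closed\<close>)
    \<comment> \<open>Negating the residues gives the additive inverse.\<close>
    let ?n = "reduce (\<lambda>i. - slice i p)"
    have n: "?n \<in> carrier R" using p by (intro reduce_in_carrier fcong_uminus slice_coherent) auto
    have "?n \<oplus>\<^bsub>R\<^esub> p = \<zero>\<^bsub>R\<^esub>"
      unfolding fps_add_reduce fps_zero_reduce
    proof (rule reduce_eqI)
      show "fcong (int m ^ i) (slice i ?n + slice i p) 0" for i
        using fcong_add[OF slice_reduce fcong_refl, of i "\<lambda>i. - slice i p" "slice i p"] by simp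
    qed
    with n show "\<exists>p'\<in>carrier R. p' \<oplus>\<^bsub>R\<^esub> p = \<zero>\<^bsub>R\<^esub>" by blast
  qed (rule fps_constants_closed)
  show "Group.comm_monoid R"
  proof (rule comm_monoidI)
    fix p p' p'' assume p: "p \<in> carrier R" "p' \<in> carrier R" "p'' \<in> carrier R"
    show "p \<otimes>\<^bsub>R\<^esub> p' \<in> carrier R" using p by (intro fps_mult_closed)
    show "p \<otimes>\<^bsub>R\<^esub> p' = p' \<otimes>\<^bsub>R\<^esub> p" using p by (intro fps_mult_commute)
    show "p \<otimes>\<^bsub>R\<^esub> p' \<otimes>\<^bsub>R\<^esub> p'' = p \<otimes>\<^bsub>R\<^esub> (p' \<otimes>\<^bsub>R\<^esub> p'')"
    proof (rule madic_fps_eqI)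
      fix i
      have "fcong (int m ^ i) (slice i (p \<otimes>\<^bsub>R\<^esub> p' \<otimes>\<^bsub>R\<^esub> p'')) (slice i p * slice i p' * slice i p'')"
        by (rule slice_mult3[OF p])
      also have "slice i p * slice i p' * slice i p'' = slice i p * (slice i p' * slice i p'')"
        by (rule mult.assoc)
      also have "fcong (int m ^ i) \<dots> (slice i (p \<otimes>\<^bsub>R\<^esub> (p' \<otimes>\<^bsub>R\<^esub> p'')))"
        using p by (intro fcong_sym[OF fcong_trans[OF slice_mult fcong_mult[OF fcong_refl slice_mult]]]
            fps_mult_closed)
      finally show "fcong (int m ^ i) (slice i (p \<otimes>\<^bsub>R\<^esub> p' \<otimes>\<^bsub>R\<^esub> p'')) (slice i (p \<otimes>\<^bsub>R\<^esub> (p' \<otimes>\<^bsub>R\<^esub> p'')))" .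
    qed (use p in \<open>auto intro: fps_mult_closed\<close>)
    show "\<one>\<^bsub>R\<^esub> \<otimes>\<^bsub>R\<^esub> p = p"
    proof (rule madic_fps_eqI)
      show "fcong (int m ^ i) (slice i (\<one>\<^bsub>R\<^esub> \<otimes>\<^bsub>R\<^esub> p)) (slice i p)" for i
        using fcong_trans[OF slice_mult[OF fps_constants_closed(2) p(1)]
          fcong_mult[OF slice_constants(2) fcong_refl]] by simp
    qed (use p fps_constants_closed in \<open>auto intro: fps_mult_closed\<close>)
  qed (rule fps_constants_closed)
next
  fix p p' p'' assume p: "p \<in> carrier R" "p' \<in> carrier R" "p'' \<in> carrier R"
  show "(p \<oplus>\<^bsub>R\<^esub> p') \<otimes>\<^bsub>R\<^esub> p'' = p \<otimes>\<^bsub>R\<^esub> p'' \<oplus>\<^bsub>R\<^esub> p' \<otimes>\<^bsub>R\<^esub> p''"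
  proof (rule madic_fps_eqI)
    fix i
    have "fcong (int m ^ i) (slice i ((p \<oplus>\<^bsub>R\<^esub> p') \<otimes>\<^bsub>R\<^esub> p'')) ((slice i p + slice i p') * slice i p'')"
      by (rule slice_mult3[OF p])
    also have "(slice i p + slice i p') * slice i p'' = slice i p * slice i p'' + slice i p' * slice i p''"
      by (rule distrib_right)
    also have "fcong (int m ^ i) \<dots> (slice i (p \<otimes>\<^bsub>R\<^esub> p'' \<oplus>\<^bsub>R\<^esub> p' \<otimes>\<^bsub>R\<^esub> p''))"
      using p by (intro fcong_sym[OF fcong_trans[OF slice_add fcong_add[OF slice_mult slice_mult]]])
    finally show "fcong (int m ^ i) (slice i ((p \<oplus>\<^bsub>R\<^esub> p') \<otimes>\<^bsub>R\<^esub> p''))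
        (slice i (p \<otimes>\<^bsub>R\<^esub> p'' \<oplus>\<^bsub>R\<^esub> p' \<otimes>\<^bsub>R\<^esub> p''))" .
  qed (use p in \<open>auto intro: fps_add_closed fps_mult_closed\<close>)
qed

sublocale R: cring "madic_fps m"
  by (rule cring_madic_fps)

lemma slice_minus:
  assumes "p \<in> carrier R"
  shows "fcong (int m ^ i) (slice i (\<ominus>\<^bsub>R\<^esub> p)) (- slice i p)"
proof -
  have "fcong (int m ^ i) (slice i (\<ominus>\<^bsub>R\<^esub> p) + slice i p) (slice i (\<ominus>\<^bsub>R\<^esub> p \<oplus>\<^bsub>R\<^esub> p))"
    by (rule fcong_sym[OF slice_add])
  also have "\<ominus>\<^bsub>R\<^esub> p \<oplus>\<^bsub>R\<^esub> p = \<zero>\<^bsub>R\<^esub>" using assms by (rule R.l_neg)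
  also have "fcong (int m ^ i) (slice i \<zero>\<^bsub>R\<^esub>) 0" by (rule slice_constants)
  finally have "fcong (int m ^ i) (slice i (\<ominus>\<^bsub>R\<^esub> p) + slice i p) 0" .
  from fcong_diff[OF this fcong_refl, of "slice i p"] show ?thesis by simp
qed

lemma slice_diff:
  assumes "p \<in> carrier R" "p' \<in> carrier R"
  shows "fcong (int m ^ i) (slice i (p \<ominus>\<^bsub>R\<^esub> p')) (slice i p - slice i p')"
  using fcong_trans[OF slice_add fcong_add[OF fcong_refl slice_minus[OF assms(2)]]]
  by (simp add: a_minus_def)

lemma slice_of_nat: "fcong (int m ^ i) (slice i ([n] \<cdot>\<^bsub>R\<^esub> \<one>\<^bsub>R\<^esub>)) (of_nat n)"
proof (induction n)
  case 0
  then show ?case using slice_constants(1) by simp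
next
  case (Suc n)
  then show ?case
    using fcong_trans[OF slice_add fcong_add[OF Suc slice_constants(2)]] by (simp add: add.commute)
qed

lemma slice_finsum:
  assumes "finite A" "f \<in> A \<rightarrow> carrier R"
  shows "fcong (int m ^ i) (slice i (finsum R f A)) (\<Sum>a\<in>A. slice i (f a))"
  using assms
proof (induction A rule: finite_induct)
  case empty
  then show ?case using slice_constants(1) by simp
next
  case (insert a A)
  then have "fcong (int m ^ i) (slice i (f a \<oplus>\<^bsub>R\<^esub> finsum R f A)) (slice i (f a) + (\<Sum>a\<in>A. slice i (f a)))"
    by (intro fcong_trans[OF slice_add fcong_add[OF fcong_refl]]) auto
  with insert show ?case by (simp add: Pi_iff)
qed

end

section \<open>An action of integer power series on words\<close>

lemma fps_shift_1_X_mult: "fps_shift 1 (fps_X * a) = (a :: 'a :: comm_ring_1 fps)"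
  by (rule fps_ext) simp

lemma fps_shift_add_distrib: "fps_shift k (a + b) = fps_shift k a + fps_shift k (b :: 'a :: comm_ring_1 fps)"
  by (rule fps_ext) simp

lemma fps_head_tail: "a = fps_const (fps_nth a 0) + fps_X * fps_shift 1 (a :: 'a :: comm_ring_1 fps)"
proof (rule fps_ext)
  fix n show "fps_nth a n = fps_nth (fps_const (fps_nth a 0) + fps_X * fps_shift 1 a) n"
    by (cases n) simp_all
qed

context m_ary_tree
begin

text \<open>
  The power \<open>(1, 2, \<dots>, m)\<^sup>n\<close> of the cycle.  The letters are numbered from 1 and the residues from 0,
  whence the shifts by one.
\<close>

definition rotate_letter :: "int \<Rightarrow> nat \<Rightarrow> nat" where
  "rotate_letter n y = nat ((int y - 1 + n) mod int m) + 1"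

definition total :: "(nat \<Rightarrow> int fps) \<Rightarrow> int fps" where
  "total Q = (\<Sum>j<m. Q (Suc j))"

text \<open>
  \<open>cumul Q t\<close> is the sum \<open>Q 1 + \<dots> + Q t\<close> of the first \<open>t\<close> terms of \<open>Q\<close>, continued m-periodically, and
  extended to negative \<open>t\<close> so that adding \<open>m\<close> to \<open>t\<close> always adds the total \<open>Q 1 + \<dots> + Q m\<close>.
\<close>

definition cumul :: "(nat \<Rightarrow> int fps) \<Rightarrow> int \<Rightarrow> int fps" where
  "cumul Q t = (\<Sum>j<nat (t mod int m). Q (Suc j)) + of_int (t div int m) * total Q"

text \<open>
  For a natural number \<open>n\<close> the state of \<open>\<alpha>\<^sup>n\<close> at \<open>y\<close> is \<open>\<alpha>\<close> to the power
  \<open>Q y + Q (y + 1) + \<dots>\<close> (\<open>n\<close> terms, indices modulo \<open>m\<close>), a difference of two values of \<open>cumul\<close>.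
  The factor \<open>\<alpha>\<^sup>x\<^sup>P\<^sup>'\<close> of \<open>\<alpha>\<^sup>P\<close> is diagonal and contributes \<open>P'\<close> to every state.
\<close>

definition fps_state :: "(nat \<Rightarrow> int fps) \<Rightarrow> nat \<Rightarrow> int fps \<Rightarrow> int fps" where
  "fps_state Q y P = cumul Q (int y - 1 + fps_nth P 0) - cumul Q (int y - 1) + fps_shift 1 P"

text \<open>
  The intended action of \<open>\<alpha>\<^sup>P\<close> on words, for integer power series \<open>P\<close> and \<open>Q 1, \<dots>, Q m\<close>.
\<close>

primrec act :: "(nat \<Rightarrow> int fps) \<Rightarrow> nat list \<Rightarrow> int fps \<Rightarrow> nat list" where
  "act Q [] P = []"
| "act Q (y # u) P = rotate_letter (fps_nth P 0) y # act Q u (fps_state Q y P)"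

lemma m_pos: "0 < int m"
  using m_ge_2 by simp

lemma rotate_letter_in: "rotate_letter n y \<in> Y"
proof -
  have "0 \<le> (int y - 1 + n) mod int m" "(int y - 1 + n) mod int m < int m"
    using m_pos by simp_all
  then show ?thesis by (simp add: rotate_letter_def)
qed

lemma rotate_letter_int: "int (rotate_letter n y) - 1 = (int y - 1 + n) mod int m"
  using m_pos by (simp add: rotate_letter_def)

lemma rotate_letter_add: "rotate_letter (n + k) y = rotate_letter k (rotate_letter n y)"
proof -
  have "(int (rotate_letter n y) - 1 + k) mod int m = (int y - 1 + (n + k)) mod int m"
    unfolding rotate_letter_int by (simp add: mod_add_left_eq add.assoc)
  then show ?thesis by (simp add: rotate_letter_def[of _ "rotate_letter n y"]) (simp add: rotate_letter_def)
qed

lemma rotate_letter_multiple: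
  assumes "y \<in> Y" "int m dvd n"
  shows "rotate_letter n y = y"
proof -
  have "(int y - 1 + n) mod int m = int y - 1"
    using assms by (auto simp: mod_add_right_eq[symmetric] simp del: mod_add_right_eq)
  then show ?thesis using assms by (simp add: rotate_letter_def Suc_nat_eq_nat_zadd1)
qed

lemma rotate_letter_cong: "n mod int m = k mod int m \<Longrightarrow> rotate_letter n y = rotate_letter k y"
  unfolding rotate_letter_def by (metis mod_add_right_eq)

lemma cumul_add_multiple: "cumul Q (t + int m * k) = cumul Q t + of_int k * total Q"
  using m_pos by (simp add: cumul_def algebra_simps)

lemma cumul_step:
  assumes "y \<in> Y"
  shows "cumul Q (int y) - cumul Q (int y - 1) = Q y"
proof -
  have pred: "(int y - 1) mod int m = int y - 1" "(int y - 1) div int m = 0"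
    using assms by (auto intro: div_pos_pos_trivial)
  have before: "cumul Q (int y - 1) = (\<Sum>j<y - 1. Q (Suc j))"
    unfolding cumul_def pred using assms by (simp add: nat_diff_distrib)
  have split_last: "(\<Sum>j<y. Q (Suc j)) = (\<Sum>j<y - 1. Q (Suc j)) + Q y"
    using assms by (cases y) auto
  have after: "cumul Q (int y) = (\<Sum>j<y. Q (Suc j))"
  proof (cases "y = m")
    case True
    then show ?thesis using m_pos by (simp add: cumul_def total_def)
  next
    case False
    with assms have "int y mod int m = int y" "int y div int m = 0"
      by (auto intro: div_pos_pos_trivial)
    then show ?thesis by (simp add: cumul_def)
  qed
  show ?thesis by (simp add: before after split_last)
qed

text \<open>
  The cocycle identity.  The differences of \<open>cumul\<close> telescope along \<open>y\<close>, its image under the first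
  factor, and the image of that under the second; reducing the intermediate letter modulo \<open>m\<close>
  shifts both ends of the second difference by the same multiple of the total.
\<close>

lemma fps_state_add:
  "fps_state Q y (P + P') = fps_state Q y P + fps_state Q (rotate_letter (fps_nth P 0) y) P'"
proof -
  let ?t = "int y - 1 + fps_nth P 0"
  \<comment> \<open>The multiple of \<open>m\<close> by which reducing modulo \<open>m\<close> moves the intermediate letter.\<close>
  define k where "k = - (?t div int m)"
  have z: "int (rotate_letter (fps_nth P 0) y) - 1 = ?t + int m * k"
    unfolding rotate_letter_int k_def by (simp add: minus_div_mult_eq_mod[symmetric] algebra_simps)
  have "cumul Q (?t + int m * k + fps_nth P' 0) = cumul Q (?t + fps_nth P' 0) + of_int k * total Q"
    using cumul_add_multiple[of Q "?t + fps_nth P' 0" k] by (simp add: algebra_simps)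
  then show ?thesis
    unfolding fps_state_def z cumul_add_multiple fps_shift_add_distrib by (simp add: algebra_simps)
qed

lemma act_length [simp]: "length (act Q u P) = length u"
  by (induction u arbitrary: P) simp_all

lemma act_in_words: "act Q u P \<in> W"
  by (induction u arbitrary: P) (simp_all add: rotate_letter_in del: atLeastAtMost_iff One_nat_def)

lemma act_add: "act Q u (P + P') = act Q (act Q u P) P'"
  by (induction u arbitrary: P P') (simp_all add: rotate_letter_add fps_state_add)

lemma act_zero: "u \<in> W \<Longrightarrow> act Q u 0 = u"
  by (induction u) (simp_all add: rotate_letter_multiple fps_state_def)

lemma act_shift: "y \<in> Y \<Longrightarrow> act Q (y # u) (fps_X * P) = y # act Q u P"
  by (simp add: rotate_letter_multiple fps_state_def fps_shift_1_X_mult del: One_nat_def)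

lemma act_one: "y \<in> Y \<Longrightarrow> act Q (y # u) 1 = rotate_letter 1 y # act Q u (Q y)"
  using cumul_step[of y Q] by (simp add: fps_state_def fps_shift_one del: One_nat_def)

lemma act_extends: "\<exists>z\<in>Y. act Q (u @ [y]) P = act Q u P @ [z]"
  by (induction u arbitrary: P) (simp_all add: rotate_letter_in del: atLeastAtMost_iff One_nat_def)

lemma cumul_cong:
  assumes "\<And>y. y \<in> Y \<Longrightarrow> fcong (int m ^ l) (Q y) (Q' y)" "t mod int m ^ Suc l = t' mod int m ^ Suc l"
  shows "fcong (int m ^ l) (cumul Q t) (cumul Q' t')"
proof -
  have mod: "t mod int m = t' mod int m"
    using arg_cong[OF assms(2), of "\<lambda>x. x mod int m"] by (simp add: mod_mod_cancel)
  have "int m ^ Suc l dvd t - t'" using assms(2) by (simp add: mod_eq_dvd_iff)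
  then obtain s where "t - t' = int m ^ Suc l * s" by (rule dvdE)
  then have "t = t' + int m * (int m ^ l * s)" by (simp add: algebra_simps)
  then have "t div int m = t' div int m + int m ^ l * s" using m_pos by simp
  then have div: "fcong (int m ^ l) (of_int (t div int m)) (of_int (t' div int m))"
    by (simp add: fcong_def flip: fps_of_int)
  have "nat (t' mod int m) \<le> m" using m_pos by (simp add: nat_le_iff less_imp_le)
  then show ?thesis
    unfolding cumul_def total_def mod
    by (intro fcong_add fcong_sum fcong_mult div assms(1)) auto
qed

lemma fps_state_cong:
  assumes "fcong (int m ^ Suc l) P P'" "\<And>y. y \<in> Y \<Longrightarrow> fcong (int m ^ l) (Q y) (Q' y)"
  shows "fcong (int m ^ l) (fps_state Q y P) (fps_state Q' y P')"
proof -
  have "(int y - 1 + fps_nth P 0) mod int m ^ Suc l = (int y - 1 + fps_nth P' 0) mod int m ^ Suc l"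
    using assms(1) unfolding fcong_mod by (metis mod_add_right_eq)
  moreover have "fcong (int m ^ l) P P'" using assms(1) by (rule fcong_dvd) simp
  ultimately show ?thesis
    unfolding fps_state_def by (intro fcong_add fcong_diff cumul_cong fcong_shift assms(2)) auto
qed

text \<open>
  On words of length at most \<open>l\<close> only the residues modulo \<open>m\<^sup>l\<close> matter: passing to a state divides the
  constant coefficient by \<open>m\<close> and so costs one power of \<open>m\<close>, but also one letter of the word.
\<close>

lemma act_cong:
  assumes "fcong (int m ^ l) P P'" "\<And>y. y \<in> Y \<Longrightarrow> fcong (int m ^ l) (Q y) (Q' y)" "length u \<le> l"
  shows "act Q u P = act Q' u P'"
  using assms
proof (induction u arbitrary: l P P')
  case (Cons y u)
  then obtain k where l: "l = Suc k" "length u \<le> k" by (cases l) auto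
  have "fps_nth P 0 mod int m = fps_nth P' 0 mod int m"
    using Cons.prems(1) fcong_dvd[of "int m ^ l" P P' "int m"] l(1) by (simp add: fcong_mod)
  then have "rotate_letter (fps_nth P 0) y = rotate_letter (fps_nth P' 0) y"
    by (rule rotate_letter_cong)
  moreover have Q: "fcong (int m ^ k) (Q y) (Q' y)" if "y \<in> Y" for y
    using Cons.prems(2)[OF that] by (rule fcong_dvd) (simp add: l)
  have "act Q u (fps_state Q y P) = act Q' u (fps_state Q' y P')"
    using Cons.prems(1) l Q by (intro Cons.IH[of k] fps_state_cong) auto
  ultimately show ?case by simp
qed simp

text \<open>
  Multiples of \<open>m - x q\<close> act trivially: rotating \<open>m\<close> times fixes the letter and adds the total \<open>q\<close> to
  the state, which the term \<open>-x q\<close> cancels.  The state is a multiple of \<open>m - x q\<close> again.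
\<close>

lemma act_relation:
  assumes "u \<in> W"
  shows "act Q u (S * (of_nat m - fps_X * total Q)) = u"
  using assms
proof (induction u arbitrary: S)
  case (Cons y u)
  let ?r = "of_nat m - fps_X * total Q"
  define s where "s = fps_nth S 0"
  define S' where "S' = fps_shift 1 S"
  have S: "S = fps_const s + fps_X * S'"
    unfolding s_def S'_def by (rule fps_head_tail)
  have y: "y \<in> Y" using Cons.prems by simp
  have head: "fps_nth (S * ?r) 0 = int m * s"
    by (simp add: s_def)
  have "S * ?r = fps_const (int m * s) + fps_X * (S' * ?r - fps_const s * total Q)"
    unfolding S by (simp add: algebra_simps fps_of_nat flip: fps_const_mult)
  then have "fps_shift 1 (S * ?r) = S' * ?r - fps_const s * total Q"
    by (simp add: fps_shift_add_distrib fps_shift_1_X_mult fps_shift_fps_const del: One_nat_def)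
  moreover have "cumul Q (int y - 1 + int m * s) = cumul Q (int y - 1) + fps_const s * total Q"
    unfolding cumul_add_multiple using fps_of_int[of s, where ?'a = int] by simp
  ultimately have "fps_state Q y (S * ?r) = S' * ?r"
    unfolding fps_state_def head by simp
  then show ?case using Cons y head by (simp add: rotate_letter_multiple)
qed simp

end

section \<open>The solution of the recursion\<close>

locale tree_recursion = m_ary_tree +
  fixes q :: "nat \<Rightarrow> nat \<Rightarrow> nat \<Rightarrow> int"
  assumes q: "q \<in> {1..m} \<rightarrow> carrier (madic_fps m)"
begin

abbreviation "q_slice l y \<equiv> slice l (q y)"

text \<open>
  By \<open>act_cong\<close> the residues modulo \<open>m\<^sup>l\<close> suffice on level \<open>l\<close>, so the action of integer series extends
  to series over the m-adic integers.
\<close>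

definition adic_act :: "(nat \<Rightarrow> nat \<Rightarrow> int) \<Rightarrow> nat list \<Rightarrow> nat list" where
  "adic_act p u = (if u \<in> W then act (q_slice (length u)) u (slice (length u) p) else u)"

text \<open>
  A series \<open>p\<close> is meant to act as \<open>\<alpha>\<^sup>p\<close>, so the solution \<open>\<alpha>\<close> of the recursion has to be the action of
  the series 1.
\<close>

abbreviation "root_gen \<equiv> adic_act \<one>\<^bsub>R\<^esub>"

lemma q_slice_coherent: "y \<in> Y \<Longrightarrow> i \<le> k \<Longrightarrow> fcong (int m ^ i) (q_slice k y) (q_slice i y)"
  using q by (intro slice_coherent) auto

lemma adic_act_cong:
  assumes "u \<in> W" "length u \<le> l" "p \<in> carrier R" "fcong (int m ^ l) (slice l p) P"
  shows "adic_act p u = act (q_slice l) u P"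
proof -
  have "adic_act p u = act (q_slice (length u)) u (slice (length u) p)"
    using assms(1) by (simp add: adic_act_def)
  also have "\<dots> = act (q_slice l) u (slice l p)"
    using assms by (intro act_cong[of "length u"] fcong_sym[OF slice_coherent] fcong_sym[OF q_slice_coherent]) auto
  also have "\<dots> = act (q_slice l) u P"
    using assms by (intro act_cong) auto
  finally show ?thesis .
qed

lemmas adic_act_level = adic_act_cong[OF _ _ _ fcong_refl]

lemma adic_act_outside: "u \<notin> W \<Longrightarrow> adic_act p u = u"
  by (simp add: adic_act_def)

lemma adic_act_add:
  assumes "p \<in> carrier R" "p' \<in> carrier R"
  shows "adic_act (p \<oplus>\<^bsub>R\<^esub> p') = adic_act p' \<circ> adic_act p"
proof
  fix u show "adic_act (p \<oplus>\<^bsub>R\<^esub> p') u = (adic_act p' \<circ> adic_act p) u"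
  proof (cases "u \<in> W")
    case True
    let ?l = "length u"
    have "adic_act (p \<oplus>\<^bsub>R\<^esub> p') u = act (q_slice ?l) u (slice ?l p + slice ?l p')"
      using assms True by (intro adic_act_cong slice_add) auto
    also have "\<dots> = adic_act p' (adic_act p u)"
      unfolding act_add using True assms
      by (simp add: adic_act_def[of p u] adic_act_def[of p'] act_in_words)
    finally show ?thesis by simp
  qed (simp add: adic_act_outside)
qed

lemma adic_act_zero: "adic_act \<zero>\<^bsub>R\<^esub> = id"
proof
  fix u show "adic_act \<zero>\<^bsub>R\<^esub> u = id u"
    using adic_act_cong[OF _ order_refl R.zero_closed slice_constants(1), of u]
    by (cases "u \<in> W") (simp_all add: adic_act_outside act_zero)
qed

lemma extends_words_adic_act:
  assumes "p \<in> carrier R"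
  shows "extends_words (adic_act p)"
  unfolding extends_words_def
proof (intro conjI ballI)
  fix u y assume uy: "u \<in> W" "y \<in> Y"
  let ?l = "length (u @ [y])"
  have "adic_act p u = act (q_slice ?l) u (slice ?l p)"
    "adic_act p (u @ [y]) = act (q_slice ?l) (u @ [y]) (slice ?l p)"
    using assms uy by (auto intro!: adic_act_level)
  then show "\<exists>z\<in>Y. adic_act p (u @ [y]) = adic_act p u @ [z]"
    using act_extends by (simp del: atLeastAtMost_iff)
qed (simp add: adic_act_def)

text \<open>
  Additivity provides the inverse: the action of the negative.
\<close>

lemma adic_act_closed:
  assumes "p \<in> carrier R"
  shows "adic_act p \<in> carrier \<A>"
proof (rule tree_autI)
  have n: "\<ominus>\<^bsub>R\<^esub> p \<in> carrier R" using assms by simp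
  show "extends_words (adic_act p)" "extends_words (adic_act (\<ominus>\<^bsub>R\<^esub> p))"
    using assms n by (auto intro: extends_words_adic_act)
  show "adic_act (\<ominus>\<^bsub>R\<^esub> p) (adic_act p u) = u" for u
    using adic_act_add[OF assms n] assms adic_act_zero by (simp add: R.r_neg) (metis comp_apply id_apply)
  show "adic_act p (adic_act (\<ominus>\<^bsub>R\<^esub> p) u) = u" for u
    using adic_act_add[OF n assms] assms adic_act_zero by (simp add: R.l_neg) (metis comp_apply id_apply)
qed (rule adic_act_outside)

lemma adic_act_var:
  assumes "p \<in> carrier R"
  shows "adic_act (fps_var Zm \<otimes>\<^bsub>R\<^esub> p) = diag (adic_act p)"
proof
  fix u
  have X: "fps_var Zm \<in> carrier R" by (rule fps_constants_closed)
  show "adic_act (fps_var Zm \<otimes>\<^bsub>R\<^esub> p) u = diag (adic_act p) u"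
  proof (cases "u \<in> W")
    case True
    show ?thesis
    proof (cases u)
      case Nil
      then show ?thesis by (simp add: adic_act_def)
    next
      case (Cons y v)
      let ?l = "length u"
      have yv: "y \<in> Y" "v \<in> W" using True Cons by auto
      have "adic_act (fps_var Zm \<otimes>\<^bsub>R\<^esub> p) u = act (q_slice ?l) u (fps_X * slice ?l p)"
        using assms X True
        by (intro adic_act_cong fcong_trans[OF slice_mult fcong_mult[OF slice_constants(3) fcong_refl]]) auto
      also have "\<dots> = y # act (q_slice ?l) v (slice ?l p)"
        unfolding Cons by (rule act_shift[OF yv(1)])
      also have "\<dots> = y # adic_act p v"
        using assms yv Cons by (subst adic_act_level[of v ?l]) auto
      finally show ?thesis using yv Cons by simp
    qed
  qed (simp add: adic_act_outside diag_outside)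
qed

lemma adic_act_Cons:
  assumes "p \<in> carrier R" "y \<in> Y" "u \<in> W" "l = length u"
  shows "adic_act p (y # u) = rotate_letter (p 0 1) y #
    act (q_slice (Suc l)) u (fps_state (q_slice (Suc l)) y (slice (Suc l) p))"
proof -
  have "p 0 (Suc l) mod int m ^ 1 = p 0 1"
    using assms(1) by (intro madic_coherent) (auto simp: in_madic_fps_iff)
  moreover have "p 0 1 mod int m ^ 1 = p 0 1"
    using assms(1) by (intro madic_coherent) (auto simp: in_madic_fps_iff)
  ultimately have "rotate_letter (p 0 (Suc l)) y = rotate_letter (p 0 1) y"
    by (intro rotate_letter_cong) simp
  then show ?thesis using assms by (simp add: adic_act_def)
qed

lemma root_perm_adic_act:
  assumes "p \<in> carrier R" "y \<in> Y"
  shows "rt (adic_act p) y = rotate_letter (p 0 1) y"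
  using adic_act_Cons[OF assms, of "[]"] assms by (simp add: root_perm_def)

text \<open>
  The series that describes the state at \<open>y\<close>.  Its residue modulo \<open>m\<^sup>i\<close> requires that of \<open>p\<close> modulo
  \<open>m\<^sup>i\<^sup>+\<^sup>1\<close>, since the constant coefficient gets divided by \<open>m\<close>.
\<close>

definition adic_state :: "nat \<Rightarrow> (nat \<Rightarrow> nat \<Rightarrow> int) \<Rightarrow> nat \<Rightarrow> nat \<Rightarrow> int" where
  "adic_state y p = reduce (\<lambda>i. fps_state (q_slice (Suc i)) y (slice (Suc i) p))"

lemma adic_state_closed:
  assumes "p \<in> carrier R"
  shows "adic_state y p \<in> carrier R"
  unfolding adic_state_def
  using assms by (intro reduce_in_carrier fps_state_cong slice_coherent
      fcong_trans[OF q_slice_coherent fcong_sym[OF q_slice_coherent]]) auto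

lemma tree_comp_adic_act:
  assumes "p \<in> carrier R" "y \<in> Y"
  shows "cmp (adic_act p) y = adic_act (adic_state y p)"
proof
  fix u show "cmp (adic_act p) y u = adic_act (adic_state y p) u"
  proof (cases "u \<in> W")
    case True
    let ?l = "length u"
    let ?P = "fps_state (q_slice (Suc ?l)) y (slice (Suc ?l) p)"
    have "adic_act (adic_state y p) u = act (q_slice ?l) u ?P"
      using assms True
      by (intro adic_act_cong adic_state_closed) (auto simp: adic_state_def intro: slice_reduce)
    also have "\<dots> = act (q_slice (Suc ?l)) u ?P"
      by (intro act_cong[of ?l] fcong_sym[OF q_slice_coherent]) auto
    finally show ?thesis
      using adic_act_Cons[OF assms True refl] True by (simp add: tree_comp_def)
  qed (simp add: tree_comp_def adic_act_outside)
qed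

lemma root_gen_closed: "root_gen \<in> carrier \<A>"
  by (intro adic_act_closed R.one_closed)

lemma root_gen_nat_pow:
  assumes "u \<in> W" "length u \<le> l"
  shows "(root_gen [^]\<^bsub>\<A>\<^esub> (n::nat)) u = act (q_slice l) u (of_nat n)"
proof (induction n)
  case 0
  then show ?case using assms by (simp add: act_zero)
next
  case (Suc n)
  let ?w = "act (q_slice l) u (of_nat n)"
  have "(root_gen [^]\<^bsub>\<A>\<^esub> Suc n) u = root_gen ((root_gen [^]\<^bsub>\<A>\<^esub> n) u)" by simp
  also have "\<dots> = root_gen ?w" by (simp only: Suc)
  also have "\<dots> = act (q_slice l) ?w 1"
    using assms by (intro adic_act_cong slice_constants R.one_closed act_in_words) auto
  also have "\<dots> = act (q_slice l) u (of_nat n + 1)" by (rule act_add[symmetric])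
  finally show ?case by (simp add: add.commute)
qed

lemma root_gen_int_pow:
  assumes "u \<in> W" "length u \<le> l"
  shows "(root_gen [^]\<^bsub>\<A>\<^esub> (n::int)) u = act (q_slice l) u (of_int n)"
proof (cases n)
  case (nonneg k)
  then show ?thesis using root_gen_nat_pow[OF assms] by (simp add: int_pow_int)
next
  case (neg k)
  let ?\<beta> = "root_gen [^]\<^bsub>\<A>\<^esub> Suc k"
  have \<beta>: "?\<beta> \<in> carrier \<A>" by (intro G.nat_pow_closed root_gen_closed)
  have inv: "root_gen [^]\<^bsub>\<A>\<^esub> n = inv\<^bsub>\<A>\<^esub> ?\<beta>"
    unfolding neg by (rule G.int_pow_neg_int[OF root_gen_closed])
  define w where "w = (inv\<^bsub>\<A>\<^esub> ?\<beta>) u"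
  have w: "w \<in> W" "length w \<le> l" using assms \<beta> by (simp_all add: w_def)
  have "u = ?\<beta> w" unfolding w_def by (rule inv_apply(1)[OF \<beta>, symmetric])
  also have "\<dots> = act (q_slice l) w (of_nat (Suc k))" by (rule root_gen_nat_pow[OF w])
  finally have "act (q_slice l) u (of_int n) = act (q_slice l) w (of_nat (Suc k) + of_int n)"
    by (simp only: act_add)
  also have "of_nat (Suc k) + of_int n = (0 :: int fps)" by (simp add: neg)
  also have "act (q_slice l) w 0 = w" using w by (intro act_zero)
  finally show ?thesis by (simp add: inv w_def)
qed

lemma root_perm_root_gen_pow:
  assumes "y \<in> Y"
  shows "rt (root_gen [^]\<^bsub>\<A>\<^esub> (n::int)) y = rotate_letter n y"
  using root_gen_int_pow[of "[y]" 1 n] assms by (simp add: root_perm_def flip: fps_of_int)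

definition const_series :: "(nat \<Rightarrow> int) \<Rightarrow> nat \<Rightarrow> nat \<Rightarrow> int" where
  "const_series \<xi> n = (if n = 0 then \<xi> else \<zero>\<^bsub>Zm\<^esub>)"

definition shift_series :: "(nat \<Rightarrow> nat \<Rightarrow> int) \<Rightarrow> nat \<Rightarrow> nat \<Rightarrow> int" where
  "shift_series p n = p (Suc n)"

lemma const_series_closed: "\<xi> \<in> carrier Zm \<Longrightarrow> const_series \<xi> \<in> carrier R"
  by (simp add: in_madic_fps_iff const_series_def zero_in_madic_ring)

lemma shift_series_closed: "p \<in> carrier R \<Longrightarrow> shift_series p \<in> carrier R"
  by (simp add: in_madic_fps_iff shift_series_def)

lemma slice_const_series: "slice i (const_series \<xi>) = fps_const (\<xi> i)"
  by (rule fps_ext) (simp add: const_series_def madic_ring_def)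

lemma slice_shift_series: "slice i (shift_series p) = fps_shift 1 (slice i p)"
  by (rule fps_ext) (simp add: shift_series_def)

lemma series_decomposition:
  assumes "p \<in> carrier R"
  shows "p = const_series (p 0) \<oplus>\<^bsub>R\<^esub> fps_var Zm \<otimes>\<^bsub>R\<^esub> shift_series p"
proof (rule madic_fps_eqI[OF assms])
  have p0: "const_series (p 0) \<in> carrier R"
    using assms by (intro const_series_closed) (simp add: in_madic_fps_iff)
  note s = shift_series_closed[OF assms] and X = fps_constants_closed(3)
  show "const_series (p 0) \<oplus>\<^bsub>R\<^esub> fps_var Zm \<otimes>\<^bsub>R\<^esub> shift_series p \<in> carrier R"
    using p0 s X by simp
  fix i
  have "slice i p = fps_const (p 0 i) + fps_X * fps_shift 1 (slice i p)"
    using fps_head_tail[of "slice i p"] by simp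
  also have "\<dots> = slice i (const_series (p 0)) + fps_X * slice i (shift_series p)"
    by (simp add: slice_const_series slice_shift_series)
  also have "fcong (int m ^ i) \<dots> (slice i (const_series (p 0) \<oplus>\<^bsub>R\<^esub> fps_var Zm \<otimes>\<^bsub>R\<^esub> shift_series p))"
    using s X by (intro fcong_sym[OF fcong_trans[OF slice_add fcong_add[OF fcong_refl
        fcong_trans[OF slice_mult fcong_mult[OF slice_constants(3) fcong_refl]]]]])
  finally show "fcong (int m ^ i) (slice i p)
      (slice i (const_series (p 0) \<oplus>\<^bsub>R\<^esub> fps_var Zm \<otimes>\<^bsub>R\<^esub> shift_series p))" .
qed

lemma has_madic_pow_root_gen:
  assumes "\<xi> \<in> carrier Zm"
  shows "has_madic_pow m root_gen \<xi> (adic_act (const_series \<xi>))"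
proof (rule has_madic_powI)
  show "root_gen \<in> carrier \<A>" "adic_act (const_series \<xi>) \<in> carrier \<A>"
    using assms by (auto intro: root_gen_closed adic_act_closed const_series_closed)
  fix n l assume n: "n mod int m ^ l = \<xi> l"
  have "fcong (int m ^ l) (slice l (const_series \<xi>)) (of_int n)"
  proof -
    have "\<xi> l mod int m ^ l = n mod int m ^ l"
      using n madic_coherent[OF assms order_refl] by simp
    then show ?thesis by (simp add: slice_const_series fcong_mod flip: fps_of_int)
  qed
  then show "agree l (root_gen [^]\<^bsub>\<A>\<^esub> n) (adic_act (const_series \<xi>))"
    unfolding agree_def using root_gen_int_pow adic_act_cong const_series_closed[OF assms] by simp
qed

text \<open>
  Splitting off one coefficient after the other,
  \<open>p = p\<^sub>0 + x p\<^sub>1 + \<dots> + x\<^sup>k\<^sup>-\<^sup>1 p\<^sub>k\<^sub>-\<^sub>1 + x\<^sup>k p'\<close>, writes the action of \<open>p\<close> as a partial product of \<open>\<alpha>\<^sup>p\<close>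
  followed by a \<open>k\<close>-fold diagonal, which is trivial up to level \<open>k\<close>.
\<close>

lemma has_fps_pow_root_gen:
  assumes "p \<in> carrier R"
  shows "has_fps_pow m root_gen p (adic_act p)"
proof (rule has_fps_powI)
  let ?\<gamma> = "\<lambda>k. adic_act (const_series (p k))"
  have coeff: "p k \<in> carrier Zm" for k using assms by (simp add: in_madic_fps_iff)
  show "has_madic_pow m root_gen (p k) (?\<gamma> k)" for k using coeff by (rule has_madic_pow_root_gen)
  show \<gamma>: "?\<gamma> k \<in> carrier \<A>" for k using coeff by (intro adic_act_closed const_series_closed)
  show "adic_act p \<in> carrier \<A>" using assms by (rule adic_act_closed)
  have tail: "(shift_series ^^ k) p \<in> carrier R" "(shift_series ^^ k) p n = p (n + k)" for k n
  proof -
    show "(shift_series ^^ k) p \<in> carrier R"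
      using assms by (induction k) (simp_all add: shift_series_closed)
    show "(shift_series ^^ k) p n = p (n + k)"
      by (induction k arbitrary: n) (simp_all add: shift_series_def)
  qed
  have rest: "adic_act p = (diag ^^ k) (adic_act ((shift_series ^^ k) p)) \<circ> diag_partial_prod m ?\<gamma> k" for k
  proof (induction k)
    case 0
    have "adic_act p = (diag ^^ 0) (adic_act ((shift_series ^^ 0) p)) \<circ> diag_partial_prod m ?\<gamma> 0" by simp
    then show ?case .
  next
    case (Suc k)
    let ?p = "(shift_series ^^ k) p"
    have "adic_act ?p = adic_act (const_series (?p 0) \<oplus>\<^bsub>R\<^esub> fps_var Zm \<otimes>\<^bsub>R\<^esub> shift_series ?p)"
      using series_decomposition[OF tail(1)] by simp
    also have "\<dots> = diag (adic_act (shift_series ?p)) \<circ> ?\<gamma> k"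
    proof -
      have head: "?p 0 = p k" using tail(2)[of k 0] by simp
      note s = shift_series_closed[OF tail(1), of k]
      show ?thesis
        unfolding head adic_act_var[OF s, symmetric]
        by (intro adic_act_add const_series_closed coeff R.m_closed fps_constants_closed s)
    qed
    finally have "(diag ^^ k) (adic_act ?p) = (diag ^^ k) (diag (adic_act (shift_series ?p)) \<circ> ?\<gamma> k)"
      by (rule arg_cong)
    also have "\<dots> = (diag ^^ k) (diag (adic_act (shift_series ?p))) \<circ> (diag ^^ k) (?\<gamma> k)"
      by (intro diag_pow_comp diag_closed \<gamma> adic_act_closed shift_series_closed tail(1))
    also have "\<dots> = (diag ^^ Suc k) (adic_act ((shift_series ^^ Suc k) p)) \<circ> (diag ^^ k) (?\<gamma> k)"
      by (simp add: funpow_swap1)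
    finally have "(diag ^^ k) (adic_act ?p) \<circ> diag_partial_prod m ?\<gamma> k =
        (diag ^^ Suc k) (adic_act ((shift_series ^^ Suc k) p)) \<circ> diag_partial_prod m ?\<gamma> (Suc k)"
      by (simp add: comp_assoc)
    then show ?case by (rule trans[OF Suc])
  qed
  show "agree k (diag_partial_prod m ?\<gamma> k) (adic_act p)" for k
  proof -
    have "agree (0 + k) ((diag ^^ k) (adic_act ((shift_series ^^ k) p))) ((diag ^^ k) id)"
      using tail by (intro agree_diag_pow agree_0 adic_act_closed id_tree_aut)
    then have "agree k (id \<circ> diag_partial_prod m ?\<gamma> k)
        ((diag ^^ k) (adic_act ((shift_series ^^ k) p)) \<circ> diag_partial_prod m ?\<gamma> k)"
      using diag_partial_prod_closed[of ?\<gamma>, OF \<gamma>] by (intro agree_comp) (auto intro: agree_sym)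
    then show ?thesis by (simp flip: rest)
  qed
qed

text \<open>
  The values of the cycle are obtained by comparing the list of letters with its rotation.
\<close>

lemma rotation_cycle: "y \<in> Y \<Longrightarrow> cycle_of_list [1..<Suc m] y = rotate_letter 1 y"
proof -
  assume y: "y \<in> Y"
  let ?cs = "[1..<Suc m]"
  have "map (cycle_of_list ?cs ^^ 1) ?cs = rotate 1 ?cs"
    by (rule cyclic_rotation) simp
  then have "map (cycle_of_list ?cs) ?cs ! (y - 1) = rotate1 ?cs ! (y - 1)" by simp
  then have "cycle_of_list ?cs y = y mod m + 1"
    using y by (subst (asm) nth_map) (auto simp: nth_rotate1 nth_upt simp del: upt_Suc)
  moreover have "(int y - 1 + 1) mod int m = int (y mod m)" by (simp add: zmod_int)
  ultimately show ?thesis by (simp only: rotate_letter_def nat_int)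
qed

text \<open>
  The state of the action of 1 at \<open>y\<close> is the action of \<open>q\<^sub>y\<close>, by \<open>cumul_step\<close>.
\<close>

lemma tree_rec_root_gen: "tree_rec m q (cycle_of_list [1..<Suc m]) root_gen"
  unfolding tree_rec_def
proof (intro conjI exI ballI root_gen_closed)
  show "has_fps_pow m root_gen (q y) (adic_act (q y))" if "y \<in> Y" for y
    using q that by (intro has_fps_pow_root_gen) auto
  show "root_gen = tree_cons m (\<lambda>y. adic_act (q y)) (cycle_of_list [1..<Suc m])"
  proof
    fix u show "root_gen u = tree_cons m (\<lambda>y. adic_act (q y)) (cycle_of_list [1..<Suc m]) u"
    proof (cases "u \<in> W")
      case True
      show ?thesis
      proof (cases u)
        case Nil
        then show ?thesis by (simp add: adic_act_def)
      next
        case (Cons y v)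
        with True have yv: "y \<in> Y" "v \<in> W" by auto
        let ?l = "length u"
        have "root_gen u = act (q_slice ?l) u 1"
          using True by (intro adic_act_cong slice_constants R.one_closed) auto
        also have "\<dots> = rotate_letter 1 y # act (q_slice ?l) v (q_slice ?l y)"
          unfolding Cons by (rule act_one[OF yv(1)])
        also have "act (q_slice ?l) v (q_slice ?l y) = adic_act (q y) v"
          using yv Cons q by (intro adic_act_level[symmetric]) auto
        finally show ?thesis using Cons yv rotation_cycle[OF yv(1)] by simp
      qed
    qed (simp add: adic_act_outside)
  qed
qed

end

section \<open>The series that act trivially\<close>

lemma (in cring) cancel_common_multiple:
  assumes "c \<in> carrier R" "r \<in> carrier R" "x \<in> carrier R" "p \<in> carrier R" "s \<in> carrier R"
  shows "(c \<otimes> r \<oplus> x \<otimes> p) \<ominus> (c \<oplus> x \<otimes> s) \<otimes> r = x \<otimes> (p \<ominus> s \<otimes> r)"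
  using assms by algebra

context m_ary_tree
begin

lemma var_mult_nth:
  assumes "p \<in> carrier R"
  shows "(fps_var Zm \<otimes>\<^bsub>R\<^esub> p) 0 = \<zero>\<^bsub>R\<^esub> 0" "(fps_var Zm \<otimes>\<^bsub>R\<^esub> p) (Suc n) = p n"
proof -
  let ?xp = "fps_var Zm \<otimes>\<^bsub>R\<^esub> p"
  have X: "fps_var Zm \<in> carrier R" by (rule fps_constants_closed)
  have in_R: "?xp \<in> carrier R" using assms X by simp
  have cong: "fcong (int m ^ i) (slice i ?xp) (fps_X * slice i p)" for i
    using assms X by (intro fcong_trans[OF slice_mult fcong_mult[OF slice_constants(3) fcong_refl]])
  have self: "f n i mod int m ^ i = f n i" if "f \<in> carrier R" for f n i
    using that by (intro madic_coherent) (auto simp: in_madic_fps_iff)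
  show "?xp 0 = \<zero>\<^bsub>R\<^esub> 0"
  proof
    fix i show "?xp 0 i = \<zero>\<^bsub>R\<^esub> 0 i"
      using spec[OF cong[of i, unfolded fcong_mod], of 0] self[OF in_R, of 0 i]
      by (simp add: fps_ring_def madic_ring_def)
  qed
  show "?xp (Suc n) = p n"
  proof
    fix i show "?xp (Suc n) i = p n i"
      using spec[OF cong[of i, unfolded fcong_mod], of "Suc n"] self[OF in_R, of "Suc n" i] self[OF assms, of n i]
      by simp
  qed
qed

text \<open>
  A series divisible by every power of \<open>x\<close> vanishes.
\<close>

lemma infinitely_divisible_by_var:
  assumes "\<And>k. d k \<in> carrier R" "\<And>k. d k = fps_var Zm \<otimes>\<^bsub>R\<^esub> d (Suc k)"
  shows "d 0 = \<zero>\<^bsub>R\<^esub>"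
proof
  fix n
  have "d k n = \<zero>\<^bsub>R\<^esub> n" for k
  proof (induction n arbitrary: k)
    case 0
    then show ?case using var_mult_nth(1)[OF assms(1)] assms(2)[of k] by metis
  next
    case (Suc n)
    have "d k (Suc n) = d (Suc k) n" using var_mult_nth(2)[OF assms(1)] assms(2)[of k] by metis
    also have "\<dots> = \<zero>\<^bsub>R\<^esub> (Suc n)" using Suc by (simp add: fps_ring_def)
    finally show ?case .
  qed
  then show "d 0 n = \<zero>\<^bsub>R\<^esub> n" .
qed

lemma madic_divide_by_m:
  assumes "\<xi> \<in> carrier Zm"
  shows "(\<lambda>i. \<xi> (Suc i) div int m) \<in> carrier Zm"
proof -
  have "\<xi> (Suc (Suc i)) div int m mod int m ^ i = \<xi> (Suc i) div int m" for i
  proof -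
    have "\<xi> (Suc i) = \<xi> (Suc (Suc i)) mod (int m * int m ^ i)"
      using madic_coherent_Suc[OF assms, of "Suc i"] by simp
    also have "\<dots> = int m * (\<xi> (Suc (Suc i)) div int m mod int m ^ i) + \<xi> (Suc (Suc i)) mod int m"
      by (rule zmod_zmult2_eq) simp
    finally show ?thesis using m_pos by simp
  qed
  moreover have "0 \<le> \<xi> (Suc i) div int m" "\<xi> (Suc i) div int m < int m ^ i" for i
  proof -
    have "0 \<le> \<xi> (Suc i)" "\<xi> (Suc i) < int m ^ i * int m"
      using assms by (auto simp: in_madic_ring_iff mult.commute simp flip: power_Suc)
    moreover have "\<xi> (Suc i) div int m * int m \<le> \<xi> (Suc i)"
      using div_mult_mod_eq[of "\<xi> (Suc i)" "int m"] pos_mod_sign[OF m_pos, of "\<xi> (Suc i)"] by linarith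
    ultimately have "\<xi> (Suc i) div int m * int m < int m ^ i * int m" by linarith
    then show "\<xi> (Suc i) div int m < int m ^ i" using m_pos by simp
    show "0 \<le> \<xi> (Suc i) div int m"
      using m_pos \<open>0 \<le> \<xi> (Suc i)\<close> by (simp add: pos_imp_zdiv_nonneg_iff)
  qed
  ultimately show ?thesis by (simp add: in_madic_ring_iff)
qed

end

context tree_recursion
begin

definition relation :: "nat \<Rightarrow> nat \<Rightarrow> int" where
  "relation = ([m] \<cdot>\<^bsub>R\<^esub> \<one>\<^bsub>R\<^esub>) \<ominus>\<^bsub>R\<^esub> (fps_var Zm \<otimes>\<^bsub>R\<^esub> (\<Oplus>\<^bsub>R\<^esub>i\<in>Y. q i))"

lemma sum_q_closed: "(\<Oplus>\<^bsub>R\<^esub>i\<in>Y. q i) \<in> carrier R"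
  using q by (intro R.finsum_closed) auto

lemma relation_closed: "relation \<in> carrier R"
  unfolding relation_def
  by (intro R.minus_closed R.m_closed sum_q_closed fps_constants_closed R.add.nat_pow_closed R.one_closed)

lemma slice_relation:
  "fcong (int m ^ i) (slice i relation) (of_nat m - fps_X * total (q_slice i))"
proof -
  have "(\<Sum>y\<in>Y. q_slice i y) = total (q_slice i)"
    by (simp add: total_def sum.atLeast1_atMost_eq)
  then have "fcong (int m ^ i) (slice i (\<Oplus>\<^bsub>R\<^esub>i\<in>Y. q i)) (total (q_slice i))"
    using slice_finsum[of Y q i] q by simp
  then have "fcong (int m ^ i) (slice i (fps_var Zm \<otimes>\<^bsub>R\<^esub> (\<Oplus>\<^bsub>R\<^esub>i\<in>Y. q i))) (fps_X * total (q_slice i))"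
    by (intro fcong_trans[OF slice_mult fcong_mult[OF slice_constants(3)]] sum_q_closed fps_constants_closed)
  then show ?thesis
    unfolding relation_def
    by (intro fcong_trans[OF slice_diff fcong_diff[OF slice_of_nat]] R.m_closed sum_q_closed
        fps_constants_closed R.add.nat_pow_closed R.one_closed)
qed

lemma adic_act_multiple_of_relation:
  assumes "s \<in> carrier R"
  shows "adic_act (s \<otimes>\<^bsub>R\<^esub> relation) = id"
proof
  fix u show "adic_act (s \<otimes>\<^bsub>R\<^esub> relation) u = id u"
  proof (cases "u \<in> W")
    case True
    let ?l = "length u"
    have "adic_act (s \<otimes>\<^bsub>R\<^esub> relation) u =
        act (q_slice ?l) u (slice ?l s * (of_nat m - fps_X * total (q_slice ?l)))"
      using assms True
      by (intro adic_act_cong R.m_closed relation_closed order_refl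
          fcong_trans[OF slice_mult fcong_mult[OF fcong_refl slice_relation]])
    then show ?thesis using act_relation[OF True] by simp
  qed (simp add: adic_act_outside)
qed

text \<open>
  The quotient of the constant coefficient by \<open>m\<close>, for series whose constant coefficient is
  divisible by \<open>m\<close>.  Its residue modulo \<open>m\<^sup>i\<close> is computed from the residue modulo \<open>m\<^sup>i\<^sup>+\<^sup>1\<close>.
\<close>

definition divided_head :: "(nat \<Rightarrow> nat \<Rightarrow> int) \<Rightarrow> nat \<Rightarrow> int" where
  "divided_head p i = p 0 (Suc i) div int m"

lemma divided_head_closed: "p \<in> carrier R \<Longrightarrow> divided_head p \<in> carrier Zm"
  using madic_divide_by_m[of "p 0"] by (simp add: divided_head_def[abs_def] in_madic_fps_iff)

text \<open>
  One step of division by \<open>r = m - x q\<close>: with \<open>p = m s + x p'\<close> one has \<open>p = s r + x (s q + p')\<close>, and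
  \<open>s q + p'\<close> is the series that describes the states of the action of \<open>p\<close>.
\<close>

lemma division_by_relation:
  assumes p: "p \<in> carrier R" and "p 0 1 = 0"
  shows "p = const_series (divided_head p) \<otimes>\<^bsub>R\<^esub> relation \<oplus>\<^bsub>R\<^esub> fps_var Zm \<otimes>\<^bsub>R\<^esub> adic_state 1 p"
proof (rule madic_fps_eqI[OF p])
  note closed = const_series_closed[OF divided_head_closed[OF p]] relation_closed
    adic_state_closed[OF p] fps_constants_closed(3)
  show "const_series (divided_head p) \<otimes>\<^bsub>R\<^esub> relation \<oplus>\<^bsub>R\<^esub> fps_var Zm \<otimes>\<^bsub>R\<^esub> adic_state 1 p \<in> carrier R"
    using closed by simp
  fix i
  let ?P = "slice (Suc i) p"
  let ?Q = "q_slice (Suc i)"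
  define s where "s = divided_head p i"
  have "p 0 (Suc i) mod int m ^ 1 = p 0 1"
    using p by (intro madic_coherent) (auto simp: in_madic_fps_iff)
  then have head: "p 0 (Suc i) = int m * s"
    using assms(2) mult_div_mod_eq[of "int m" "p 0 (Suc i)"] by (simp add: s_def divided_head_def)
  have "cumul ?Q (0 + int m * s) = cumul ?Q 0 + fps_const s * total ?Q"
    unfolding cumul_add_multiple using fps_of_int[of s, where ?'a = int] by simp
  then have state: "fps_state ?Q 1 ?P = fps_const s * total ?Q + fps_shift 1 ?P"
    by (simp add: fps_state_def head)
  have "?P = fps_const (int m * s) + fps_X * fps_shift 1 ?P"
    using fps_head_tail[of ?P] by (simp add: head)
  also have "\<dots> = fps_const s * (of_nat m - fps_X * total ?Q) + fps_X * fps_state ?Q 1 ?P"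
    unfolding state by (simp add: algebra_simps fps_of_nat flip: fps_const_mult)
  finally have P: "?P = fps_const s * (of_nat m - fps_X * total ?Q) + fps_X * fps_state ?Q 1 ?P" .
  have total: "fcong (int m ^ i) (total ?Q) (total (q_slice i))"
    unfolding total_def by (intro fcong_sum q_slice_coherent) auto
  have "fcong (int m ^ i) (slice i p) ?P"
    by (rule fcong_sym[OF slice_coherent[OF p]]) simp
  also have "fcong (int m ^ i) ?P
      (slice i (const_series (divided_head p)) * slice i relation + fps_X * slice i (adic_state 1 p))"
    unfolding slice_const_series s_def[symmetric]
    by (subst P) (intro fcong_add fcong_mult fcong_refl fcong_trans[OF fcong_diff[OF fcong_refl
        fcong_mult[OF fcong_refl total]] fcong_sym[OF slice_relation]]
        fcong_sym[OF slice_reduce[of i "\<lambda>i. fps_state (q_slice (Suc i)) 1 (slice (Suc i) p)",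
          folded adic_state_def]])
  also have "fcong (int m ^ i) \<dots>
      (slice i (const_series (divided_head p) \<otimes>\<^bsub>R\<^esub> relation \<oplus>\<^bsub>R\<^esub> fps_var Zm \<otimes>\<^bsub>R\<^esub> adic_state 1 p))"
    using closed by (intro fcong_sym[OF fcong_trans[OF slice_add fcong_add[OF slice_mult
        fcong_trans[OF slice_mult fcong_mult[OF slice_constants(3) fcong_refl]]]]])
  finally show "fcong (int m ^ i) (slice i p)
      (slice i (const_series (divided_head p) \<otimes>\<^bsub>R\<^esub> relation \<oplus>\<^bsub>R\<^esub> fps_var Zm \<otimes>\<^bsub>R\<^esub> adic_state 1 p))" .
qed

lemma adic_act_id_head:
  assumes "p \<in> carrier R" "adic_act p = id"
  shows "p 0 1 = 0"
proof -
  have "1 \<in> Y" using m_ge_2 by simp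
  from root_perm_adic_act[OF assms(1) this] have "rotate_letter (p 0 1) 1 = 1"
    using assms(2) by simp
  then have "p 0 1 mod int m = 0"
    using rotate_letter_int[of "p 0 1" 1] by simp
  moreover have "p 0 1 mod int m ^ 1 = p 0 1"
    using assms(1) by (intro madic_coherent) (auto simp: in_madic_fps_iff)
  ultimately show ?thesis by simp
qed

text \<open>
  If \<open>p\<close> acts trivially, so does the series describing its states, and the division step can be
  repeated for ever; this gives \<open>p = (s\<^sub>0 + s\<^sub>1 x + s\<^sub>2 x\<^sup>2 + \<dots>) r\<close>.
\<close>

lemma adic_act_kernel:
  assumes p: "p \<in> carrier R" "adic_act p = id"
  obtains s where "s \<in> carrier R" "p = s \<otimes>\<^bsub>R\<^esub> relation"
proof -
  have "1 \<in> Y" using m_ge_2 by simp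
  \<comment> \<open>The successive dividends of the division by \<open>r\<close>.\<close>
  define P where "P k = (adic_state 1 ^^ k) p" for k
  have P_Suc: "P (Suc k) = adic_state 1 (P k)" for k by (simp add: P_def)
  have P: "P k \<in> carrier R \<and> adic_act (P k) = id" for k
  proof (induction k)
    case 0
    show "P 0 \<in> carrier R \<and> adic_act (P 0) = id" using p by (simp add: P_def)
  next
    case (Suc k)
    then have "adic_act (P (Suc k)) = cmp (adic_act (P k)) 1"
      unfolding P_Suc by (intro tree_comp_adic_act[symmetric] \<open>1 \<in> Y\<close>) simp
    also have "\<dots> = id" using Suc by (metis tree_comp_id)
    finally show "P (Suc k) \<in> carrier R \<and> adic_act (P (Suc k)) = id"
      using Suc adic_state_closed P_Suc by metis
  qed
  \<comment> \<open>The tail from index \<open>k\<close> on of the quotient, a series of successive digits.\<close>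
  define S where "S k n = divided_head (P (k + n))" for k n
  have S: "S k \<in> carrier R" for k
    using divided_head_closed P by (simp add: in_madic_fps_iff S_def)
  have S_step: "S k = const_series (divided_head (P k)) \<oplus>\<^bsub>R\<^esub> fps_var Zm \<otimes>\<^bsub>R\<^esub> S (Suc k)" for k
  proof -
    have "S k 0 = divided_head (P k)" "shift_series (S k) = S (Suc k)"
      by (simp_all add: S_def shift_series_def fun_eq_iff)
    then show ?thesis using series_decomposition[OF S[of k]] by simp
  qed
  \<comment> \<open>The defect after \<open>k\<close> steps; each defect is \<open>x\<close> times the next one.\<close>
  define d where "d k = P k \<ominus>\<^bsub>R\<^esub> S k \<otimes>\<^bsub>R\<^esub> relation" for k
  have "d k \<in> carrier R" for k
    unfolding d_def using P S relation_closed by (intro R.minus_closed R.m_closed) auto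
  moreover have "d k = fps_var Zm \<otimes>\<^bsub>R\<^esub> d (Suc k)" for k
  proof -
    have "P k = const_series (divided_head (P k)) \<otimes>\<^bsub>R\<^esub> relation \<oplus>\<^bsub>R\<^esub> fps_var Zm \<otimes>\<^bsub>R\<^esub> P (Suc k)"
      unfolding P_Suc using P adic_act_id_head by (intro division_by_relation) auto
    then have "d k = (const_series (divided_head (P k)) \<otimes>\<^bsub>R\<^esub> relation \<oplus>\<^bsub>R\<^esub> fps_var Zm \<otimes>\<^bsub>R\<^esub> P (Suc k))
        \<ominus>\<^bsub>R\<^esub> (const_series (divided_head (P k)) \<oplus>\<^bsub>R\<^esub> fps_var Zm \<otimes>\<^bsub>R\<^esub> S (Suc k)) \<otimes>\<^bsub>R\<^esub> relation"
      unfolding d_def using S_step[of k] by simp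
    also have "\<dots> = fps_var Zm \<otimes>\<^bsub>R\<^esub> d (Suc k)"
      unfolding d_def
      using P S relation_closed fps_constants_closed(3) const_series_closed divided_head_closed
      by (intro R.cancel_common_multiple) auto
    finally show ?thesis .
  qed
  ultimately have "d 0 = \<zero>\<^bsub>R\<^esub>" by (rule infinitely_divisible_by_var)
  then have "p = S 0 \<otimes>\<^bsub>R\<^esub> relation"
    using p S relation_closed by (simp add: d_def P_def)
  with S that show ?thesis by blast
qed

lemma adic_act_group_hom: "group_hom (add_monoid R) \<A> adic_act"
proof (intro group_hom.intro group_hom_axioms.intro homI R.a_group G.group_axioms)
  fix p p' assume "p \<in> carrier (add_monoid R)" "p' \<in> carrier (add_monoid R)"
  then show "adic_act p \<in> carrier \<A>"
    "adic_act (p \<otimes>\<^bsub>add_monoid R\<^esub> p') = adic_act p \<otimes>\<^bsub>\<A>\<^esub> adic_act p'"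
    by (simp_all add: adic_act_closed adic_act_add)
qed

lemma adic_act_range_subgroup: "subgroup (adic_act ` carrier R) \<A>"
  using group_hom.img_is_subgroup[OF adic_act_group_hom] by simp

lemma adic_act_range_state_closed: "state_closed m (adic_act ` carrier R)"
  unfolding state_closed_iff
  using adic_act_range_subgroup tree_comp_adic_act adic_state_closed by auto

lemma adic_act_range_commutes:
  assumes "\<alpha> \<in> adic_act ` carrier R" "\<beta> \<in> adic_act ` carrier R"
  shows "\<beta> \<circ> \<alpha> = \<alpha> \<circ> \<beta>"
proof -
  from assms obtain p p' where "\<alpha> = adic_act p" "p \<in> carrier R" "\<beta> = adic_act p'" "p' \<in> carrier R"
    by blast
  then show ?thesis by (metis R.a_comm adic_act_add)
qed

end

context m_ary_tree
begin

section \<open>Structure of the closures\<close>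

lemma state_closure_incl: "G \<subseteq> state_closure m G"
  by (auto simp: state_closure_def)

lemma state_closure_minimal: "state_closed m H \<Longrightarrow> G \<subseteq> H \<Longrightarrow> state_closure m G \<subseteq> H"
  by (auto simp: state_closure_def)

lemma state_closed_state_closure:
  assumes "G \<subseteq> carrier \<A>"
  shows "state_closed m (state_closure m G)"
proof -
  have "state_closed m (carrier \<A>)"
    by (simp add: state_closed_iff G.subgroup_self tree_comp_closed)
  with assms have "subgroup (state_closure m G) \<A>"
    unfolding state_closure_def
    by (intro G.subgroups_Inter) (auto simp: state_closed_iff)
  then show ?thesis
    by (auto simp: state_closure_def state_closed_iff)
qed

lemma elt_state_closure:
  assumes "\<alpha> \<in> carrier \<A>"
  shows "\<alpha> \<in> elt_state_closure m \<alpha>" "state_closed m (elt_state_closure m \<alpha>)"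
    "state_closed m H \<Longrightarrow> \<alpha> \<in> H \<Longrightarrow> elt_state_closure m \<alpha> \<subseteq> H"
proof -
  have gen: "generate \<A> {\<alpha>} \<subseteq> carrier \<A>" using assms by (intro G.generate_incl) simp
  show "\<alpha> \<in> elt_state_closure m \<alpha>"
    unfolding elt_state_closure_def using state_closure_incl generate.incl[of \<alpha> "{\<alpha>}" \<A>] by blast
  show "state_closed m (elt_state_closure m \<alpha>)"
    unfolding elt_state_closure_def by (rule state_closed_state_closure[OF gen])
  show "elt_state_closure m \<alpha> \<subseteq> H" if "state_closed m H" "\<alpha> \<in> H"
    unfolding elt_state_closure_def
    using that by (intro state_closure_minimal G.generate_subgroup_incl) (auto simp: state_closed_iff)
qed

lemma closed_abelian_diag_top_closure:
  assumes "state_abelian A" "transitive_on_level1 m A"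
  shows "closed_abelian m (diag_top_closure m A)"
proof (unfold_locales)
  have A: "subgroup A \<A>" using assms(1) by (simp add: state_abelian_def)
  show "state_abelian (diag_top_closure m A)" by (rule state_abelian_diag_top_closure[OF assms(1)])
  show "diag_top_closed (diag_top_closure m A)"
    by (rule diag_top_closed_diag_top_closure[OF subgroup.subset[OF A]])
  show "transitive_on_level1 m (diag_top_closure m A)"
    using assms(2) perm_group_diag_top_closure[OF A] by (simp add: transitive_on_level1_def)
qed

text \<open>
  Only the factor with index 0 of \<open>\<alpha>\<^sup>q\<close> acts on the first level, and there it acts as an integral
  power of \<open>\<alpha>\<close>.
\<close>

lemma root_perm_fps_pow:
  assumes "has_fps_pow m \<alpha> q \<beta>" "\<alpha> \<in> carrier \<A>" "q \<in> carrier R"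
  obtains n :: int where "rt \<beta> = rt (\<alpha> [^]\<^bsub>\<A>\<^esub> n)"
proof -
  obtain \<gamma> where \<gamma>: "\<And>i. has_madic_pow m \<alpha> (q i) (\<gamma> i)" "\<And>i. \<gamma> i \<in> carrier \<A>"
    "\<forall>\<^sub>F k in sequentially. agree 1 (diag_partial_prod m \<gamma> k) \<beta>"
    using has_fps_powD[OF assms] by metis
  have "rt (diag_partial_prod m \<gamma> (Suc k)) = rt (\<gamma> 0)" for k
  proof (induction k)
    case (Suc k)
    have "rt (diag_partial_prod m \<gamma> (Suc (Suc k))) =
        rt ((diag ^^ Suc k) (\<gamma> (Suc k)) \<circ> diag_partial_prod m \<gamma> (Suc k))" by simp
    also have "\<dots> = rt ((diag ^^ Suc k) (\<gamma> (Suc k))) \<circ> rt (diag_partial_prod m \<gamma> (Suc k))"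
      using \<gamma>(2) by (intro root_perm_comp diag_partial_prod_closed diag_pow_closed)
    also have "\<dots> = rt (diag_partial_prod m \<gamma> (Suc k))" by simp
    also note Suc
    finally show ?case .
  qed simp
  moreover obtain k where "agree 1 (diag_partial_prod m \<gamma> k) \<beta>" "k > 0"
    using eventually_happens'[OF sequentially_bot eventually_conj[OF \<gamma>(3) eventually_gt_at_top[of 0]]]
    by blast
  ultimately have "rt \<beta> = rt (\<gamma> 0)"
    using agree_root[of 1 _ \<beta>] by (metis gr0_conv_Suc order_refl)
  moreover obtain n where "agree 1 (\<alpha> [^]\<^bsub>\<A>\<^esub> (q 0 n)) (\<gamma> 0)"
    using has_madic_powD(2)[OF \<gamma>(1) assms(2), of 0 1] assms(3) in_madic_fps_iff
      eventually_happens'[OF sequentially_bot] by blast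
  ultimately show ?thesis using that agree_root[of 1] by (metis order_refl)
qed

end

context tree_recursion
begin

lemma root_gen_state_closure:
  shows "elt_state_closure m root_gen \<subseteq> adic_act ` carrier R"
    and "state_abelian (elt_state_closure m root_gen)"
    and "transitive_on_level1 m (elt_state_closure m root_gen)"
proof -
  let ?A = "elt_state_closure m root_gen"
  note A = elt_state_closure[OF root_gen_closed]
  have sub: "subgroup ?A \<A>" using A(2) by (simp add: state_closed_iff)
  show range: "?A \<subseteq> adic_act ` carrier R"
    by (intro A(3) adic_act_range_state_closed imageI R.one_closed)
  show "state_abelian ?A"
    unfolding state_abelian_def
  proof (intro conjI ballI)
    show "\<beta> \<circ> \<alpha> = \<alpha> \<circ> \<beta>" if "\<alpha> \<in> ?A" "\<beta> \<in> ?A" for \<alpha> \<beta>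
      using that range by (intro adic_act_range_commutes) auto
  qed (use A(2) sub in \<open>auto simp: state_closed_iff\<close>)
  show "transitive_on_level1 m ?A"
    unfolding transitive_on_level1_def
  proof (intro ballI)
    fix x y assume xy: "x \<in> Y" "y \<in> Y"
    \<comment> \<open>The root permutation of \<open>\<alpha>\<close> is the cycle, so this power moves \<open>x\<close> to \<open>y\<close>.\<close>
    let ?n = "int y - int x"
    have "root_gen [^]\<^bsub>\<A>\<^esub> ?n \<in> ?A" by (rule G.subgroup_int_pow_closed[OF sub A(1)])
    moreover have "rt (root_gen [^]\<^bsub>\<A>\<^esub> ?n) x = y"
      unfolding root_perm_root_gen_pow[OF xy(1)]
      using xy by (simp add: rotate_letter_def Suc_nat_eq_nat_zadd1)
    ultimately show "\<exists>\<gamma>\<in>perm_group m ?A. \<gamma> x = y" unfolding perm_group_def by blast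
  qed
qed

text \<open>
  \<open>A\<^sup>*\<close> is the group of all \<open>\<alpha>\<^sup>p\<close>: it contains these because it is closed, and the digit expansion
  \<open>fps_pow_generates\<close> shows that there is nothing else.
\<close>

lemma root_gen_diag_top_closure:
  "diag_top_closure m (elt_state_closure m root_gen) = adic_act ` carrier R"
proof -
  let ?A = "elt_state_closure m root_gen"
  note A = elt_state_closure[OF root_gen_closed]
  have sub: "subgroup ?A \<A>" using A(2) by (simp add: state_closed_iff)
  interpret C: closed_abelian m "diag_top_closure m ?A"
    by (rule closed_abelian_diag_top_closure[OF root_gen_state_closure(2,3)])
  have gen: "root_gen \<in> diag_top_closure m ?A"
    using diag_top_closure_incl[OF subgroup.subset[OF sub]] A(1) by blast
  show ?thesis
  proof
    show "adic_act ` carrier R \<subseteq> diag_top_closure m ?A"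
      using diag_top_closed_fps_pow[OF C.diag_top_closed gen _ has_fps_pow_root_gen] by blast
    show "diag_top_closure m ?A \<subseteq> adic_act ` carrier R"
    proof
      fix \<beta> assume \<beta>: "\<beta> \<in> diag_top_closure m ?A"
      have "\<exists>n::int. rt \<delta> = rt (root_gen [^]\<^bsub>\<A>\<^esub> n)" if "\<delta> \<in> diag_top_closure m ?A" for \<delta>
      proof -
        have "rt \<delta> \<in> perm_group m ?A"
          using that perm_group_diag_top_closure[OF sub] unfolding perm_group_def by blast
        then obtain p where p: "p \<in> carrier R" "rt \<delta> = rt (adic_act p)"
          using root_gen_state_closure(1) unfolding perm_group_def by blast
        have "rt (adic_act p) = rt (root_gen [^]\<^bsub>\<A>\<^esub> (p 0 1))"
        proof
          fix y show "rt (adic_act p) y = rt (root_gen [^]\<^bsub>\<A>\<^esub> (p 0 1)) y"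
            using root_perm_adic_act[OF p(1)] root_perm_root_gen_pow
            by (cases "y \<in> Y") (simp_all add: root_perm_outside del: atLeastAtMost_iff)
        qed
        with p(2) show ?thesis by metis
      qed
      then obtain p where "p \<in> carrier R" "has_fps_pow m root_gen p \<beta>"
        by (rule C.fps_pow_generates[OF gen _ \<beta>])
      then show "\<beta> \<in> adic_act ` carrier R"
        using has_fps_pow_unique[OF _ has_fps_pow_root_gen root_gen_closed] by blast
    qed
  qed
qed

lemma root_gen_quotient_iso:
  "\<A>\<lparr>carrier := diag_top_closure m (elt_state_closure m root_gen)\<rparr>
    \<cong> add_monoid (R Quot (PIdl\<^bsub>R\<^esub> relation))"
proof -
  let ?H = "\<A>\<lparr>carrier := adic_act ` carrier R\<rparr>"
  let ?I = "PIdl\<^bsub>R\<^esub> relation"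
  have H: "group ?H" by (rule G.subgroup_imp_group[OF adic_act_range_subgroup])
  interpret h: group_hom "add_monoid R" ?H adic_act
    using H R.a_group
    by (intro group_hom.intro group_hom_axioms.intro homI) (simp_all add: adic_act_add)
  have "kernel (add_monoid R) ?H adic_act = ?I"
  proof
    show "kernel (add_monoid R) ?H adic_act \<subseteq> ?I"
    proof
      fix p assume "p \<in> kernel (add_monoid R) ?H adic_act"
      then have "p \<in> carrier R" "adic_act p = id" by (simp_all add: kernel_def)
      then obtain s where "s \<in> carrier R" "p = s \<otimes>\<^bsub>R\<^esub> relation" by (rule adic_act_kernel)
      then show "p \<in> ?I" unfolding cgenideal_def by blast
    qed
    show "?I \<subseteq> kernel (add_monoid R) ?H adic_act"
    proof
      fix p assume "p \<in> ?I"
      then obtain s where "s \<in> carrier R" "p = s \<otimes>\<^bsub>R\<^esub> relation" unfolding cgenideal_def by blast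
      then show "p \<in> kernel (add_monoid R) ?H adic_act"
        using adic_act_multiple_of_relation relation_closed by (simp add: kernel_def)
    qed
  qed
  then have "add_monoid R Mod ?I \<cong> ?H"
    using h.FactGroup_iso by simp
  moreover have "add_monoid R Mod ?I = add_monoid (R Quot ?I)"
    by (simp add: FactGroup_def FactRing_def A_RCOSETS_def set_add_def)
  moreover have "group (add_monoid R Mod ?I)"
    using \<open>kernel (add_monoid R) ?H adic_act = ?I\<close> h.normal_kernel normal.factorgroup_is_group by metis
  ultimately show ?thesis
    unfolding root_gen_diag_top_closure using group.iso_sym by metis
qed

theorem recursion_structure:
  assumes "tree_rec m q (cycle_of_list [1..<Suc m]) \<alpha>"
  shows "comm_group (\<A>\<lparr>carrier := elt_state_closure m \<alpha>\<rparr>)"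
    and "transitive_on_level1 m (elt_state_closure m \<alpha>)"
    and "\<A>\<lparr>carrier := diag_top_closure m (elt_state_closure m \<alpha>)\<rparr>
      \<cong> add_monoid (R Quot (PIdl\<^bsub>R\<^esub> relation))"
proof -
  have \<alpha>: "\<alpha> = root_gen" by (rule tree_rec_unique[OF q assms tree_rec_root_gen])
  note A = root_gen_state_closure(2)[unfolded state_abelian_def]
  show "comm_group (\<A>\<lparr>carrier := elt_state_closure m \<alpha>\<rparr>)"
    unfolding \<alpha> using A by (intro comm_group_if_commutes) blast+
  show "transitive_on_level1 m (elt_state_closure m \<alpha>)"
    unfolding \<alpha> by (rule root_gen_state_closure)
  show "\<A>\<lparr>carrier := diag_top_closure m (elt_state_closure m \<alpha>)\<rparr>
      \<cong> add_monoid (R Quot (PIdl\<^bsub>R\<^esub> relation))"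
    unfolding \<alpha> by (rule root_gen_quotient_iso)
qed

end

context m_ary_tree
begin

text \<open>
  If \<open>a\<close> generates the module, then the root permutations of its elements are powers of that of \<open>a\<close>.
  Conversely, for a generator \<open>\<sigma>\<close> of \<open>P(A)\<close> choose \<open>\<alpha>\<close> in \<open>A\<close> with root permutation \<open>\<sigma>\<close>.  By the digit
  expansion every element of \<open>A\<^sup>*\<close> is a power of \<open>\<alpha>\<close>.  Applied to the states of \<open>\<alpha>\<close> this is the
  recursion, and applied to all of \<open>A\<^sup>*\<close> it shows that \<open>\<alpha>\<close> already produces \<open>A\<^sup>*\<close>.
\<close>

theorem cyclic_module_structure:
  assumes A: "state_closed m A" "transitive_on_level1 m A" "comm_group (\<A>\<lparr>carrier := A\<rparr>)"
  shows "cyclic_module R (closure_module m A) \<Longrightarrow>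
      cyclic_group (sym_group m\<lparr>carrier := perm_group m A\<rparr>)"
    and "\<sigma> \<in> perm_group m A \<Longrightarrow> generate (sym_group m) {\<sigma>} = perm_group m A \<Longrightarrow>
      \<exists>q \<in> Y \<rightarrow> carrier R. \<exists>\<alpha>. tree_rec m q \<sigma> \<alpha> \<and>
        diag_top_closure m A = diag_top_closure m (elt_state_closure m \<alpha>)"
proof -
  interpret S: group "sym_group m" by (rule sym_group_is_group)
  let ?C = "diag_top_closure m A"
  let ?P = "perm_group m A"
  have ab: "state_abelian A" by (rule state_abelianI[OF A(1,3)])
  interpret C: closed_abelian m ?C by (rule closed_abelian_diag_top_closure[OF ab A(2)])
  have sub: "subgroup A \<A>" using A(1) by (simp add: state_closed_iff)
  have incl: "A \<subseteq> ?C" by (rule diag_top_closure_incl[OF subgroup.subset[OF sub]])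
  have P: "perm_group m ?C = ?P" by (rule perm_group_diag_top_closure[OF sub])
  have P_sub: "subgroup ?P (sym_group m)" by (rule perm_group_subgroup[OF sub])
  interpret P: group "sym_group m\<lparr>carrier := ?P\<rparr>" by (rule S.subgroup_imp_group[OF P_sub])
  show "cyclic_group (sym_group m\<lparr>carrier := ?P\<rparr>)" if "cyclic_module R (closure_module m A)"
  proof -
    from that obtain a where a: "a \<in> ?C" "?C = {fps_pow m a q | q. q \<in> carrier R}"
      unfolding cyclic_module_def closure_module_def by auto
    have root: "rt a \<in> ?P" using a(1) P by (auto simp: perm_group_def)
    have "?P = range (\<lambda>n::int. rt a [^]\<^bsub>sym_group m\<^esub> n)"
    proof
      show "range (\<lambda>n::int. rt a [^]\<^bsub>sym_group m\<^esub> n) \<subseteq> ?P"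
        using S.subgroup_int_pow_closed[OF P_sub root] by blast
      show "?P \<subseteq> range (\<lambda>n::int. rt a [^]\<^bsub>sym_group m\<^esub> n)"
      proof
        fix \<pi> assume "\<pi> \<in> ?P"
        then obtain \<beta> where \<beta>: "\<pi> = rt \<beta>" "\<beta> \<in> ?C" using incl unfolding perm_group_def by blast
        then obtain q where q: "q \<in> carrier R" "\<beta> = fps_pow m a q" using a(2) by blast
        obtain \<beta>' where "has_fps_pow m a q \<beta>'" using C.fps_pow_exists[OF a(1) q(1)] by blast
        with q a(1) have "has_fps_pow m a q \<beta>" using fps_pow_eq by (metis C.in_carrier)
        then obtain n :: int where "rt \<beta> = rt (a [^]\<^bsub>\<A>\<^esub> n)"
          using root_perm_fps_pow a(1) q(1) C.in_carrier by metis
        then show "\<pi> \<in> range (\<lambda>n::int. rt a [^]\<^bsub>sym_group m\<^esub> n)"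
          using \<beta>(1) root_perm_int_pow[OF C.in_carrier[OF a(1)]] by simp
      qed
    qed
    then show ?thesis
      using root S.int_pow_consistent[OF P_sub root]
      by (intro P.cyclic_group[THEN iffD2] bexI[of _ "rt a"]) simp_all
  qed
  assume \<sigma>: "\<sigma> \<in> ?P" "generate (sym_group m) {\<sigma>} = ?P"
  then obtain \<alpha> where \<alpha>: "\<alpha> \<in> A" "rt \<alpha> = \<sigma>" unfolding perm_group_def by blast
  have \<alpha>C: "\<alpha> \<in> ?C" using \<alpha>(1) incl by blast
  have \<alpha>_aut: "\<alpha> \<in> carrier \<A>" using \<alpha>C by simp
  have roots: "\<exists>n::int. rt \<beta> = rt (\<alpha> [^]\<^bsub>\<A>\<^esub> n)" if "\<beta> \<in> ?C" for \<beta>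
  proof -
    have "rt \<beta> \<in> generate (sym_group m) {\<sigma>}" using that \<sigma>(2) P unfolding perm_group_def by blast
    then obtain n :: int where "rt \<beta> = \<sigma> [^]\<^bsub>sym_group m\<^esub> n"
      using S.generate_pow subgroup.mem_carrier[OF P_sub \<sigma>(1)] by blast
    then show ?thesis using root_perm_int_pow[OF \<alpha>_aut] \<alpha>(2) by metis
  qed
  have pow: "\<exists>q\<in>carrier R. has_fps_pow m \<alpha> q \<beta>" if "\<beta> \<in> ?C" for \<beta>
    using C.fps_pow_generates[OF \<alpha>C roots that] by blast
  then have "\<forall>y\<in>Y. \<exists>q. q \<in> carrier R \<and> has_fps_pow m \<alpha> q (cmp \<alpha> y)"
    using C.comp_closed[OF \<alpha>C] by blast
  from bchoice[OF this]
  obtain q where q: "\<And>y. y \<in> Y \<Longrightarrow> q y \<in> carrier R \<and> has_fps_pow m \<alpha> (q y) (cmp \<alpha> y)" by blast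
  have rec: "tree_rec m q \<sigma> \<alpha>"
    unfolding tree_rec_def
  proof (intro conjI exI[of _ "cmp \<alpha>"] ballI)
    show "\<alpha> = tree_cons m (cmp \<alpha>) \<sigma>" using tree_cons_root_comp[OF \<alpha>_aut] \<alpha>(2) by simp
  qed (use q \<alpha>_aut in auto)
  let ?B = "elt_state_closure m \<alpha>"
  note B = elt_state_closure[OF \<alpha>_aut]
  have B_carrier: "?B \<subseteq> carrier \<A>" using B(2) subgroup.subset unfolding state_closed_iff by blast
  have "?B \<subseteq> ?C" using B(3)[OF A(1) \<alpha>(1)] incl by blast
  then have "diag_top_closure m ?B \<subseteq> ?C"
    by (rule diag_top_closure_minimal[OF C.diag_top_closed])
  moreover have "?C \<subseteq> diag_top_closure m ?B"
  proof
    fix \<beta> assume "\<beta> \<in> ?C"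
    then obtain p where p: "p \<in> carrier R" "has_fps_pow m \<alpha> p \<beta>" using pow by blast
    have "\<alpha> \<in> diag_top_closure m ?B" using diag_top_closure_incl[OF B_carrier] B(1) by blast
    then show "\<beta> \<in> diag_top_closure m ?B"
      using diag_top_closed_fps_pow[OF diag_top_closed_diag_top_closure[OF B_carrier] _ p] by blast
  qed
  ultimately have "?C = diag_top_closure m ?B" by blast
  moreover have "q \<in> Y \<rightarrow> carrier R" using q by blast
  ultimately show "\<exists>q \<in> Y \<rightarrow> carrier R. \<exists>\<alpha>. tree_rec m q \<sigma> \<alpha> \<and>
      ?C = diag_top_closure m (elt_state_closure m \<alpha>)" using rec by blast
qed

end

theorem theorem3:
  fixes m :: nat
  assumes "m \<ge> 2"
  shows
    "(\<forall>q \<in> {1..m} \<rightarrow> carrier (madic_fps m).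
        (\<exists>!\<alpha>. tree_rec m q (cycle_of_list [1..<Suc m]) \<alpha>) \<and>
        (\<forall>\<alpha>. tree_rec m q (cycle_of_list [1..<Suc m]) \<alpha> \<longrightarrow>
          (let A = elt_state_closure m \<alpha>;
               R = madic_fps m;
               r = ([m] \<cdot>\<^bsub>R\<^esub> \<one>\<^bsub>R\<^esub>)
                     \<ominus>\<^bsub>R\<^esub> (fps_var (madic_ring m) \<otimes>\<^bsub>R\<^esub> (\<Oplus>\<^bsub>R\<^esub>i\<in>{1..m}. q i))
           in comm_group (tree_aut m\<lparr>carrier := A\<rparr>) \<and>
              transitive_on_level1 m A \<and>
              (tree_aut m\<lparr>carrier := diag_top_closure m A\<rparr>)
                \<cong> add_monoid (R Quot (PIdl\<^bsub>R\<^esub> r)))))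
     \<and>
     (\<forall>A. state_closed m A \<and> transitive_on_level1 m A \<and>
          comm_group (tree_aut m\<lparr>carrier := A\<rparr>) \<and>
          cyclic_module (madic_fps m) (closure_module m A) \<longrightarrow>
        cyclic_group (sym_group m\<lparr>carrier := perm_group m A\<rparr>) \<and>
        (\<forall>\<sigma>\<in>perm_group m A. generate (sym_group m) {\<sigma>} = perm_group m A \<longrightarrow>
          (\<exists>q \<in> {1..m} \<rightarrow> carrier (madic_fps m). \<exists>\<alpha>. tree_rec m q \<sigma> \<alpha> \<and>
             diag_top_closure m A = diag_top_closure m (elt_state_closure m \<alpha>))))"
proof (intro conjI ballI allI impI)
  interpret m_ary_tree m by unfold_locales (rule assms)
  let ?\<sigma> = "cycle_of_list [1..<Suc m]"
  {
    fix q assume q: "q \<in> {1..m} \<rightarrow> carrier (madic_fps m)"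
    interpret tree_recursion m q by unfold_locales (rule q)
    show "\<exists>!\<alpha>. tree_rec m q ?\<sigma> \<alpha>"
      using tree_rec_root_gen tree_rec_unique[OF q] by blast
    fix \<alpha> assume "tree_rec m q ?\<sigma> \<alpha>"
    from recursion_structure[OF this] show "let A = elt_state_closure m \<alpha>;
               R = madic_fps m;
               r = ([m] \<cdot>\<^bsub>R\<^esub> \<one>\<^bsub>R\<^esub>)
                     \<ominus>\<^bsub>R\<^esub> (fps_var (madic_ring m) \<otimes>\<^bsub>R\<^esub> (\<Oplus>\<^bsub>R\<^esub>i\<in>{1..m}. q i))
           in comm_group (tree_aut m\<lparr>carrier := A\<rparr>) \<and>
              transitive_on_level1 m A \<and>
              (tree_aut m\<lparr>carrier := diag_top_closure m A\<rparr>)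
                \<cong> add_monoid (R Quot (PIdl\<^bsub>R\<^esub> r))"
      unfolding Let_def relation_def by blast
  }
  {
    fix A assume A: "state_closed m A \<and> transitive_on_level1 m A \<and>
          comm_group (tree_aut m\<lparr>carrier := A\<rparr>) \<and>
          cyclic_module (madic_fps m) (closure_module m A)"
    then show "cyclic_group (sym_group m\<lparr>carrier := perm_group m A\<rparr>)"
      using cyclic_module_structure(1) by blast
    fix \<sigma> assume "\<sigma> \<in> perm_group m A" "generate (sym_group m) {\<sigma>} = perm_group m A"
    with A show "\<exists>q \<in> {1..m} \<rightarrow> carrier (madic_fps m). \<exists>\<alpha>. tree_rec m q \<sigma> \<alpha> \<and>
             diag_top_closure m A = diag_top_closure m (elt_state_closure m \<alpha>)"
      using cyclic_module_structure(2) by blast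
  }
qed

end
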